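(* Let $\Omega=\mathbb R^{\mathbb Z}$, let $\sigma$ be the shift $(\sigma x)_n=x_{n+1}$, let $X_n(x)=x_n$ be the coordinate functions and $F=X_0$. Let $\mu$ be the centered Gaussian $\sigma$-invariant probability measure on $\Omega$ determined by a strictly positive definite real sequence $(r(n))_{n\in\mathbb Z}$ with $r(-n)=r(n)$, i.e. $\int x_ix_j\,d\mu=r(i-j)$, and let $\nu$ be its spectral measure on the unit circle, $\hat\nu(n)=r(n)$. Let $P_n$, $Q_n$ and $Q$ denote the orthogonal projections in $L^2(\mu)$ onto the (closed) linear spans of $\{X_1,\dots,X_n\}$, $\{X_{-n+1},\dots,X_{-1}\}$ and $\{X_{-1},X_{-2},\dots\}$ respectively. Then: a) $$Se(F,\sigma)=\tfrac12\log(2\pi)+\log\|F-QF\|_2+\tfrac12=\tfrac12\log(2\pi)+\tfrac12\int\log f\,d\lambda+\tfrac12,$$ where $f$ is the density of (the absolutely continuous part of) $\nu$ with respect to $\lambda$. In particular, if $\|F-QF\|_2=0$ then $Se(F,\sigma)=-\infty$. b) If $\|F-QF\|_2>0$, the following are equivalent, where throughout convergence is meant almost everywhere [respectively, throughout, in $L^1(\mu)$]: (i) the Shannon information $\frac1n\mathcal I_n(F)$ converges; (ii) $\frac1N\sum_{j=1}^{N-1}(F-P_jF)^2\circ\sigma^{N-j}$ converges as $N\to\infty$; (iii) $\frac1N\sum_{j=1}^{N-1}(F-P_jF)^2\circ\sigma^{-j}$ converges as $N\to\infty$; (iv) $\frac1N\sum_{j=1}^{N-1}(F-Q_jF)^2\circ\sigma^{j}$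 converges as $N\to\infty$; (v) $\frac1N\sum_{n=2}^{N}\log\frac{\rho_n(x)}{\rho_n(\sigma x)}$ converges as $N\to\infty$.
   Context: $\lambda$ is normalized Lebesgue measure on the unit circle; the spectral measure $\nu$ is the finite positive measure on the circle with Fourier coefficients $r(n)$ (a probability measure if $r(0)=1$). $\rho_n$ is the density of the law of $(X_0,\dots,X_{n-1})$ with respect to Lebesgue measure on $\mathbb R^n$, $\rho_n(x_0,\dots,x_{n-1})=(2\pi)^{-n/2}(\det R_n)^{-1/2}\exp\left(-\frac12\sum_{i,j}(R_n^{-1})_{ij}x_ix_j\right)$ with $(R_n)_{ij}=r(i-j)$, $0\le i,j\le n-1$; for $x\in\Omega$, $\rho_n(x)$ means $\rho_n(x_0,\dots,x_{n-1})$. The information function is $\mathcal I_n(F)(x)=-\log\rho_n(x)$, $H_n(F)=\int\mathcal I_n(F)\,d\mu$, and the Shannon entropy is $Se(F,\sigma)=\lim_n\frac1nH_n(F)\in[-\infty,\infty)$. Convention $\log 0=-\infty$; $Q_1=0$. *)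

theory Defs
  imports
    "HOL-Probability.Probability"
    "Jordan_Normal_Form.Gauss_Jordan_Elimination"
    "Jordan_Normal_Form.Determinant"
begin

section \<open>The shift on \<open>\<real>\<^sup>\<int>\<close> and Gaussian shift-invariant measures\<close>

definition seq_space :: "(int \<Rightarrow> real) measure" where
  "seq_space = (\<Pi>\<^sub>M n\<in>UNIV. borel)"

definition shift :: "(int \<Rightarrow> real) \<Rightarrow> (int \<Rightarrow> real)" where
  "shift x = (\<lambda>n. x (n + 1))"

definition coord :: "int \<Rightarrow> (int \<Rightarrow> real) \<Rightarrow> real" where
  "coord n x = x n"

definition strictly_posdef :: "(int \<Rightarrow> real) \<Rightarrow> bool" where
  "strictly_posdef r \<longleftrightarrow>
     (\<forall>K c. finite K \<longrightarrow> (\<exists>k\<in>K. c k \<noteq> 0) \<longrightarrow>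
        (\<Sum>i\<in>K. \<Sum>j\<in>K. c i * c j * r (i - j)) > 0)"

text \<open>A real random variable is centered Gaussian if it is constantly \<open>0\<close> (a.e.) or has a
  centered normal density; a measure on sequences is centered Gaussian if all finite linear
  combinations of the coordinates are.\<close>

definition centered_gaussian_rv :: "'a measure \<Rightarrow> ('a \<Rightarrow> real) \<Rightarrow> bool" where
  "centered_gaussian_rv M Y \<longleftrightarrow>
     Y \<in> borel_measurable M \<and>
     ((AE x in M. Y x = 0) \<or> (\<exists>s>0. distributed M lborel Y (\<lambda>t. ennreal (normal_density 0 s t))))"

definition centered_gaussian :: "(int \<Rightarrow> real) measure \<Rightarrow> bool" where
  "centered_gaussian \<mu> \<longleftrightarrow>
     (\<forall>K c. finite K \<longrightarrow> centered_gaussian_rv \<mu> (\<lambda>x. \<Sum>k\<in>K. c k * coord k x))"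

definition shift_invariant :: "(int \<Rightarrow> real) measure \<Rightarrow> bool" where
  "shift_invariant \<mu> \<longleftrightarrow> shift \<in> measurable \<mu> \<mu> \<and> distr \<mu> \<mu> shift = \<mu>"

definition has_covariance :: "(int \<Rightarrow> real) measure \<Rightarrow> (int \<Rightarrow> real) \<Rightarrow> bool" where
  "has_covariance \<mu> r \<longleftrightarrow>
     (\<forall>i j. integrable \<mu> (\<lambda>x. coord i x * coord j x) \<and>
            (\<integral>x. coord i x * coord j x \<partial>\<mu>) = r (i - j))"


section \<open>Spectral measure\<close>

definition circle_lebesgue :: "complex measure" where
  "circle_lebesgue =
     distr (uniform_measure lborel {0..2 * pi}) (restrict_space borel (sphere 0 1)) cis"

definition fourier_coeff :: "complex measure \<Rightarrow> int \<Rightarrow> complex" where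
  "fourier_coeff \<nu> n = (\<integral>z. z powi (- n) \<partial>\<nu>)"

definition is_spectral_measure :: "(int \<Rightarrow> real) \<Rightarrow> complex measure \<Rightarrow> bool" where
  "is_spectral_measure r \<nu> \<longleftrightarrow>
     finite_measure \<nu> \<and> sets \<nu> = sets circle_lebesgue \<and>
     (\<forall>n. fourier_coeff \<nu> n = complex_of_real (r n))"

definition mutually_singular :: "'a measure \<Rightarrow> 'a measure \<Rightarrow> bool" where
  "mutually_singular M N \<longleftrightarrow>
     sets M = sets N \<and> (\<exists>A\<in>sets M. emeasure M A = 0 \<and> emeasure N (space N - A) = 0)"

text \<open>The library's \<open>RN_deriv\<close> is meaningful only for absolutely continuous measures, hence the
  density of the absolutely continuous part is expressed by the Lebesgue decomposition.\<close>

definition is_ac_density :: "'a measure \<Rightarrow> 'a measure \<Rightarrow> ('a \<Rightarrow> real) \<Rightarrow> bool" where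
  "is_ac_density M N f \<longleftrightarrow>
     f \<in> borel_measurable M \<and> (\<forall>x\<in>space M. 0 \<le> f x) \<and>
     (\<exists>S. mutually_singular S M \<and>
        (\<forall>A\<in>sets M. emeasure N A = emeasure (density M (\<lambda>x. ennreal (f x))) A + emeasure S A))"

text \<open>Logarithm of a nonnegative real with the convention \<open>log 0 = -\<infinity>\<close>.\<close>

definition ext_ln :: "real \<Rightarrow> ereal" where
  "ext_ln t = (if t = 0 then -\<infinity> else ereal (ln t))"

text \<open>Integral of the positive part minus integral of the negative part (\<open>e2ennreal\<close> sends
  negative values to \<open>0\<close>); meaningful as soon as one of the two is finite. This is always the case
  for \<open>log f\<close> with \<open>f\<close> nonnegative and integrable, since then \<open>log f \<le> f\<close>.\<close>

definition ext_integral :: "'a measure \<Rightarrow> ('a \<Rightarrow> ereal) \<Rightarrow> ereal" where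
  "ext_integral M g =
     enn2ereal (\<integral>\<^sup>+x. e2ennreal (g x) \<partial>M) - enn2ereal (\<integral>\<^sup>+x. e2ennreal (- g x) \<partial>M)"


section \<open>Densities, information and Shannon entropy\<close>

definition cov_mat :: "(int \<Rightarrow> real) \<Rightarrow> nat \<Rightarrow> real Matrix.mat" where
  "cov_mat r n = Matrix.mat n n (\<lambda>(i, j). r (int i - int j))"

definition gauss_density :: "(int \<Rightarrow> real) \<Rightarrow> nat \<Rightarrow> (int \<Rightarrow> real) \<Rightarrow> real" where
  "gauss_density r n x =
     (2 * pi) powr (- real n / 2) * Determinant.det (cov_mat r n) powr (- 1 / 2) *
     exp (- (1 / 2) * (\<Sum>i<n. \<Sum>j<n.
        the (mat_inverse (cov_mat r n)) $$ (i, j) * coord (int i) x * coord (int j) x))"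

definition information :: "(int \<Rightarrow> real) \<Rightarrow> nat \<Rightarrow> (int \<Rightarrow> real) \<Rightarrow> real" where
  "information r n x = - ln (gauss_density r n x)"

definition block_entropy :: "(int \<Rightarrow> real) measure \<Rightarrow> (int \<Rightarrow> real) \<Rightarrow> nat \<Rightarrow> real" where
  "block_entropy \<mu> r n = (\<integral>x. information r n x \<partial>\<mu>)"

definition shannon_entropy :: "(int \<Rightarrow> real) measure \<Rightarrow> (int \<Rightarrow> real) \<Rightarrow> ereal" where
  "shannon_entropy \<mu> r = lim (\<lambda>n. ereal (block_entropy \<mu> r n / real n))"


section \<open>Orthogonal projections in \<open>L\<^sup>2\<close>\<close>

text \<open>Elements of \<open>L\<^sup>2\<close> are represented by square-integrable functions.\<close>

definition square_integrable :: "'a measure \<Rightarrow> ('a \<Rightarrow> real) set" where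
  "square_integrable M = {g \<in> borel_measurable M. integrable M (\<lambda>x. (g x)\<^sup>2)}"

definition norm2 :: "'a measure \<Rightarrow> ('a \<Rightarrow> real) \<Rightarrow> real" where
  "norm2 M g = sqrt (\<integral>x. (g x)\<^sup>2 \<partial>M)"

definition coord_span :: "int set \<Rightarrow> ((int \<Rightarrow> real) \<Rightarrow> real) set" where
  "coord_span I = {(\<lambda>x. \<Sum>k\<in>K. c k * coord k x) | K c. finite K \<and> K \<subseteq> I}"

definition closed_coord_span ::
  "(int \<Rightarrow> real) measure \<Rightarrow> int set \<Rightarrow> ((int \<Rightarrow> real) \<Rightarrow> real) set" where
  "closed_coord_span \<mu> I =
     {h \<in> square_integrable \<mu>. \<forall>e>0. \<exists>g\<in>coord_span I. norm2 \<mu> (\<lambda>x. h x - g x) < e}"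

text \<open>\<open>T\<close> selects, for each square-integrable \<open>f\<close>, a representative of the projection of the class
  of \<open>f\<close> onto the closed subspace \<open>V\<close>; it is determined up to equality almost everywhere.\<close>

definition is_orth_projection ::
  "'a measure \<Rightarrow> ('a \<Rightarrow> real) set \<Rightarrow> (('a \<Rightarrow> real) \<Rightarrow> ('a \<Rightarrow> real)) \<Rightarrow> bool" where
  "is_orth_projection M V T \<longleftrightarrow>
     (\<forall>f\<in>square_integrable M. T f \<in> V \<and> (\<forall>g\<in>V. (\<integral>x. (f x - T f x) * g x \<partial>M) = 0))"


section \<open>Modes of convergence\<close>

definition converges_AE :: "'a measure \<Rightarrow> (nat \<Rightarrow> 'a \<Rightarrow> real) \<Rightarrow> bool" where
  "converges_AE M g \<longleftrightarrow> (AE x in M. convergent (\<lambda>n. g n x))"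

definition converges_L1 :: "'a measure \<Rightarrow> (nat \<Rightarrow> 'a \<Rightarrow> real) \<Rightarrow> bool" where
  "converges_L1 M g \<longleftrightarrow>
     (\<forall>n. integrable M (g n)) \<and>
     (\<exists>h. integrable M h \<and> (\<lambda>n. \<integral>x. \<bar>g n x - h x\<bar> \<partial>M) \<longlonglongrightarrow> 0)"

end

(*
  Prediction residuals of a Gaussian sequence are orthogonal along any exhaustion of an interval
  from one end. Normalized, they form orthonormal bases of the span of X_0, ..., X_(n-1), so
  det R_n is the product of the prediction errors d_k, and the quadratic form of R_n^(-1) is the
  sum of the squares of the normalized residuals, for every such exhaustion. Hence
    -log rho_n = n/2 log(2 pi) + 1/2 sum log d_k + 1/2 sum (residual_k)^2 / d_k,
  and d_k decreases to S = |F - QF|^2, which gives the first formula for the entropy.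

  If S > 0, each of (i) - (v) in fact converges, a.e. and in L^1. A centered Gaussian variable Y has
  E Y^4 = 3 (E Y^2)^2; by polarization, orthogonal Y, Z satisfy E Y^2 Z^2 = E Y^2 E Z^2. So the squares
  of the residuals have uncorrelated fluctuations and obey the strong law, which settles (i), (iii)
  and (iv). In (ii) the residuals change with N, but weighted by 1/d_j their squares add up to the
  same quadratic form as in (i), and d_j -> S. In (v) the log ratio is half of the difference of two
  squared normalized residuals, of X_n given X_0, ..., X_(n-1) and of X_0 given X_1, ..., X_n; the latter
  converges a.e. by a maximal inequality that needs only fourth moments.

  Szego's theorem S = exp (int log f): S is the infimum of int |p|^2 d nu over polynomials with
  p(0) = 1. Taking p close to exp((q(0) - q)/2) gives S <= exp(int h) int exp(-h) d nu for h = Re q,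
  and |int p exp(q/2)|^2 <= int |p|^2 exp(h) gives exp(int h) <= int |p|^2 exp(h). Both extend to bounded
  Borel h, in particular to the logarithm of the truncated density, with h arbitrarily large on the
  null set that carries the singular part.
*)
theory Submission
  imports Defs "HOL-Library.Discrete_Functions"
begin

text \<open>Two devices keep null sets out of the algebra. By strict positive definiteness a linear
  combination of coordinates with second moment 0 vanishes as a function, so residuals and the
  identities among them hold pointwise; exceptional sets enter only with limits and with the
  representatives chosen by P and Q. And \<open>conv_to\<close> carries a.e. and L^1 convergence to
  one limit together, so both readings of b) have one proof. Two elementary sources of a.e.
  convergence suffice. For averages of squares the variance of the N-th sum is at most linear in N,
  so the errors along N = k^2 are summable and nonnegative terms fill the gaps. For one residual
  given more and more coordinates, the fourth moment of an increment is 3 (d_i - d_j)^2; since the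
  exponent 2 exceeds 1, bisecting the variance gives a maximal inequality without a logarithm. In
  Szego's theorem the logarithm of the truncated density is only bounded Borel. It is approximated
  by Re q boundedly and a.e. for the spectral measure and Lebesgue measure at once, because the
  upper bound mixes integrals over both.\<close>

section \<open>Convergence almost everywhere and in mean\<close>

text \<open>Monotone convergence makes the series of the \<open>g n\<close> integrable, hence finite
  almost everywhere. This takes the place of Borel-Cantelli wherever moments are summable.\<close>

lemma AE_tendsto_zero_of_summable:
  fixes g :: "nat \<Rightarrow> 'a \<Rightarrow> real"
  assumes int: "\<And>n. integrable M (g n)" and nonneg: "\<And>n x. 0 \<le> g n x"
    and sm: "summable (\<lambda>n. \<integral>x. g n x \<partial>M)"
  shows "AE x in M. (\<lambda>n. g n x) \<longlonglongrightarrow> 0"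
proof -
  have [measurable]: "\<And>n. g n \<in> borel_measurable M" using int by auto
  have "(\<integral>\<^sup>+x. (\<Sum>n. ennreal (g n x)) \<partial>M) = (\<Sum>n. \<integral>\<^sup>+x. ennreal (g n x) \<partial>M)"
    by (rule nn_integral_suminf) auto
  also have "\<dots> = (\<Sum>n. ennreal (\<integral>x. g n x \<partial>M))"
    using int nonneg by (simp add: nn_integral_eq_integral)
  also have "\<dots> = ennreal (\<Sum>n. \<integral>x. g n x \<partial>M)"
    by (rule suminf_ennreal2) (use sm nonneg in auto)
  finally have "(\<integral>\<^sup>+x. (\<Sum>n. ennreal (g n x)) \<partial>M) \<noteq> \<infinity>" by simp
  then have "AE x in M. (\<Sum>n. ennreal (g n x)) \<noteq> \<infinity>"
    by (intro nn_integral_PInf_AE) auto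
  then show ?thesis
  proof eventually_elim
    case (elim x)
    then have "summable (\<lambda>n. g n x)"
      using nonneg by (intro summable_suminf_not_top) auto
    then show ?case by (rule summable_LIMSEQ_zero)
  qed
qed

text \<open>Both modes are bundled with a common limit because each estimate below yields both;
  \<open>converges_AE\<close> and \<open>converges_L1\<close> are then read off.\<close>

definition conv_to :: "'a measure \<Rightarrow> (nat \<Rightarrow> 'a \<Rightarrow> real) \<Rightarrow> ('a \<Rightarrow> real) \<Rightarrow> bool" where
  "conv_to M g h \<longleftrightarrow> (\<forall>n. integrable M (g n)) \<and> integrable M h \<and>
     (AE x in M. (\<lambda>n. g n x) \<longlonglongrightarrow> h x) \<and> (\<lambda>n. \<integral>x. \<bar>g n x - h x\<bar> \<partial>M) \<longlonglongrightarrow> 0"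

lemma conv_to_AE: "conv_to M g h \<Longrightarrow> converges_AE M g"
  unfolding conv_to_def converges_AE_def by (auto simp: convergent_def elim!: AE_mp)

lemma conv_to_L1: "conv_to M g h \<Longrightarrow> converges_L1 M g"
  unfolding conv_to_def converges_L1_def by blast

lemma conv_toI_bound:
  assumes int: "\<And>n. integrable M (g n)" "integrable M h"
    and ae: "AE x in M. (\<lambda>n. g n x) \<longlonglongrightarrow> h x"
    and b: "\<And>n. (\<integral>x. \<bar>g n x - h x\<bar> \<partial>M) \<le> b n" "b \<longlonglongrightarrow> 0"
  shows "conv_to M g h"
proof -
  have "(\<lambda>n. \<integral>x. \<bar>g n x - h x\<bar> \<partial>M) \<longlonglongrightarrow> 0"
    by (rule tendsto_sandwich[OF _ _ tendsto_const b(2)]) (use b in auto)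
  then show ?thesis using int ae unfolding conv_to_def by auto
qed

lemma conv_to_add:
  assumes g: "conv_to M g h" and k: "conv_to M g' h'"
  shows "conv_to M (\<lambda>n x. g n x + g' n x) (\<lambda>x. h x + h' x)"
proof -
  have int [simp]: "integrable M (g n)" "integrable M h" "integrable M (g' n)" "integrable M h'" for n
    using g k by (auto simp: conv_to_def)
  show ?thesis
  proof (rule conv_toI_bound)
    show "AE x in M. (\<lambda>n. g n x + g' n x) \<longlonglongrightarrow> h x + h' x"
    proof -
      have "AE x in M. (\<lambda>n. g n x) \<longlonglongrightarrow> h x" "AE x in M. (\<lambda>n. g' n x) \<longlonglongrightarrow> h' x"
        using g k by (auto simp: conv_to_def)
      then show ?thesis by eventually_elim (rule tendsto_add)
    qed
    show "(\<integral>x. \<bar>g n x + g' n x - (h x + h' x)\<bar> \<partial>M) \<le>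
        (\<integral>x. \<bar>g n x - h x\<bar> \<partial>M) + (\<integral>x. \<bar>g' n x - h' x\<bar> \<partial>M)" for n
      by (subst Bochner_Integration.integral_add[symmetric]) (simp, simp, rule integral_mono, auto)
    show "(\<lambda>n. (\<integral>x. \<bar>g n x - h x\<bar> \<partial>M) + (\<integral>x. \<bar>g' n x - h' x\<bar> \<partial>M)) \<longlonglongrightarrow> 0"
      using tendsto_add[of "\<lambda>n. \<integral>x. \<bar>g n x - h x\<bar> \<partial>M" 0 _ "\<lambda>n. \<integral>x. \<bar>g' n x - h' x\<bar> \<partial>M" 0] g k
      by (auto simp: conv_to_def)
  qed auto
qed

text \<open>The factor may vary with n, which absorbs changes of normalization such as (n + 1) / n
  and 1 / d_n.\<close>

lemma conv_to_scale:
  assumes g: "conv_to M g h" and c: "c \<longlonglongrightarrow> (c0::real)"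
  shows "conv_to M (\<lambda>n x. c n * g n x) (\<lambda>x. c0 * h x)"
proof -
  have int [simp]: "integrable M (g n)" "integrable M h" for n
    using g by (auto simp: conv_to_def)
  show ?thesis
  proof (rule conv_toI_bound)
    have "AE x in M. (\<lambda>n. g n x) \<longlonglongrightarrow> h x" using g by (auto simp: conv_to_def)
    then show "AE x in M. (\<lambda>n. c n * g n x) \<longlonglongrightarrow> c0 * h x"
      by eventually_elim (intro tendsto_mult c)
    show "(\<integral>x. \<bar>c n * g n x - c0 * h x\<bar> \<partial>M) \<le>
        \<bar>c n\<bar> * (\<integral>x. \<bar>g n x - h x\<bar> \<partial>M) + \<bar>c n - c0\<bar> * (\<integral>x. \<bar>h x\<bar> \<partial>M)" (is "_ \<le> ?r") for n
    proof -
      have "\<bar>c n * g n x - c0 * h x\<bar> \<le> \<bar>c n\<bar> * \<bar>g n x - h x\<bar> + \<bar>c n - c0\<bar> * \<bar>h x\<bar>" for x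
      proof -
        have "c n * g n x - c0 * h x = c n * (g n x - h x) + (c n - c0) * h x"
          by (simp add: algebra_simps)
        then show ?thesis by (metis abs_mult abs_triangle_ineq)
      qed
      then have "(\<integral>x. \<bar>c n * g n x - c0 * h x\<bar> \<partial>M) \<le> (\<integral>x. \<bar>c n\<bar> * \<bar>g n x - h x\<bar> + \<bar>c n - c0\<bar> * \<bar>h x\<bar> \<partial>M)"
        by (intro integral_mono) auto
      also have "\<dots> = ?r" by simp
      finally show ?thesis .
    qed
    have "(\<lambda>n. \<bar>c n\<bar> * (\<integral>x. \<bar>g n x - h x\<bar> \<partial>M) + \<bar>c n - c0\<bar> * (\<integral>x. \<bar>h x\<bar> \<partial>M))
        \<longlonglongrightarrow> \<bar>c0\<bar> * 0 + \<bar>c0 - c0\<bar> * (\<integral>x. \<bar>h x\<bar> \<partial>M)"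
      using g by (intro tendsto_intros c) (auto simp: conv_to_def)
    then show "(\<lambda>n. \<bar>c n\<bar> * (\<integral>x. \<bar>g n x - h x\<bar> \<partial>M) + \<bar>c n - c0\<bar> * (\<integral>x. \<bar>h x\<bar> \<partial>M)) \<longlonglongrightarrow> 0"
      by simp
  qed auto
qed

lemma conv_to_diff:
  assumes g: "conv_to M g h" and k: "conv_to M g' h'"
  shows "conv_to M (\<lambda>n x. g n x - g' n x) (\<lambda>x. h x - h' x)"
  using conv_to_add[OF g conv_to_scale[OF k tendsto_const[of "-1"]]] by simp

lemma conv_to_const:
  assumes "prob_space M" and c: "c \<longlonglongrightarrow> (c0::real)"
  shows "conv_to M (\<lambda>n x. c n) (\<lambda>x. c0)"
proof -
  interpret prob_space M by fact
  have "(\<lambda>n. \<bar>c n - c0\<bar>) \<longlonglongrightarrow> 0"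
    using c by (simp add: LIM_zero tendsto_rabs_zero)
  then show ?thesis unfolding conv_to_def using c by (auto simp: prob_space)
qed

lemma conv_to_cong:
  assumes g: "conv_to M g h" and eq: "\<And>n. AE x in M. g' n x = g n x"
    and [measurable]: "\<And>n. g' n \<in> borel_measurable M"
  shows "conv_to M g' h"
proof -
  have [measurable]: "g n \<in> borel_measurable M" "h \<in> borel_measurable M" for n
    using g by (auto simp: conv_to_def)
  have ae: "AE x in M. \<forall>n. g' n x = g n x" using eq by (simp add: AE_all_countable)
  have "AE x in M. (\<lambda>n. g n x) \<longlonglongrightarrow> h x" using g by (auto simp: conv_to_def)
  with ae have 1: "AE x in M. (\<lambda>n. g' n x) \<longlonglongrightarrow> h x"
    by eventually_elim simp
  have 2: "integrable M (g' n)" for n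
    using g eq[of n] by (subst integrable_cong_AE[of _ _ "g n"]) (auto simp: conv_to_def)
  have 3: "(\<integral>x. \<bar>g' n x - h x\<bar> \<partial>M) = (\<integral>x. \<bar>g n x - h x\<bar> \<partial>M)" for n
    using eq[of n] by (intro integral_cong_AE) auto
  show ?thesis using g 1 2 3 by (auto simp: conv_to_def)
qed

lemma conv_to_eventually:
  assumes g: "conv_to M g h" and eq: "\<And>n x. n \<ge> n0 \<Longrightarrow> g' n x = g n x"
    and int: "\<And>n. integrable M (g' n)"
  shows "conv_to M g' h"
proof -
  have ev: "eventually (\<lambda>n. g n x = g' n x) sequentially" for x
    using eq by (auto simp: eventually_sequentially intro!: exI[of _ n0])
  have "AE x in M. (\<lambda>n. g n x) \<longlonglongrightarrow> h x" using g by (auto simp: conv_to_def)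
  then have 1: "AE x in M. (\<lambda>n. g' n x) \<longlonglongrightarrow> h x"
    by eventually_elim (rule Lim_transform_eventually[OF _ ev])
  have "eventually (\<lambda>n. (\<integral>x. \<bar>g n x - h x\<bar> \<partial>M) = (\<integral>x. \<bar>g' n x - h x\<bar> \<partial>M)) sequentially"
    using eq by (auto simp: eventually_sequentially intro!: exI[of _ n0])
  moreover have "(\<lambda>n. \<integral>x. \<bar>g n x - h x\<bar> \<partial>M) \<longlonglongrightarrow> 0" using g by (auto simp: conv_to_def)
  ultimately have "(\<lambda>n. \<integral>x. \<bar>g' n x - h x\<bar> \<partial>M) \<longlonglongrightarrow> 0"
    by (rule Lim_transform_eventually[rotated])
  then show ?thesis using g int 1 by (auto simp: conv_to_def)
qed

text \<open>Meant for errors that split into a small multiple of a convergent average and finitely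
  many negligible terms: the majorant may be a different sequence for each i, and only its limit has
  to become small with i.\<close>

lemma conv_to_zero_approx:
  assumes int: "\<And>n. integrable M (g n)"
    and ap: "\<And>i::nat. \<exists>k. conv_to M k (\<lambda>x. c / real (Suc i)) \<and> (\<forall>n x. \<bar>g n x\<bar> \<le> k n x)"
    and fin: "prob_space M"
  shows "conv_to M g (\<lambda>x. 0)"
proof -
  interpret prob_space M by fact
  obtain k where k: "\<And>i. conv_to M (k i) (\<lambda>x. c / real (Suc i))" and le: "\<And>i n x. \<bar>g n x\<bar> \<le> k i n x"
    using ap by metis
  have lim: "(\<lambda>i. c / real (Suc i)) \<longlonglongrightarrow> 0"
    by (rule LIMSEQ_Suc[OF lim_const_over_n])
  \<comment> \<open>The deterministic core, applied below once pointwise and once to the L^1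
    norms.\<close>
  have key: "u \<longlonglongrightarrow> 0"
    if "\<And>n. (0::real) \<le> u n" "\<And>i n. u n \<le> v i n" "\<And>i. v i \<longlonglongrightarrow> c / real (Suc i)" for u :: "nat \<Rightarrow> real" and v
  proof (rule LIMSEQ_I)
    fix e :: real assume "0 < e"
    then have "eventually (\<lambda>i. c / real (Suc i) < e) sequentially"
      by (rule order_tendstoD(2)[OF lim])
    then obtain i where i: "c / real (Suc i) < e" by (auto simp: eventually_sequentially)
    have "eventually (\<lambda>n. v i n < e) sequentially"
      using that(3) i by (rule order_tendstoD(2))
    then obtain n0 where n0: "\<And>n. n \<ge> n0 \<Longrightarrow> v i n < e" by (auto simp: eventually_sequentially)
    show "\<exists>no. \<forall>n\<ge>no. norm (u n - 0) < e"
    proof (intro exI allI impI)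
      fix n assume "n \<ge> n0"
      then show "norm (u n - 0) < e" using that(1)[of n] that(2)[of n i] n0[of n] by auto
    qed
  qed
  have "AE x in M. \<forall>i. (\<lambda>n. k i n x) \<longlonglongrightarrow> c / real (Suc i)"
    using k by (auto simp: conv_to_def AE_all_countable)
  then have ae: "AE x in M. (\<lambda>n. g n x) \<longlonglongrightarrow> 0"
  proof eventually_elim
    case (elim x)
    have "(\<lambda>n. \<bar>g n x\<bar>) \<longlonglongrightarrow> 0"
      by (rule key[of _ "\<lambda>i n. k i n x"]) (use elim le in auto)
    then show ?case by (rule tendsto_rabs_zero_cancel)
  qed
  have ik: "integrable M (k i n)" for i n using k by (auto simp: conv_to_def)
  have c': "c / real (Suc i) \<le> \<bar>c\<bar> / real (Suc i)" for i by (simp add: divide_right_mono)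
  have "(\<lambda>n. \<integral>x. \<bar>g n x\<bar> \<partial>M) \<longlonglongrightarrow> 0"
  proof (rule key)
    show "(\<integral>x. \<bar>g n x\<bar> \<partial>M) \<le> c / real (Suc i) + (\<integral>x. \<bar>k i n x - c / real (Suc i)\<bar> \<partial>M)" for i n
    proof -
      have "(\<integral>x. \<bar>g n x\<bar> \<partial>M) \<le> (\<integral>x. c / real (Suc i) + \<bar>k i n x - c / real (Suc i)\<bar> \<partial>M)"
      proof (intro integral_mono)
        fix x show "\<bar>g n x\<bar> \<le> c / real (Suc i) + \<bar>k i n x - c / real (Suc i)\<bar>"
          using le[of n x i] by linarith
      qed (use int ik in auto)
      also have "\<dots> = c / real (Suc i) + (\<integral>x. \<bar>k i n x - c / real (Suc i)\<bar> \<partial>M)"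
        using ik by (simp add: prob_space)
      finally show ?thesis .
    qed
    show "(\<lambda>n. c / real (Suc i) + (\<integral>x. \<bar>k i n x - c / real (Suc i)\<bar> \<partial>M)) \<longlonglongrightarrow> c / real (Suc i)" for i
      using tendsto_add[OF tendsto_const, of "\<lambda>n. \<integral>x. \<bar>k i n x - c / real (Suc i)\<bar> \<partial>M" 0 sequentially "c / real (Suc i)"] k
      by (auto simp: conv_to_def)
  qed auto
  with ae int show ?thesis by (auto simp: conv_to_def)
qed

section \<open>Moment bounds and the strong law\<close>

lemma integral_abs_le_sqrt:
  assumes "prob_space M" and [measurable]: "f \<in> borel_measurable M" and f2: "integrable M (\<lambda>x. (f x)\<^sup>2)"
  shows "integrable M (f :: 'a \<Rightarrow> real)" "(\<integral>x. \<bar>f x\<bar> \<partial>M) \<le> sqrt (\<integral>x. (f x)\<^sup>2 \<partial>M)"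
proof -
  interpret prob_space M by fact
  have a: "\<bar>t\<bar> \<le> 1 + t\<^sup>2" for t :: real
    using sum_squares_bound[of "\<bar>t\<bar>" 1] by (auto simp: power2_eq_square)
  show int: "integrable M f"
    by (rule Bochner_Integration.integrable_bound[of _ "\<lambda>x. 1 + (f x)\<^sup>2"]) (use f2 a in auto)
  have "(\<integral>x. \<bar>f x\<bar> \<partial>M)\<^sup>2 \<le> (\<integral>x. \<bar>f x\<bar>\<^sup>2 \<partial>M)"
  proof -
    let ?m = "\<integral>x. \<bar>f x\<bar> \<partial>M"
    have "0 \<le> (\<integral>x. (\<bar>f x\<bar> - ?m)\<^sup>2 \<partial>M)" by simp
    also have "\<dots> = (\<integral>x. \<bar>f x\<bar>\<^sup>2 - 2 * ?m * \<bar>f x\<bar> + ?m\<^sup>2 \<partial>M)"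
      by (simp add: power2_diff algebra_simps)
    also have "\<dots> = (\<integral>x. \<bar>f x\<bar>\<^sup>2 \<partial>M) - 2 * ?m * ?m + ?m\<^sup>2"
      using int f2 by (simp add: prob_space)
    finally show ?thesis by (simp add: power2_eq_square)
  qed
  then show "(\<integral>x. \<bar>f x\<bar> \<partial>M) \<le> sqrt (\<integral>x. (f x)\<^sup>2 \<partial>M)"
    by (intro real_le_rsqrt) simp
qed

text \<open>The second moment of \<open>(Y n x)^2 / n\<close> is at most C / n^2, which is summable.
  Nothing relates different n, so boundary terms that change with n are covered.\<close>

lemma conv_to_square_over_n:
  fixes Y :: "nat \<Rightarrow> 'a \<Rightarrow> real"
  assumes "prob_space M" and [measurable]: "\<And>n. Y n \<in> borel_measurable M"
    and i4: "\<And>n. integrable M (\<lambda>x. (Y n x)^4)"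
    and b: "\<And>n. (\<integral>x. (Y n x)^4 \<partial>M) \<le> C"
  shows "conv_to M (\<lambda>n x. (Y n x)\<^sup>2 / real n) (\<lambda>x. 0)"
proof -
  interpret prob_space M by fact
  have sq: "((Y n x)\<^sup>2)\<^sup>2 = (Y n x)^4" for n x by simp
  have i2: "integrable M (\<lambda>x. (Y n x)\<^sup>2)" "(\<integral>x. \<bar>(Y n x)\<^sup>2\<bar> \<partial>M) \<le> sqrt (\<integral>x. (Y n x)^4 \<partial>M)" for n
    using integral_abs_le_sqrt[OF \<open>prob_space M\<close>, of "\<lambda>x. (Y n x)\<^sup>2"] i4[of n] unfolding sq by auto
  have "AE x in M. (\<lambda>n. (Y n x)^4 / (real n)\<^sup>2) \<longlonglongrightarrow> 0"
  proof (rule AE_tendsto_zero_of_summable)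
    show "summable (\<lambda>n. \<integral>x. (Y n x)^4 / (real n)\<^sup>2 \<partial>M)"
    proof (rule summable_comparison_test')
      show "summable (\<lambda>n. C * (1 / (real n)^2))"
        by (intro summable_mult) (use inverse_power_summable[of 2, where ?'a = real] in \<open>simp add: field_simps\<close>)
      show "norm (\<integral>x. (Y n x)^4 / (real n)\<^sup>2 \<partial>M) \<le> C * (1 / (real n)^2)" for n
        using b[of n] by (simp add: divide_right_mono)
    qed
  qed (use i4 in auto)
  then have ae: "AE x in M. (\<lambda>n. (Y n x)\<^sup>2 / real n) \<longlonglongrightarrow> 0"
  proof eventually_elim
    case (elim x)
    have "(\<lambda>n. sqrt ((Y n x)^4 / (real n)\<^sup>2)) \<longlonglongrightarrow> 0"
      using tendsto_real_sqrt[OF elim] by simp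
    moreover have "sqrt ((Y n x)^4 / (real n)\<^sup>2) = (Y n x)\<^sup>2 / real n" for n
      by (rule real_sqrt_unique) (simp_all add: power_divide)
    ultimately show ?case by simp
  qed
  show ?thesis
  proof (rule conv_toI_bound[OF _ _ ae])
    show "(\<integral>x. \<bar>(Y n x)\<^sup>2 / real n - 0\<bar> \<partial>M) \<le> sqrt C / real n" for n
    proof -
      have "(\<integral>x. \<bar>(Y n x)\<^sup>2\<bar> \<partial>M) \<le> sqrt C"
        using i2(2)[of n] b[of n] by (meson order_trans real_sqrt_le_mono)
      then show ?thesis by (simp add: divide_right_mono)
    qed
    show "(\<lambda>n. sqrt C / real n) \<longlonglongrightarrow> 0" by (rule lim_const_over_n)
  qed (use i2 in auto)
qed

text \<open>Along N = k^2 the averages have variances at most C / k^2, which are summable. The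
  partial sums increase because the \<open>Z k\<close> are nonnegative, and consecutive squares have
  ratio tending to 1, so every other N is squeezed between two squares.\<close>

lemma slln_nonneg:
  fixes Z :: "nat \<Rightarrow> 'a \<Rightarrow> real"
  assumes "prob_space M" and [measurable]: "\<And>k. Z k \<in> borel_measurable M"
    and nonneg: "\<And>k x. 0 \<le> Z k x"
    and i2: "\<And>N. integrable M (\<lambda>x. ((\<Sum>k<N. Z k x) - (\<Sum>k<N. m k))\<^sup>2)"
    and var: "\<And>N. (\<integral>x. ((\<Sum>k<N. Z k x) - (\<Sum>k<N. m k))\<^sup>2 \<partial>M) \<le> C * real N"
    and mean: "(\<lambda>N. (\<Sum>k<N. m k) / real N) \<longlonglongrightarrow> c"
  shows "conv_to M (\<lambda>N x. (\<Sum>k<N. Z k x) / real N) (\<lambda>x. c)"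
proof -
  interpret prob_space M by fact
  define D where "D N x = (\<Sum>k<N. Z k x) - (\<Sum>k<N. m k)" for N x
  have [measurable]: "D N \<in> borel_measurable M" for N unfolding D_def by measurable
  have D2: "integrable M (\<lambda>x. (D N x)\<^sup>2)" "(\<integral>x. (D N x)\<^sup>2 \<partial>M) \<le> C * real N" for N
    using i2[of N] var[of N] by (auto simp: D_def)
  have D1: "integrable M (D N)" "(\<integral>x. \<bar>D N x\<bar> \<partial>M) \<le> sqrt (C * real N)" for N
    using integral_abs_le_sqrt[OF \<open>prob_space M\<close>, of "D N"] D2[of N]
    by (auto intro: order_trans[OF _ real_sqrt_le_mono])
  have intZ: "integrable M (\<lambda>x. \<Sum>k<N. Z k x)" for N
  proof -
    have "integrable M (\<lambda>x. D N x + (\<Sum>k<N. m k))" using D1 by auto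
    then show ?thesis by (simp add: D_def)
  qed
  have "AE x in M. (\<lambda>k. (D (k\<^sup>2) x)\<^sup>2 / (real (k\<^sup>2))\<^sup>2) \<longlonglongrightarrow> 0"
  proof (rule AE_tendsto_zero_of_summable)
    show "summable (\<lambda>k. \<integral>x. (D (k\<^sup>2) x)\<^sup>2 / (real (k\<^sup>2))\<^sup>2 \<partial>M)"
    proof (rule summable_comparison_test')
      show "summable (\<lambda>n. C * (1 / (real n)^2))"
        by (intro summable_mult) (use inverse_power_summable[of 2, where ?'a = real] in \<open>simp add: field_simps\<close>)
      show "norm (\<integral>x. (D (k\<^sup>2) x)\<^sup>2 / (real (k\<^sup>2))\<^sup>2 \<partial>M) \<le> C * (1 / (real k)^2)" for k
      proof (cases "k = 0")
        case False
        have "(\<integral>x. (D (k\<^sup>2) x)\<^sup>2 \<partial>M) / (real (k\<^sup>2))\<^sup>2 \<le> C * real (k\<^sup>2) / (real (k\<^sup>2))\<^sup>2"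
          by (rule divide_right_mono[OF D2(2)]) simp
        also have "\<dots> = C * (1 / (real k)^2)" using False by (simp add: power2_eq_square)
        finally show ?thesis by simp
      qed simp
    qed
  qed (use D2 in auto)
  then have ae: "AE x in M. (\<lambda>N. (\<Sum>k<N. Z k x) / real N) \<longlonglongrightarrow> c"
  proof eventually_elim
    case (elim x)
    let ?S = "\<lambda>N. \<Sum>k<N. Z k x"
    have mono: "?S a \<le> ?S b" if "a \<le> b" for a b
      using that nonneg by (intro sum_mono2) auto
    have S0: "0 \<le> ?S a" for a using nonneg by (simp add: sum_nonneg)
    have "(\<lambda>k. sqrt ((D (k\<^sup>2) x)\<^sup>2 / (real (k\<^sup>2))\<^sup>2)) \<longlonglongrightarrow> sqrt 0"
      by (rule tendsto_real_sqrt[OF elim])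
    then have "(\<lambda>k. \<bar>D (k\<^sup>2) x / real (k\<^sup>2)\<bar>) \<longlonglongrightarrow> 0"
      by (simp only: real_sqrt_divide real_sqrt_abs real_sqrt_zero abs_divide)
    then have a: "(\<lambda>k. D (k\<^sup>2) x / real (k\<^sup>2)) \<longlonglongrightarrow> 0" by (rule tendsto_rabs_zero_cancel)
    have fl: "filterlim (\<lambda>k::nat. k\<^sup>2) sequentially sequentially"
      by (rule filterlim_subseq) (auto simp: strict_mono_def power_strict_mono)
    have "(\<lambda>k. D (k\<^sup>2) x / real (k\<^sup>2) + (\<Sum>j<k\<^sup>2. m j) / real (k\<^sup>2)) \<longlonglongrightarrow> 0 + c"
      by (intro tendsto_add a filterlim_compose[OF mean fl])
    then have b: "(\<lambda>k. ?S (k\<^sup>2) / real (k\<^sup>2)) \<longlonglongrightarrow> c"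
      by (simp add: D_def diff_divide_distrib)
    have r: "(\<lambda>k. real (k\<^sup>2) / real ((Suc k)\<^sup>2)) \<longlonglongrightarrow> 1"
    proof -
      have "(\<lambda>k. (real k / real (Suc k))\<^sup>2) \<longlonglongrightarrow> 1\<^sup>2"
        by (intro tendsto_power LIMSEQ_n_over_Suc_n)
      then show ?thesis by (simp add: power_divide)
    qed
    have lo: "(\<lambda>k. ?S (k\<^sup>2) / real ((Suc k)\<^sup>2)) \<longlonglongrightarrow> c"
    proof -
      have "(\<lambda>k. ?S (k\<^sup>2) / real (k\<^sup>2) * (real (k\<^sup>2) / real ((Suc k)\<^sup>2))) \<longlonglongrightarrow> c * 1"
        by (intro tendsto_mult b r)
      moreover have "?S (k\<^sup>2) / real (k\<^sup>2) * (real (k\<^sup>2) / real ((Suc k)\<^sup>2)) = ?S (k\<^sup>2) / real ((Suc k)\<^sup>2)" for k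
        by (cases "k = 0") auto
      ultimately show ?thesis by simp
    qed
    have hi: "(\<lambda>k. ?S ((Suc k)\<^sup>2) / real (k\<^sup>2)) \<longlonglongrightarrow> c"
    proof -
      have r': "(\<lambda>k. real ((Suc k)\<^sup>2) / real (k\<^sup>2)) \<longlonglongrightarrow> 1"
        using tendsto_inverse[OF r] by simp
      have "(\<lambda>k. ?S ((Suc k)\<^sup>2) / real ((Suc k)\<^sup>2) * (real ((Suc k)\<^sup>2) / real (k\<^sup>2))) \<longlonglongrightarrow> c * 1"
        by (intro tendsto_mult LIMSEQ_Suc[OF b] r')
      then show ?thesis by simp
    qed
    let ?q = "floor_sqrt"
    have q: "filterlim ?q sequentially sequentially"
      unfolding filterlim_at_top
    proof
      fix Z show "\<forall>\<^sub>F n in sequentially. Z \<le> ?q n"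
        unfolding eventually_sequentially
        by (intro exI[of _ "Z\<^sup>2"]) (metis floor_sqrt_inverse_power2 mono_floor_sqrt')
    qed
    show ?case
    proof (rule tendsto_sandwich[OF _ _ filterlim_compose[OF lo q] filterlim_compose[OF hi q]])
      have lt: "N < (Suc (?q N))\<^sup>2" for N by (rule Suc_floor_sqrt_power2_gt)
      show "\<forall>\<^sub>F N in sequentially. ?S ((?q N)\<^sup>2) / real ((Suc (?q N))\<^sup>2) \<le> ?S N / real N"
        unfolding eventually_sequentially
      proof (intro exI[of _ 1] allI impI)
        fix N :: nat assume "1 \<le> N"
        then show "?S ((?q N)\<^sup>2) / real ((Suc (?q N))\<^sup>2) \<le> ?S N / real N"
          using lt[of N] by (intro frac_le S0 mono floor_sqrt_power2_le) (simp_all del: power_Suc of_nat_power)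
      qed
      show "\<forall>\<^sub>F N in sequentially. ?S N / real N \<le> ?S ((Suc (?q N))\<^sup>2) / real ((?q N)\<^sup>2)"
        unfolding eventually_sequentially
      proof (intro exI[of _ 1] allI impI)
        fix N :: nat assume "1 \<le> N"
        then have "?q N \<ge> 1" using mono_floor_sqrt'[of 1 N] by simp
        then show "?S N / real N \<le> ?S ((Suc (?q N))\<^sup>2) / real ((?q N)\<^sup>2)"
          using lt[of N] floor_sqrt_power2_le[of N] \<open>1 \<le> N\<close> by (intro frac_le S0 mono) (simp_all del: of_nat_power)
      qed
    qed
  qed
  show ?thesis
  proof (rule conv_toI_bound[OF _ _ ae])
    show "(\<integral>x. \<bar>(\<Sum>k<N. Z k x) / real N - c\<bar> \<partial>M) \<le>
      sqrt C * (1 / sqrt (real N)) + \<bar>(\<Sum>k<N. m k) / real N - c\<bar>" for N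
    proof -
      have "\<bar>(\<Sum>k<N. Z k x) / real N - c\<bar> \<le> \<bar>D N x\<bar> / real N + \<bar>(\<Sum>k<N. m k) / real N - c\<bar>" for x
      proof -
        have "(\<Sum>k<N. Z k x) / real N - c = D N x / real N + ((\<Sum>k<N. m k) / real N - c)"
          by (simp add: D_def diff_divide_distrib)
        then show ?thesis by (metis abs_divide abs_of_nat abs_triangle_ineq)
      qed
      then have "(\<integral>x. \<bar>(\<Sum>k<N. Z k x) / real N - c\<bar> \<partial>M) \<le>
        (\<integral>x. \<bar>D N x\<bar> / real N + \<bar>(\<Sum>k<N. m k) / real N - c\<bar> \<partial>M)"
        using D1 intZ by (intro integral_mono) auto
      also have "\<dots> = (\<integral>x. \<bar>D N x\<bar> \<partial>M) / real N + \<bar>(\<Sum>k<N. m k) / real N - c\<bar>"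
        using D1 by (simp add: prob_space)
      also have "(\<integral>x. \<bar>D N x\<bar> \<partial>M) / real N \<le> sqrt (C * real N) / real N"
        by (intro divide_right_mono D1) simp
      also have "\<dots> = sqrt C * (1 / sqrt (real N))"
      proof (cases "N = 0")
        case False
        then have "sqrt (real N) / real N = 1 / sqrt (real N)" by (simp add: frac_eq_eq)
        then show ?thesis unfolding real_sqrt_mult times_divide_eq_right[symmetric] by simp
      qed simp
      finally show ?thesis by simp
    qed
    have "(\<lambda>N. \<bar>(\<Sum>k<N. m k) / real N - c\<bar>) \<longlonglongrightarrow> 0"
      using mean by (simp add: LIM_zero tendsto_rabs_zero)
    moreover have "(\<lambda>N. sqrt C * (1 / sqrt (real N))) \<longlonglongrightarrow> 0"
    proof -
      have "(\<lambda>N. sqrt (1 / real N)) \<longlonglongrightarrow> sqrt 0"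
        by (rule tendsto_real_sqrt[OF lim_const_over_n])
      then have "(\<lambda>N. 1 / sqrt (real N)) \<longlonglongrightarrow> 0" by (simp only: real_sqrt_divide real_sqrt_one real_sqrt_zero)
      then show ?thesis by (rule tendsto_mult_right_zero)
    qed
    ultimately show "(\<lambda>N. sqrt C * (1 / sqrt (real N)) + \<bar>(\<Sum>k<N. m k) / real N - c\<bar>) \<longlonglongrightarrow> 0"
      by (intro tendsto_add_zero)
  qed (use intZ in auto)
qed


lemma conv_to_mean:
  assumes g: "conv_to M g h"
  shows "conv_to M (\<lambda>N x. (\<Sum>k<N. g k x) / real N) h"
proof -
  have ces: "(\<lambda>N. (\<Sum>k<N. u k) / real N) \<longlonglongrightarrow> l" if "u \<longlonglongrightarrow> l" for u :: "nat \<Rightarrow> real" and l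
  proof (rule LIMSEQ_I)
    fix e :: real assume e: "0 < e"
    from LIMSEQ_D[OF that half_gt_zero[OF e]] obtain m where m: "\<And>n. n \<ge> m \<Longrightarrow> \<bar>u n - l\<bar> < e/2" by auto
    define K where "K = (\<Sum>k<m. \<bar>u k - l\<bar>)"
    have "(\<lambda>N. K / real N) \<longlonglongrightarrow> 0" by (rule lim_const_over_n)
    from LIMSEQ_D[OF this half_gt_zero[OF e]] obtain n1 where n1: "\<And>n. n \<ge> n1 \<Longrightarrow> \<bar>K / real n\<bar> < e/2" by auto
    show "\<exists>no. \<forall>n\<ge>no. norm ((\<Sum>k<n. u k) / real n - l) < e"
    proof (intro exI allI impI)
      fix n assume n: "n \<ge> max (max m n1) 1"
      have "(\<Sum>k<n. u k) / real n - l = (\<Sum>k<n. u k - l) / real n"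
        using n by (simp add: sum_subtractf diff_divide_distrib)
      also have "\<bar>\<dots>\<bar> \<le> (\<Sum>k<n. \<bar>u k - l\<bar>) / real n"
        by (simp add: divide_right_mono)
      also have "(\<Sum>k<n. \<bar>u k - l\<bar>) = K + (\<Sum>k=m..<n. \<bar>u k - l\<bar>)"
        unfolding K_def lessThan_atLeast0 using n by (subst sum.atLeastLessThan_concat) auto
      also have "(\<Sum>k=m..<n. \<bar>u k - l\<bar>) \<le> (\<Sum>k=m..<n. e/2)"
        by (intro sum_mono) (use m in \<open>auto intro: less_imp_le\<close>)
      also have "\<dots> \<le> real n * (e/2)" using e by (simp add: mult_right_mono)
      finally have "\<bar>(\<Sum>k<n. u k) / real n - l\<bar> \<le> (K + real n * (e/2)) / real n"
        using n by (simp add: divide_right_mono)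
      also have "\<dots> = K / real n + e/2" using n by (simp add: add_divide_distrib)
      also have "\<dots> < e"
        using n1[of n] n abs_ge_self[of "K / real n"] by linarith
      finally show "norm ((\<Sum>k<n. u k) / real n - l) < e" by simp
    qed
  qed
  have int [simp]: "integrable M (g n)" "integrable M h" for n
    using g by (auto simp: conv_to_def)
  show ?thesis
  proof (rule conv_to_eventually[where ?n0.0 = 1])
    \<comment> \<open>At N = 0 the quotient is 0 by division by zero; \<open>h\<close> is put there
      so that the L^1 bound below holds for every N.\<close>
    let ?g = "\<lambda>N x. if N = 0 then h x else (\<Sum>k<N. g k x) / real N"
    show "conv_to M ?g h"
    proof (rule conv_toI_bound)
      have "AE x in M. (\<lambda>n. g n x) \<longlonglongrightarrow> h x" using g by (auto simp: conv_to_def)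
      then show "AE x in M. (\<lambda>N. ?g N x) \<longlonglongrightarrow> h x"
      proof eventually_elim
        case (elim x)
        show ?case
          by (rule Lim_transform_eventually[OF ces[OF elim]])
            (auto simp: eventually_sequentially intro!: exI[of _ 1])
      qed
      show "integrable M (?g n)" for n by (cases "n = 0") auto
      show "(\<integral>x. \<bar>?g N x - h x\<bar> \<partial>M) \<le> (\<Sum>k<N. \<integral>x. \<bar>g k x - h x\<bar> \<partial>M) / real N" for N
      proof (cases "N = 0")
        case False
        have "\<bar>?g N x - h x\<bar> \<le> (\<Sum>k<N. \<bar>g k x - h x\<bar>) / real N" for x
        proof -
          have "?g N x - h x = (\<Sum>k<N. g k x - h x) / real N"
            using False by (simp add: sum_subtractf diff_divide_distrib)
          then show ?thesis by (simp add: divide_right_mono del: sum_subtractf)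
        qed
        then have "(\<integral>x. \<bar>?g N x - h x\<bar> \<partial>M) \<le> (\<integral>x. (\<Sum>k<N. \<bar>g k x - h x\<bar>) / real N \<partial>M)"
          using False by (intro integral_mono) auto
        also have "\<dots> = (\<Sum>k<N. \<integral>x. \<bar>g k x - h x\<bar> \<partial>M) / real N" by simp
        finally show ?thesis .
      qed simp
      show "(\<lambda>N. (\<Sum>k<N. \<integral>x. \<bar>g k x - h x\<bar> \<partial>M) / real N) \<longlonglongrightarrow> 0"
        using g by (intro ces) (auto simp: conv_to_def)
    qed simp
  qed auto
qed

section \<open>A maximal inequality from fourth moments\<close>

text \<open>The factor 2 on \<open>y^4\<close> is the point: in \<open>max_dev_bound\<close> y comes
  from a block with at most half of the variance, whose contribution returns with weight 2/4, and
  together with the 1/4 of the other block this stays below 1. The price is 216 on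
  \<open>x^4\<close>, which is estimated outright.\<close>

lemma power4_add_le: "(x + y)^4 \<le> 216 * x^4 + 2 * y^4" for x y :: real
proof -
  have "216 * x^4 + 2 * y^4 - (x + y)^4 = (y\<^sup>2 - 2*x*y - 6*x\<^sup>2)\<^sup>2 + x\<^sup>2 * (2 * (y - 7*x)\<^sup>2 + 81 * x\<^sup>2)"
    by (simp add: power2_eq_square power4_eq_xxxx algebra_simps)
  also have "\<dots> \<ge> 0" by simp
  finally show ?thesis by simp
qed

definition max_dev :: "(nat \<Rightarrow> 'a \<Rightarrow> real) \<Rightarrow> nat \<Rightarrow> nat \<Rightarrow> 'a \<Rightarrow> real" where
  "max_dev a m n x = Max ((\<lambda>j. (a (m + j) x - a m x)^4) ` {..n})"

lemma max_dev_upper: "j \<le> n \<Longrightarrow> (a (m + j) x - a m x)^4 \<le> max_dev a m n x"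
  unfolding max_dev_def by (intro Max_ge) auto

lemma max_dev_nonneg: "0 \<le> max_dev a m n x"
  using max_dev_upper[of 0 n a m x] by simp

lemma max_dev_mono: "n \<le> n' \<Longrightarrow> max_dev a m n x \<le> max_dev a m n' x"
  unfolding max_dev_def by (intro Max_mono) auto

lemma max_dev_least:
  "(\<And>j. j \<le> n \<Longrightarrow> (a (m + j) x - a m x)^4 \<le> b) \<Longrightarrow> max_dev a m n x \<le> b"
  unfolding max_dev_def by (subst Max_le_iff) auto

lemma measurable_max_dev [measurable]:
  assumes [measurable]: "\<And>k. a k \<in> borel_measurable M"
  shows "max_dev a m n \<in> borel_measurable M"
  unfolding max_dev_def[abs_def] by (intro borel_measurable_Max) auto

text \<open>The constant \<open>864\<close> solves \<open>C / 4 + 216 + 2 * C / 4 = C\<close>: cutting the index range where the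
  variance reaches one half, both pieces carry at most half of it.\<close>

lemma max_dev_bound:
  fixes a :: "nat \<Rightarrow> 'a \<Rightarrow> real" and d :: "nat \<Rightarrow> real"
  assumes [measurable]: "\<And>k. a k \<in> borel_measurable M"
    and int: "\<And>i j. i \<le> j \<Longrightarrow> integrable M (\<lambda>x. (a j x - a i x)^4)"
    and bnd: "\<And>i j. i \<le> j \<Longrightarrow> (\<integral>x. (a j x - a i x)^4 \<partial>M) \<le> C * (d i - d j)\<^sup>2"
    and anti: "\<And>i j. i \<le> j \<Longrightarrow> d j \<le> d i" and C: "0 \<le> C"
  shows "integrable M (max_dev a m n) \<and> (\<integral>x. max_dev a m n x \<partial>M) \<le> 864 * C * (d m - d (m + n))\<^sup>2"
proof (induction n arbitrary: m rule: less_induct)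
  case (less n)
  show ?case
  proof (cases "n = 0")
    case True
    then have "max_dev a m n = (\<lambda>x. 0)" by (auto simp: max_dev_def)
    then show ?thesis using True by simp
  next
    case False
    define u where "u = d m - d (m + n)"
    have u0: "0 \<le> u" using anti[of m "m + n"] by (simp add: u_def)
    \<comment> \<open>The first index at which half of the variance is spent. Up to
      \<open>h - 1\<close> at most half is spent, after \<open>h\<close> at most half is left; the
      step into \<open>h\<close> may be large, so it belongs to neither block and is paid by the
      middle term of \<open>?R\<close>. Requiring \<open>1 \<le> j\<close> keeps both blocks shorter
      than n, also for u = 0.\<close>
    define h where "h = (LEAST j. 1 \<le> j \<and> u / 2 \<le> d m - d (m + j))"
    have ex: "1 \<le> n \<and> u / 2 \<le> d m - d (m + n)" using False u0 by (simp add: u_def)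
    have h: "1 \<le> h" "u / 2 \<le> d m - d (m + h)" "h \<le> n"
      using LeastI[of "\<lambda>j. 1 \<le> j \<and> u / 2 \<le> d m - d (m + j)", OF ex]
        Least_le[of "\<lambda>j. 1 \<le> j \<and> u / 2 \<le> d m - d (m + j)", OF ex] by (auto simp: h_def)
    have h': "d m - d (m + (h - 1)) \<le> u / 2"
    proof (cases "h = 1")
      case True then show ?thesis using u0 by simp
    next
      case False
      then have "\<not> (1 \<le> h - 1 \<and> u / 2 \<le> d m - d (m + (h - 1)))"
        using h(1) unfolding h_def by (intro not_less_Least) auto
      with False h(1) show ?thesis by auto
    qed
    have I1: "integrable M (max_dev a m (h - 1))"
      "(\<integral>x. max_dev a m (h - 1) x \<partial>M) \<le> 864 * C * (d m - d (m + (h - 1)))\<^sup>2"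
      using less[of "h - 1" m] h by auto
    have I2: "integrable M (max_dev a (m + h) (n - h))"
      "(\<integral>x. max_dev a (m + h) (n - h) x \<partial>M) \<le> 864 * C * (d (m + h) - d (m + n))\<^sup>2"
      using less[of "n - h" "m + h"] h by auto
    have I3: "integrable M (\<lambda>x. (a (m + h) x - a m x)^4)"
      "(\<integral>x. (a (m + h) x - a m x)^4 \<partial>M) \<le> C * (d m - d (m + h))\<^sup>2"
      using int[of m "m + h"] bnd[of m "m + h"] by auto
    let ?R = "\<lambda>x. max_dev a m (h - 1) x + 216 * (a (m + h) x - a m x)^4 + 2 * max_dev a (m + h) (n - h) x"
    have le: "max_dev a m n x \<le> ?R x" for x
    proof (rule max_dev_least)
      fix j assume j: "j \<le> n"
      show "(a (m + j) x - a m x)^4 \<le> ?R x"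
      proof (cases "j \<le> h - 1")
        case True
        have "0 \<le> 216 * (a (m + h) x - a m x)^4" by simp
        then show ?thesis
          using max_dev_upper[OF True, of a m x] max_dev_nonneg[of a "m + h" "n - h" x] by linarith
      next
        case False
        then have hj: "h \<le> j" by simp
        have "(a (m + j) x - a m x)^4 = ((a (m + h) x - a m x) + (a (m + j) x - a (m + h) x))^4" by simp
        also have "\<dots> \<le> 216 * (a (m + h) x - a m x)^4 + 2 * (a (m + j) x - a (m + h) x)^4"
          by (rule power4_add_le)
        also have "(a (m + j) x - a (m + h) x)^4 \<le> max_dev a (m + h) (n - h) x"
          using max_dev_upper[of "j - h" "n - h" a "m + h" x] hj j by simp
        finally show ?thesis using max_dev_nonneg[of a m "h - 1" x] by linarith
      qed
    qed
    have Rint: "integrable M ?R" using I1 I2 I3 by simp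
    have "integrable M (max_dev a m n)"
      by (rule Bochner_Integration.integrable_bound[OF Rint])
        (use le max_dev_nonneg[of a m n] in \<open>auto intro: order_trans[OF _ abs_ge_self]\<close>)
    moreover have "(\<integral>x. max_dev a m n x \<partial>M) \<le> 864 * C * u\<^sup>2"
    proof -
      have "(\<integral>x. max_dev a m n x \<partial>M) \<le> (\<integral>x. ?R x \<partial>M)"
        by (intro integral_mono calculation Rint le)
      also have "\<dots> = (\<integral>x. max_dev a m (h - 1) x \<partial>M) + 216 * (\<integral>x. (a (m + h) x - a m x)^4 \<partial>M)
          + 2 * (\<integral>x. max_dev a (m + h) (n - h) x \<partial>M)"
        using I1 I2 I3 by simp
      also have "\<dots> \<le> 864 * C * (u / 2)\<^sup>2 + 216 * (C * u\<^sup>2) + 2 * (864 * C * (u / 2)\<^sup>2)"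
      proof -
        have "(d m - d (m + (h - 1)))\<^sup>2 \<le> (u / 2)\<^sup>2"
          using h' anti[of m "m + (h - 1)"] by (intro power_mono) auto
        then have 1: "864 * C * (d m - d (m + (h - 1)))\<^sup>2 \<le> 864 * C * (u / 2)\<^sup>2"
          using C by (intro mult_left_mono) auto
        have "(d (m + h) - d (m + n))\<^sup>2 \<le> (u / 2)\<^sup>2"
          using h anti[of "m + h" "m + n"] by (intro power_mono) (auto simp: u_def)
        then have 2: "864 * C * (d (m + h) - d (m + n))\<^sup>2 \<le> 864 * C * (u / 2)\<^sup>2"
          using C by (intro mult_left_mono) auto
        have "(d m - d (m + h))\<^sup>2 \<le> u\<^sup>2"
          using h anti[of m "m + h"] anti[of "m + h" "m + n"] by (intro power_mono) (auto simp: u_def)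
        then have 3: "C * (d m - d (m + h))\<^sup>2 \<le> C * u\<^sup>2"
          using C by (intro mult_left_mono) auto
        show ?thesis using 1 2 3 I1(2) I2(2) I3(2) by linarith
      qed
      also have "\<dots> = 864 * C * u\<^sup>2" by (simp add: power2_eq_square)
      finally show ?thesis .
    qed
    ultimately show ?thesis by (simp add: u_def)
  qed
qed

text \<open>Letting n grow in \<open>max_dev_bound\<close> by monotone convergence. \<open>W\<close>
  is a real-valued version of the supremum of the \<open>max_dev a m n\<close>, which is finite
  almost everywhere.\<close>

lemma sup_dev_bound:
  fixes a :: "nat \<Rightarrow> 'a \<Rightarrow> real" and d :: "nat \<Rightarrow> real"
  assumes [measurable]: "\<And>k. a k \<in> borel_measurable M"
    and int: "\<And>i j. i \<le> j \<Longrightarrow> integrable M (\<lambda>x. (a j x - a i x)^4)"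
    and bnd: "\<And>i j. i \<le> j \<Longrightarrow> (\<integral>x. (a j x - a i x)^4 \<partial>M) \<le> C * (d i - d j)\<^sup>2"
    and anti: "\<And>i j. i \<le> j \<Longrightarrow> d j \<le> d i" and C: "0 \<le> C" and lb: "\<And>i. s \<le> d i"
  obtains W where "integrable M W" "\<And>x. 0 \<le> W x" "AE x in M. \<forall>j. (a (m + j) x - a m x)^4 \<le> W x"
    "(\<integral>x. W x \<partial>M) \<le> 864 * C * (d m - s)\<^sup>2"
proof -
  let ?B = "864 * C * (d m - s)\<^sup>2"
  define V where "V = (\<lambda>x. SUP n. ennreal (max_dev a m n x))"
  have [measurable]: "V \<in> borel_measurable M" unfolding V_def by measurable
  have "(\<integral>\<^sup>+x. V x \<partial>M) = (SUP n. \<integral>\<^sup>+x. ennreal (max_dev a m n x) \<partial>M)"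
    unfolding V_def by (intro nn_integral_monotone_convergence_SUP)
      (auto simp: incseq_def le_fun_def intro!: ennreal_leI max_dev_mono)
  also have "\<dots> \<le> ennreal ?B"
  proof (rule SUP_least)
    fix n
    note b = max_dev_bound[of a M C d m n, OF assms(1) int bnd anti C]
    have "(\<integral>\<^sup>+x. ennreal (max_dev a m n x) \<partial>M) = ennreal (\<integral>x. max_dev a m n x \<partial>M)"
      by (rule nn_integral_eq_integral) (use b in \<open>auto simp: max_dev_nonneg\<close>)
    also have "\<dots> \<le> ennreal ?B"
    proof (rule ennreal_leI)
      have "(d m - d (m + n))\<^sup>2 \<le> (d m - s)\<^sup>2"
        using anti[of m "m + n"] lb[of "m + n"] by (intro power_mono) auto
      then have "864 * C * (d m - d (m + n))\<^sup>2 \<le> ?B" using C by (intro mult_left_mono) auto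
      then show "(\<integral>x. max_dev a m n x \<partial>M) \<le> ?B" using b by linarith
    qed
    finally show "(\<integral>\<^sup>+x. ennreal (max_dev a m n x) \<partial>M) \<le> ennreal ?B" .
  qed
  finally have VB: "(\<integral>\<^sup>+x. V x \<partial>M) \<le> ennreal ?B" .
  then have "(\<integral>\<^sup>+x. V x \<partial>M) \<noteq> \<infinity>" by (metis ennreal_neq_top infinity_ennreal_def neq_top_trans)
  then have fin: "AE x in M. V x \<noteq> \<infinity>" by (intro nn_integral_PInf_AE) auto
  have B0: "0 \<le> ?B" using C by simp
  let ?W = "\<lambda>x. enn2real (V x)"
  have nn: "(\<integral>\<^sup>+x. ennreal (?W x) \<partial>M) = (\<integral>\<^sup>+x. V x \<partial>M)"
    by (intro nn_integral_cong_AE, rule AE_mp[OF fin], rule AE_I2) (simp add: ennreal_enn2real less_top)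
  show ?thesis
  proof (rule that[of ?W])
    show Wi: "integrable M ?W"
      using VB nn B0 by (intro integrableI_nonneg) (auto simp: top_unique less_top intro: le_less_trans)
    show "AE x in M. \<forall>j. (a (m + j) x - a m x)^4 \<le> ?W x"
      using fin
    proof (eventually_elim, intro allI)
      fix x j assume x: "V x \<noteq> \<infinity>"
      have "ennreal ((a (m + j) x - a m x)^4) \<le> ennreal (max_dev a m j x)"
        by (intro ennreal_leI max_dev_upper) simp
      also have "\<dots> \<le> V x" unfolding V_def by (rule SUP_upper) simp
      also have "\<dots> = ennreal (?W x)" using x by (simp add: ennreal_enn2real less_top)
      finally show "(a (m + j) x - a m x)^4 \<le> ?W x" by simp
    qed
    have "ennreal (\<integral>x. ?W x \<partial>M) \<le> ennreal ?B"
      using VB nn by (subst nn_integral_eq_integral[symmetric, OF Wi]) auto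
    then show "(\<integral>x. ?W x \<partial>M) \<le> ?B" using B0 by simp
  qed simp
qed

text \<open>Takes the place of martingale convergence: the supremum of the fourth powers of the
  deviations after m has mean of order (d_m - s)^2, which tends to 0, so the sequence is Cauchy
  almost everywhere. The supremum over all times, \<open>W 0\<close>, then provides the majorant for
  L^1 convergence of the squares.\<close>

lemma fourth_moment_convergence:
  fixes a :: "nat \<Rightarrow> 'a \<Rightarrow> real" and d :: "nat \<Rightarrow> real"
  assumes "prob_space M" and [measurable]: "\<And>k. a k \<in> borel_measurable M"
    and int: "\<And>i j. i \<le> j \<Longrightarrow> integrable M (\<lambda>x. (a j x - a i x)^4)"
    and bnd: "\<And>i j. i \<le> j \<Longrightarrow> (\<integral>x. (a j x - a i x)^4 \<partial>M) \<le> C * (d i - d j)\<^sup>2"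
    and anti: "\<And>i j. i \<le> j \<Longrightarrow> d j \<le> d i" and C: "0 \<le> C" and lim: "d \<longlonglongrightarrow> s"
    and i0: "integrable M (\<lambda>x. (a 0 x)\<^sup>2)"
  obtains h where "conv_to M (\<lambda>n x. (a n x)\<^sup>2) h"
proof -
  interpret prob_space M by fact
  have lb: "s \<le> d i" for i
    by (rule LIMSEQ_le_const2[OF lim]) (auto intro: exI[of _ i] anti)
  let ?P = "\<lambda>m W. integrable M W \<and> (\<forall>x. 0 \<le> W x) \<and>
    (AE x in M. \<forall>j. (a (m + j) x - a m x)^4 \<le> W x) \<and> (\<integral>x. W x \<partial>M) \<le> 864 * C * (d m - s)\<^sup>2"
  have "\<exists>W. ?P m W" for m
    by (rule sup_dev_bound[OF assms(2) int bnd anti C lb, where m = m]; (assumption)?)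
      (intro exI conjI allI; assumption)
  then have "\<exists>W. \<forall>m. ?P m (W m)" by (intro choice allI)
  then obtain W where WP: "\<forall>m. ?P m (W m)" ..
  have Wi: "\<And>m. integrable M (W m)" and W0: "\<And>m x. 0 \<le> W m x"
    and W: "\<And>m. AE x in M. \<forall>j. (a (m + j) x - a m x)^4 \<le> W m x"
    and WB: "\<And>m. (\<integral>x. W m x \<partial>M) \<le> 864 * C * (d m - s)\<^sup>2"
    using WP by blast+
  have "(\<lambda>m. 864 * C * (d m - s)\<^sup>2) \<longlonglongrightarrow> 864 * C * (s - s)\<^sup>2"
    by (intro tendsto_intros lim)
  then have lim0: "(\<lambda>m. 864 * C * (d m - s)\<^sup>2) \<longlonglongrightarrow> 0" by simp
  \<comment> \<open>A subsequence with summable bounds is enough, since \<open>W m\<close> controls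
    all indices from m on.\<close>
  have "\<exists>m. 864 * C * (d m - s)\<^sup>2 < (1/2)^i" for i :: nat
    using order_tendstoD(2)[OF lim0, of "(1/2)^i"] by (auto simp: eventually_sequentially)
  then obtain \<phi> where \<phi>: "\<And>i. 864 * C * (d (\<phi> i) - s)\<^sup>2 < (1/2)^i" by metis
  have ae1: "AE x in M. (\<lambda>i. W (\<phi> i) x) \<longlonglongrightarrow> 0"
  proof (rule AE_tendsto_zero_of_summable)
    show "summable (\<lambda>i. \<integral>x. W (\<phi> i) x \<partial>M)"
    proof (rule summable_comparison_test')
      show "summable (\<lambda>i. (1/2::real)^i)" by (rule summable_geometric) simp
      show "norm (\<integral>x. W (\<phi> i) x \<partial>M) \<le> (1/2)^i" for i
        using WB[of "\<phi> i"] \<phi>[of i] W0 by (simp add: integral_nonneg)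
    qed
  qed (use Wi W0 in auto)
  have ae2: "AE x in M. \<forall>m j. (a (m + j) x - a m x)^4 \<le> W m x"
    using W by (simp add: AE_all_countable)
  from ae1 ae2 have conv: "AE x in M. convergent (\<lambda>n. a n x)"
  proof eventually_elim
    case (elim x)
    have "Cauchy (\<lambda>n. a n x)"
    proof (rule CauchyI')
      fix e :: real assume e: "0 < e"
      have "\<forall>\<^sub>F i in sequentially. W (\<phi> i) x < (e/2)^4"
        by (rule order_tendstoD(2)[OF elim(1)]) (use e in simp)
      then obtain i where i: "W (\<phi> i) x < (e/2)^4" by (auto simp: eventually_sequentially)
      have c: "\<bar>a k x - a (\<phi> i) x\<bar> < e/2" if "k \<ge> \<phi> i" for k
      proof -
        have "(a (\<phi> i + (k - \<phi> i)) x - a (\<phi> i) x)^4 < (e/2)^4"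
          using elim(2)[rule_format, of "\<phi> i" "k - \<phi> i"] i by linarith
        then have "\<bar>a k x - a (\<phi> i) x\<bar>^4 < (e/2)^4" using that by simp
        then show ?thesis by (rule power_less_imp_less_base) (use e in simp)
      qed
      show "\<exists>M. \<forall>m\<ge>M. \<forall>n>m. dist (a m x) (a n x) < e"
      proof (intro exI allI impI)
        fix m n assume "m \<ge> \<phi> i" "n > m"
        then show "dist (a m x) (a n x) < e" using c[of m] c[of n] by (simp add: dist_real_def abs_if split: if_splits)
      qed
    qed
    then show ?case by (rule Cauchy_convergent)
  qed
  define h where "h x = (lim (\<lambda>n. a n x))\<^sup>2" for x
  have [measurable]: "h \<in> borel_measurable M" unfolding h_def[abs_def] by measurable
  \<comment> \<open>With t the deviation from \<open>a 0\<close>: t^2 \<le> 1 + t^4 \<le> 1 +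
    \<open>W 0\<close>, and the square of a sum is at most twice the sum of the squares.\<close>
  define b where "b x = 2 * (a 0 x)\<^sup>2 + 2 * (1 + W 0 x)" for x
  have bi: "integrable M b" unfolding b_def[abs_def] using i0 Wi[of 0] by simp
  have lim': "AE x in M. (\<lambda>n. (a n x)\<^sup>2) \<longlonglongrightarrow> h x"
    using conv by eventually_elim (auto simp: h_def convergent_LIMSEQ_iff intro!: tendsto_power)
  have bd: "AE x in M. norm ((a n x)\<^sup>2) \<le> b x" for n
    using ae2
  proof eventually_elim
    case (elim x)
    let ?t = "a n x - a 0 x"
    have sq: "s \<le> 1 + s\<^sup>2" if "0 \<le> s" for s :: real
      using sum_squares_bound[of s 1] that by (auto simp: power2_eq_square)
    have "?t^4 \<le> W 0 x" using elim[rule_format, of 0 n] by simp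
    then have "?t\<^sup>2 \<le> 1 + W 0 x" using sq[of "?t\<^sup>2"] by simp
    moreover have "(a n x)\<^sup>2 \<le> 2 * (a 0 x)\<^sup>2 + 2 * ?t\<^sup>2"
    proof -
      have "2 * (a 0 x)\<^sup>2 + 2 * ?t\<^sup>2 - (a n x)\<^sup>2 = (2 * a 0 x - a n x)\<^sup>2"
        by (simp add: power2_eq_square algebra_simps)
      then show ?thesis using zero_le_power2[of "2 * a 0 x - a n x"] by linarith
    qed
    ultimately show ?case by (simp add: b_def)
  qed
  note dc = integral_dominated_convergence[of "h" M "\<lambda>n x. (a n x)\<^sup>2" b, OF _ _ bi lim' bd]
    integrable_dominated_convergence[of "h" M "\<lambda>n x. (a n x)\<^sup>2" b, OF _ _ bi lim' bd]
    integrable_dominated_convergence2[of "h" M "\<lambda>n x. (a n x)\<^sup>2" b, OF _ _ bi lim' bd]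
  have hi: "integrable M h" by (rule dc) auto
  have ai: "integrable M (\<lambda>x. (a n x)\<^sup>2)" for n by (rule dc) auto
  have "(\<lambda>n. \<integral>x. \<bar>(a n x)\<^sup>2 - h x\<bar> \<partial>M) \<longlonglongrightarrow> (\<integral>x. 0 \<partial>M)"
  proof (rule integral_dominated_convergence[where w = "\<lambda>x. b x + \<bar>h x\<bar>"])
    show "AE x in M. (\<lambda>n. \<bar>(a n x)\<^sup>2 - h x\<bar>) \<longlonglongrightarrow> 0"
      using lim' by eventually_elim (simp add: LIM_zero tendsto_rabs_zero)
    show "AE x in M. norm \<bar>(a n x)\<^sup>2 - h x\<bar> \<le> b x + \<bar>h x\<bar>" for n
      using bd[of n]
    proof eventually_elim
      case (elim x)
      have "\<bar>(a n x)\<^sup>2 - h x\<bar> \<le> \<bar>(a n x)\<^sup>2\<bar> + \<bar>h x\<bar>" by (rule abs_triangle_ineq4)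
      with elim show ?case by simp
    qed
  qed (use bi hi in auto)
  then have "conv_to M (\<lambda>n x. (a n x)\<^sup>2) h"
    using hi ai lim' by (auto simp: conv_to_def)
  then show ?thesis by (rule that)
qed


section \<open>Szego's theorem\<close>

abbreviation circle :: "complex set" where "circle \<equiv> sphere 0 1"

section \<open>Integration over the circle\<close>

lemma space_circle_lebesgue [simp]: "space circle_lebesgue = circle"
  by (simp add: circle_lebesgue_def space_restrict_space)

lemma sets_circle_lebesgue: "sets circle_lebesgue = sets (restrict_space borel circle)"
  by (simp add: circle_lebesgue_def)

lemma uniform_circle_density:
  "uniform_measure lborel {0..2 * pi} = density lborel (\<lambda>t. ennreal (indicator {0..2 * pi} t / (2 * pi)))"
proof -
  have "indicator {0..2 * pi} t / emeasure lborel {0..2 * pi} = ennreal (indicator {0..2 * pi} t / (2 * pi))" for t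
    by (simp add: divide_ennreal[symmetric] ennreal_indicator[symmetric] del: ennreal_indicator)
  then show ?thesis
    unfolding uniform_measure_def by (intro arg_cong[of _ _ "density lborel"] ext)
qed

lemma measurable_cis_circle: "cis \<in> measurable (uniform_measure lborel {0..2 * pi}) (restrict_space borel circle)"
proof (rule measurable_restrict_space2)
  show "cis \<in> uniform_measure lborel {0..2 * pi} \<rightarrow>\<^sub>M borel"
    unfolding measurable_def
    using borel_measurable_continuous_onI[OF continuous_on_cis[OF continuous_on_id], unfolded id_def]
    by (auto simp: measurable_def)
qed auto

lemma prob_space_circle_lebesgue: "prob_space circle_lebesgue"
  unfolding circle_lebesgue_def
  by (intro prob_space.prob_space_distr prob_space_uniform_measure measurable_cis_circle) auto

lemma borel_measurable_circle:
  fixes g :: "complex \<Rightarrow> 'b::topological_space"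
  assumes "sets M = sets circle_lebesgue" "continuous_on circle g"
  shows "g \<in> borel_measurable M"
proof -
  have "g \<in> borel_measurable (restrict_space borel circle)"
    by (rule borel_measurable_continuous_on_restrict[OF assms(2)])
  then show ?thesis
    by (simp add: measurable_cong_sets[OF assms(1)[unfolded sets_circle_lebesgue] refl])
qed

lemma integral_circle_lebesgue:
  fixes g :: "complex \<Rightarrow> 'b::{banach, second_countable_topology}"
  assumes "continuous_on circle g"
  shows "(\<integral>z. g z \<partial>circle_lebesgue) = (\<integral>t. indicator {0..2 * pi} t *\<^sub>R ((1 / (2 * pi)) *\<^sub>R g (cis t)) \<partial>lborel)"
proof -
  have [measurable]: "g \<in> borel_measurable (restrict_space borel circle)"
    by (rule borel_measurable_continuous_on_restrict[OF assms])
  have m: "(\<lambda>t. g (cis t)) \<in> borel_measurable lborel"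
    by (subst measurable_cong_sets[of lborel "uniform_measure lborel {0..2 * pi}" borel borel])
      (auto intro: measurable_compose[OF measurable_cis_circle])
  have "(\<integral>z. g z \<partial>circle_lebesgue) = (\<integral>t. g (cis t) \<partial>uniform_measure lborel {0..2 * pi})"
    unfolding circle_lebesgue_def by (rule integral_distr[OF measurable_cis_circle]) simp
  also have "\<dots> = (\<integral>t. (indicator {0..2 * pi} t / (2 * pi)) *\<^sub>R g (cis t) \<partial>lborel)"
    unfolding uniform_circle_density by (rule integral_density) (use m in auto)
  finally show ?thesis by simp
qed

lemma integral_circle_power: "(\<integral>z. z ^ n \<partial>circle_lebesgue) = (if n = 0 then 1 else 0)"
proof (cases "n = 0")
  case True
  interpret prob_space circle_lebesgue by (rule prob_space_circle_lebesgue)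
  from True show ?thesis using prob_space by simp
next
  case False
  let ?F = "\<lambda>t. cis (real n * t) / (2 * pi * \<i> * of_nat n)"
  have "(\<integral>z. z ^ n \<partial>circle_lebesgue) = (\<integral>t. indicator {0..2 * pi} t *\<^sub>R ((1 / (2 * pi)) *\<^sub>R (cis t ^ n)) \<partial>lborel)"
    by (rule integral_circle_lebesgue) (intro continuous_intros)
  also have "\<dots> = ?F (2 * pi) - ?F 0"
  proof (rule integral_FTC_Icc)
    show "continuous_on {0..2 * pi} (\<lambda>t. (1 / (2 * pi)) *\<^sub>R cis t ^ n)"
      by (intro continuous_intros)
    show "(?F has_vector_derivative (1 / (2 * pi)) *\<^sub>R cis t ^ n) (at t within {0..2 * pi})" for t
    proof -
      have "((\<lambda>t. exp (t *\<^sub>R (\<i> * of_nat n))) has_vector_derivative exp (t *\<^sub>R (\<i> * of_nat n)) * (\<i> * of_nat n)) (at t within {0..2 * pi})"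
        by (rule exp_scaleR_has_vector_derivative_right)
      then have "((\<lambda>t. cis (real n * t)) has_vector_derivative \<i> * of_nat n * cis (real n * t)) (at t within {0..2 * pi})"
        by (simp add: cis_conv_exp scaleR_conv_of_real mult_ac)
      then have "(?F has_vector_derivative (\<i> * of_nat n * cis (real n * t)) / (2 * pi * \<i> * of_nat n)) (at t within {0..2 * pi})"
        by (rule has_vector_derivative_divide)
      moreover have "(\<i> * of_nat n * cis (real n * t)) / (2 * pi * \<i> * of_nat n) = (1 / (2 * pi)) *\<^sub>R cis t ^ n"
        using False by (simp add: Complex.DeMoivre scaleR_conv_of_real)
      ultimately show ?thesis by simp
    qed
  qed simp
  also have "\<dots> = 0"
  proof -
    have "cis (real n * (2 * pi)) = 1"
      using cis_multiple_2pi[of "real n"] by (simp add: mult_ac)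
    then show ?thesis by simp
  qed
  finally show ?thesis using False by simp
qed

lemma integrable_circle:
  fixes g :: "complex \<Rightarrow> 'b::{banach, second_countable_topology}"
  assumes "finite_measure M" "sets M = sets circle_lebesgue" "g \<in> borel_measurable M"
    and "\<And>z. z \<in> circle \<Longrightarrow> norm (g z) \<le> B"
  shows "integrable M g"
proof -
  interpret finite_measure M by fact
  have "space M = circle" using sets_eq_imp_space_eq[OF assms(2)] by simp
  then show ?thesis using assms by (intro integrable_const_bound[of _ B] AE_I2) auto
qed

lemma integrable_circle_continuous:
  fixes g :: "complex \<Rightarrow> 'b::{banach, second_countable_topology}"
  assumes "finite_measure M" "sets M = sets circle_lebesgue" "continuous_on circle g"
  shows "integrable M g"
proof -
  have "bounded (g ` circle)"
    by (intro compact_imp_bounded compact_continuous_image assms) simp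
  then obtain B where "\<And>z. z \<in> circle \<Longrightarrow> norm (g z) \<le> B" unfolding bounded_iff by blast
  then show ?thesis using integrable_circle[OF assms(1,2) borel_measurable_circle[OF assms(2,3)]] by blast
qed

text \<open>The mean value property: a normalization at 0 becomes a statement about an integral over
  the circle.\<close>

lemma integral_circle_poly: "(\<integral>z. poly p z \<partial>circle_lebesgue) = poly p 0"
proof -
  interpret prob_space circle_lebesgue by (rule prob_space_circle_lebesgue)
  have i: "integrable circle_lebesgue (\<lambda>z. coeff p i * z ^ i)" for i
    by (intro integrable_circle_continuous finite_measure_axioms refl continuous_intros)
  have "(\<integral>z. poly p z \<partial>circle_lebesgue) = (\<Sum>i\<le>degree p. coeff p i * (\<integral>z. z ^ i \<partial>circle_lebesgue))"
    unfolding poly_altdef using i by (simp add: Bochner_Integration.integral_sum)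
  also have "\<dots> = coeff p 0"
    by (simp add: integral_circle_power if_distrib sum.delta cong: if_cong)
  finally show ?thesis by (simp add: poly_0_coeff_0)
qed

section \<open>Szego's inequalities for exponents of the form Re q\<close>

definition exp_poly :: "complex poly \<Rightarrow> nat \<Rightarrow> complex poly" where
  "exp_poly u N = (\<Sum>n\<le>N. Polynomial.smult (1 / fact n) (u ^ n))"

lemma poly_exp_poly: "poly (exp_poly u N) z = (\<Sum>n\<le>N. poly u z ^ n / fact n)"
  by (simp add: exp_poly_def poly_sum poly_power)

lemma poly_exp_poly_0: "poly u 0 = 0 \<Longrightarrow> poly (exp_poly u N) 0 = 1"
  by (simp add: poly_exp_poly power_0_left if_distrib[of "\<lambda>x. x / _"] sum.delta' cong: if_cong)

lemma exp_poly_tendsto: "(\<lambda>N. poly (exp_poly u N) z) \<longlonglongrightarrow> exp (poly u z)"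
  using exp_converges[of "poly u z"] unfolding sums_def_le poly_exp_poly
  by (simp add: scaleR_conv_of_real divide_inverse mult.commute)

lemma exp_poly_bound: "cmod (poly (exp_poly u N) z) \<le> exp (cmod (poly u z))"
proof -
  have "cmod (poly (exp_poly u N) z) \<le> (\<Sum>n\<le>N. cmod (poly u z) ^ n / fact n)"
    unfolding poly_exp_poly by (rule sum_norm_le) (simp add: norm_divide norm_power)
  also have "\<dots> \<le> exp (cmod (poly u z))"
  proof -
    have e: "(\<lambda>n. cmod (poly u z) ^ n / fact n) sums exp (cmod (poly u z))"
      using exp_converges[of "cmod (poly u z)"] by (simp add: divide_inverse mult.commute)
    show ?thesis
      using sum_le_suminf[OF sums_summable[OF e], of "{..N}"] sums_unique[OF e] by simp
  qed
  finally show ?thesis .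
qed

lemma poly_bounded_circle: obtains B where "\<And>z. z \<in> circle \<Longrightarrow> cmod (poly p z) \<le> B"
proof -
  have "bounded (poly p ` circle)"
    by (intro compact_imp_bounded compact_continuous_image continuous_intros) simp
  then show ?thesis using that unfolding bounded_iff by blast
qed

text \<open>The functions \<open>exp u\<close> with \<open>u\<close> a polynomial are limits of polynomials with the same value at \<open>0\<close>.\<close>

lemma integral_exp_poly_tendsto:
  assumes fin: "finite_measure M" and sets: "sets M = sets circle_lebesgue"
  shows "(\<lambda>N. \<integral>z. (cmod (poly (p * exp_poly u N) z))\<^sup>2 \<partial>M) \<longlonglongrightarrow>
    (\<integral>z. (cmod (poly p z))\<^sup>2 * exp (2 * Re (poly u z)) \<partial>M)"
proof -
  interpret finite_measure M by fact
  have sp: "space M = circle" using sets_eq_imp_space_eq[OF sets] by simp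
  obtain B where B: "\<And>z. z \<in> circle \<Longrightarrow> cmod (poly p z) \<le> B" using poly_bounded_circle[of p] by blast
  obtain C where C: "\<And>z. z \<in> circle \<Longrightarrow> cmod (poly u z) \<le> C" using poly_bounded_circle[of u] by blast
  show ?thesis
  proof (rule integral_dominated_convergence[where w = "\<lambda>_. (B * exp C)\<^sup>2"])
    show "(\<lambda>z. (cmod (poly p z))\<^sup>2 * exp (2 * Re (poly u z))) \<in> borel_measurable M"
      by (intro borel_measurable_circle sets continuous_intros)
    show "(\<lambda>z. (cmod (poly (p * exp_poly u N) z))\<^sup>2) \<in> borel_measurable M" for N
      by (intro borel_measurable_circle sets continuous_intros)
    show "AE z in M. (\<lambda>N. (cmod (poly (p * exp_poly u N) z))\<^sup>2) \<longlonglongrightarrow> (cmod (poly p z))\<^sup>2 * exp (2 * Re (poly u z))"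
    proof (rule AE_I2)
      fix z
      have "(\<lambda>N. (cmod (poly p z * poly (exp_poly u N) z))\<^sup>2) \<longlonglongrightarrow> (cmod (poly p z * exp (poly u z)))\<^sup>2"
        by (intro tendsto_intros exp_poly_tendsto)
      moreover have "(cmod (poly p z * exp (poly u z)))\<^sup>2 = (cmod (poly p z))\<^sup>2 * exp (2 * Re (poly u z))"
        by (simp add: norm_mult power_mult_distrib exp_double)
      ultimately show "(\<lambda>N. (cmod (poly (p * exp_poly u N) z))\<^sup>2) \<longlonglongrightarrow> (cmod (poly p z))\<^sup>2 * exp (2 * Re (poly u z))"
        by simp
    qed
    show "AE z in M. norm ((cmod (poly (p * exp_poly u N) z))\<^sup>2) \<le> (B * exp C)\<^sup>2" for N
    proof (rule AE_I2)
      fix z assume "z \<in> space M"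
      then have z: "z \<in> circle" using sp by simp
      have "cmod (poly (p * exp_poly u N) z) \<le> B * exp C"
        unfolding poly_mult norm_mult
      proof (rule mult_mono)
        show "cmod (poly (exp_poly u N) z) \<le> exp C"
          using exp_poly_bound[of u N z] C[OF z] by (meson exp_le_cancel_iff order_trans)
        show "0 \<le> B" using B[OF z] norm_ge_zero order_trans by blast
      qed (use B[OF z] in auto)
      then show "norm ((cmod (poly (p * exp_poly u N) z))\<^sup>2) \<le> (B * exp C)\<^sup>2"
        by (simp add: power_mono)
    qed
  qed simp
qed

lemma integral_Re_poly: "(\<integral>z. Re (poly q z) \<partial>circle_lebesgue) = Re (poly q 0)"
proof -
  interpret prob_space circle_lebesgue by (rule prob_space_circle_lebesgue)
  have "integrable circle_lebesgue (poly q)"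
    by (intro integrable_circle_continuous finite_measure_axioms refl continuous_intros)
  then show ?thesis using integral_circle_poly[of q] by (metis integral_Re)
qed

lemma szego_upper_poly:
  assumes fin: "finite_measure M" and sets: "sets M = sets circle_lebesgue"
    and S: "\<And>p. poly p 0 = 1 \<Longrightarrow> S \<le> (\<integral>z. (cmod (poly p z))\<^sup>2 \<partial>M)"
  shows "S \<le> exp (\<integral>z. Re (poly q z) \<partial>circle_lebesgue) * (\<integral>z. exp (- Re (poly q z)) \<partial>M)"
proof -
  define u where "u = Polynomial.smult (-1/2) (q - [:poly q 0:])"
  have u: "poly u z = - (poly q z - poly q 0) / 2" for z by (simp add: u_def diff_divide_distrib)
  have "S \<le> (\<integral>z. (cmod (poly 1 z))\<^sup>2 * exp (2 * Re (poly u z)) \<partial>M)"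
  proof (rule LIMSEQ_le_const[OF integral_exp_poly_tendsto[OF fin sets]])
    show "\<exists>N. \<forall>n\<ge>N. S \<le> (\<integral>z. (cmod (poly (1 * exp_poly u n) z))\<^sup>2 \<partial>M)"
      by (intro exI allI impI S) (simp add: poly_exp_poly_0 u)
  qed
  also have "\<dots> = (\<integral>z. exp (Re (poly q 0)) * exp (- Re (poly q z)) \<partial>M)"
  proof -
    have "2 * Re (poly u z) = Re (poly q 0) + - Re (poly q z)" for z by (simp add: u diff_divide_distrib)
    then show ?thesis by (simp only: exp_add) simp
  qed
  finally show ?thesis by (simp add: integral_Re_poly)
qed

lemma cmod_integral_square_le:
  assumes "prob_space M" "f \<in> borel_measurable M" "integrable M (\<lambda>x. (cmod (f x))\<^sup>2)"
  shows "(cmod (\<integral>x. f x \<partial>M))\<^sup>2 \<le> (\<integral>x. (cmod (f x))\<^sup>2 \<partial>M)"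
proof -
  have "cmod (\<integral>x. f x \<partial>M) \<le> (\<integral>x. \<bar>cmod (f x)\<bar> \<partial>M)" by simp
  also have "\<dots> \<le> sqrt (\<integral>x. (cmod (f x))\<^sup>2 \<partial>M)"
    by (rule integral_abs_le_sqrt) (use assms in auto)
  finally have "(cmod (\<integral>x. f x \<partial>M))\<^sup>2 \<le> (sqrt (\<integral>x. (cmod (f x))\<^sup>2 \<partial>M))\<^sup>2"
    by (intro power_mono) auto
  then show ?thesis by simp
qed

lemma szego_lower_poly:
  assumes p: "poly p 0 = 1"
  shows "exp (\<integral>z. Re (poly q z) \<partial>circle_lebesgue) \<le>
    (\<integral>z. (cmod (poly p z))\<^sup>2 * exp (Re (poly q z)) \<partial>circle_lebesgue)"
proof -
  interpret prob_space circle_lebesgue by (rule prob_space_circle_lebesgue)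
  define u where "u = Polynomial.smult (1/2) (q - [:poly q 0:])"
  have u: "poly u z = (poly q z - poly q 0) / 2" for z by (simp add: u_def)
  have "1 \<le> (\<integral>z. (cmod (poly p z))\<^sup>2 * exp (2 * Re (poly u z)) \<partial>circle_lebesgue)"
  proof (rule LIMSEQ_le_const[OF integral_exp_poly_tendsto[OF finite_measure_axioms refl]], intro exI allI impI)
    fix n :: nat
    \<comment> \<open>By the mean value property the integral on the left is p(0) times 1; the
      inequality is Cauchy-Schwarz.\<close>
    have "(cmod (\<integral>z. poly (p * exp_poly u n) z \<partial>circle_lebesgue))\<^sup>2 \<le>
      (\<integral>z. (cmod (poly (p * exp_poly u n) z))\<^sup>2 \<partial>circle_lebesgue)"
      by (intro cmod_integral_square_le prob_space_circle_lebesgue borel_measurable_circle refl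
          integrable_circle_continuous finite_measure_axioms continuous_intros)
    then show "1 \<le> (\<integral>z. (cmod (poly (p * exp_poly u n) z))\<^sup>2 \<partial>circle_lebesgue)"
      unfolding integral_circle_poly by (simp add: p poly_exp_poly_0 u)
  qed
  also have "\<dots> = (\<integral>z. exp (- Re (poly q 0)) * ((cmod (poly p z))\<^sup>2 * exp (Re (poly q z))) \<partial>circle_lebesgue)"
  proof -
    have "2 * Re (poly u z) = - Re (poly q 0) + Re (poly q z)" for z by (simp add: u diff_divide_distrib)
    then show ?thesis by (simp only: exp_add) (simp add: mult_ac)
  qed
  also have "\<dots> = exp (- Re (poly q 0)) * (\<integral>z. (cmod (poly p z))\<^sup>2 * exp (Re (poly q z)) \<partial>circle_lebesgue)"
    by simp
  finally show ?thesis by (simp add: integral_Re_poly exp_minus field_simps)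
qed

section \<open>Approximating bounded Borel functions by Re q\<close>

lemma Re_poly_mult:
  "\<exists>q. \<forall>z\<in>circle. Re (poly p1 z) * Re (poly p2 z) = Re (poly q z)"
proof -
  \<comment> \<open>The product of the real parts of u and v is half the real part of
    \<open>u * v\<close> plus half that of \<open>u * cnj v\<close>. On the circle
    \<open>cnj z\<close> is the inverse of z, so the second term is, up to conjugation, a monomial
    whose exponent is the nonnegative difference. Thus real trigonometric polynomials form an
    algebra.\<close>
  define m where "m a b i j = monom (a * b / 2) (i + j) +
    (if j \<le> i then monom (a * cnj b / 2) (i - j) else monom (cnj a * b / 2) (j - i))" for a b :: complex and i j :: nat
  have m: "Re (a * z ^ i) * Re (b * z ^ j) = Re (poly (m a b i j) z)" if z: "z \<in> circle" for a b i j z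
  proof -
    have "cmod z = 1" using z by simp
    then have "z * cnj z = 1" using complex_norm_square[of z] by simp
    then have zz: "z ^ k * cnj z ^ k = 1" for k by (simp add: power_mult_distrib[symmetric])
    have main: "Re u * Re v = Re (u * v) / 2 + Re (u * cnj v) / 2" for u v :: complex
      by (simp add: field_simps)
    have cnj_swap: "Re (u * cnj v) = Re (cnj u * v)" for u v :: complex by simp
    show ?thesis
    proof (cases "j \<le> i")
      case True
      then have pm: "poly (m a b i j) z = (a * b * z ^ (i + j)) / 2 + (a * cnj b * z ^ (i - j)) / 2"
        by (simp add: m_def poly_monom)
      from True have "z ^ i * cnj z ^ j = z ^ (i - j)"
        using zz[of j] by (metis (no_types, lifting) le_add_diff_inverse2 mult.assoc mult.right_neutral power_add)
      then have "(a * z ^ i) * cnj (b * z ^ j) = a * cnj b * z ^ (i - j)" by (simp add: mult_ac)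
      moreover have "(a * z ^ i) * (b * z ^ j) = a * b * z ^ (i + j)" by (simp add: power_add mult_ac)
      ultimately show ?thesis using main[of "a * z ^ i" "b * z ^ j"] pm by (simp only: plus_complex.sel Re_divide_numeral)
    next
      case False
      have pm: "poly (m a b i j) z = (a * b * z ^ (i + j)) / 2 + (cnj a * b * z ^ (j - i)) / 2"
        using False by (simp add: m_def poly_monom)
      from False have "z ^ j * cnj z ^ i = z ^ (j - i)"
        using zz[of i] by (metis (no_types, lifting) nat_le_linear le_add_diff_inverse2 mult.assoc mult.right_neutral power_add)
      then have "cnj (a * z ^ i) * (b * z ^ j) = cnj a * b * z ^ (j - i)" by (simp add: mult_ac)
      moreover have "Re ((a * z ^ i) * cnj (b * z ^ j)) = Re (cnj (a * z ^ i) * (b * z ^ j))"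
        using cnj_swap .
      moreover have "(a * z ^ i) * (b * z ^ j) = a * b * z ^ (i + j)" by (simp add: power_add mult_ac)
      ultimately show ?thesis using main[of "a * z ^ i" "b * z ^ j"] pm by (simp only: plus_complex.sel Re_divide_numeral)
    qed
  qed
  show ?thesis
  proof (intro exI ballI)
    fix z assume z: "z \<in> circle"
    have "Re (poly p1 z) * Re (poly p2 z) =
      (\<Sum>i\<le>degree p1. \<Sum>j\<le>degree p2. Re (coeff p1 i * z ^ i) * Re (coeff p2 j * z ^ j))"
      by (simp only: poly_altdef Re_sum sum_product)
    also have "\<dots> = Re (poly (\<Sum>i\<le>degree p1. \<Sum>j\<le>degree p2. m (coeff p1 i) (coeff p2 j) i j) z)"
      by (simp only: m[OF z] poly_sum Re_sum)
    finally show "Re (poly p1 z) * Re (poly p2 z) =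
      Re (poly (\<Sum>i\<le>degree p1. \<Sum>j\<le>degree p2. m (coeff p1 i) (coeff p2 j) i j) z)" .
  qed
qed

text \<open>Stone-Weierstrass for real trigonometric polynomials. Passing to real parts is
  essential: polynomials in z alone are not uniformly dense on the circle.\<close>

lemma continuous_circle_approx_Re_poly:
  fixes g :: "complex \<Rightarrow> real"
  assumes g: "continuous_on circle g" and e: "0 < e"
  obtains q where "\<And>z. z \<in> circle \<Longrightarrow> \<bar>g z - Re (poly q z)\<bar> < e"
proof -
  define R where "R = {h. \<exists>q. \<forall>z\<in>circle. h z = Re (poly q z)}"
  interpret function_ring_on R circle
  proof
    show "compact circle" by simp
    show "continuous_on circle h" if "h \<in> R" for h
    proof -
      from that obtain q where q: "\<And>z. z \<in> circle \<Longrightarrow> h z = Re (poly q z)" by (auto simp: R_def)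
      have "continuous_on circle (\<lambda>z. Re (poly q z))" by (intro continuous_intros)
      then show ?thesis by (rule continuous_on_eq) (rule q[symmetric])
    qed
    show "(\<lambda>x. h x + k x) \<in> R" if hk: "h \<in> R" "k \<in> R" for h k
    proof -
      obtain q1 q2 where "\<And>z. z \<in> circle \<Longrightarrow> h z = Re (poly q1 z)" "\<And>z. z \<in> circle \<Longrightarrow> k z = Re (poly q2 z)"
        using hk by (auto simp: R_def)
      then have "\<forall>z\<in>circle. h z + k z = Re (poly (q1 + q2) z)" by simp
      then show ?thesis unfolding R_def by blast
    qed
    show "(\<lambda>x. h x * k x) \<in> R" if hk: "h \<in> R" "k \<in> R" for h k
    proof -
      obtain q1 q2 where "\<And>z. z \<in> circle \<Longrightarrow> h z = Re (poly q1 z)" "\<And>z. z \<in> circle \<Longrightarrow> k z = Re (poly q2 z)"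
        using hk by (auto simp: R_def)
      then show ?thesis using Re_poly_mult[of q1 q2] by (simp add: R_def)
    qed
    have "\<forall>z\<in>circle. c = Re (poly [:of_real c:] z)" for c by simp
    then show "(\<lambda>_. c) \<in> R" for c unfolding R_def by blast
    show "\<exists>h\<in>R. h x \<noteq> h y" if "x \<noteq> y" for x y
    proof (cases "Re x = Re y")
      case False
      have "\<forall>z\<in>circle. Re z = Re (poly [:0, 1:] z)" by simp
      then have "Re \<in> R" unfolding R_def by blast
      with False show ?thesis by blast
    next
      case True
      then have "Im x \<noteq> Im y" using that by (simp add: complex_eq_iff)
      \<comment> \<open>Im z is the real part of -i z, so Im belongs to the algebra and together
        with Re separates points.\<close>
      moreover have "\<forall>z\<in>circle. Im z = Re (poly [:0, - \<i>:] z)" by simp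
      then have "Im \<in> R" unfolding R_def by blast
      ultimately show ?thesis by blast
    qed
  qed
  obtain h where "h \<in> R" and h: "\<And>z. z \<in> circle \<Longrightarrow> \<bar>g z - h z\<bar> < e"
    using Stone_Weierstrass_basic[OF g e] by blast
  then obtain q where "\<And>z. z \<in> circle \<Longrightarrow> h z = Re (poly q z)" by (auto simp: R_def)
  then show ?thesis using h that by (metis (no_types, lifting))
qed

text \<open>Regularity encloses a Borel set between a compact and an open set of nearly equal
  measure, and Urysohn's function for this pair approximates the indicator. Boundedness is carried
  along so that the approximants stay integrable.\<close>

lemma L1_approx_continuous:
  fixes h :: "complex \<Rightarrow> real"
  assumes fin: "finite_measure M" and sets: "sets M = sets borel" and h: "integrable M h" and e: "0 < e"
  shows "\<exists>g. continuous_on UNIV g \<and> bounded (range g) \<and> (\<integral>z. \<bar>h z - g z\<bar> \<partial>M) < e"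
  using h e
proof (induction arbitrary: e rule: integrable_induct)
  case (base A c)
  interpret finite_measure M by fact
  have A: "A \<in> sets borel" using base sets by simp
  \<comment> \<open>The final error is at most \<open>\<bar>c\<bar> * (2 * e')\<close>, that is, e
    times |c| / (|c| + 1).\<close>
  define e' where "e' = e / (2 * (\<bar>c\<bar> + 1))"
  have e': "0 < e'" using base by (simp add: e'_def)
  have fin': "emeasure M (space M) \<noteq> \<infinity>" by simp
  have K: "\<exists>K. K \<subseteq> A \<and> compact K \<and> measure M A < measure M K + e'"
  proof (rule ccontr)
    assume "\<not> ?thesis"
    then have "\<And>K. K \<subseteq> A \<Longrightarrow> compact K \<Longrightarrow> measure M K \<le> measure M A - e'" by force
    then have "(SUP K \<in> {K. K \<subseteq> A \<and> compact K}. emeasure M K) \<le> ennreal (measure M A - e')"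
      by (intro SUP_least) (auto simp: emeasure_eq_measure intro!: ennreal_leI)
    then have "ennreal (measure M A) \<le> ennreal (measure M A - e')"
      using inner_regular[OF sets fin' A] by (simp add: emeasure_eq_measure)
    \<comment> \<open>\<open>ennreal\<close> sends a negative \<open>measure M A - e'\<close> to 0,
      so the case of a null set A survives the comparison; the compact set {} disposes of
      it.\<close>
    then have "measure M A = 0" using e' measure_nonneg[of M A] by (auto simp: ennreal_le_iff2)
    moreover have "measure M {} \<le> measure M A - e'"
      by (rule \<open>\<And>K. K \<subseteq> A \<Longrightarrow> compact K \<Longrightarrow> measure M K \<le> measure M A - e'\<close>) auto
    ultimately show False using e' by simp
  qed
  have U: "\<exists>U. A \<subseteq> U \<and> open U \<and> measure M U < measure M A + e'"
  proof (rule ccontr)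
    assume "\<not> ?thesis"
    then have "\<And>U. A \<subseteq> U \<Longrightarrow> open U \<Longrightarrow> measure M A + e' \<le> measure M U" by force
    then have "ennreal (measure M A + e') \<le> (INF U \<in> {U. A \<subseteq> U \<and> open U}. emeasure M U)"
      by (intro INF_greatest) (auto simp: emeasure_eq_measure intro!: ennreal_leI)
    then have "ennreal (measure M A + e') \<le> ennreal (measure M A)"
      using outer_regular[OF sets fin' A] by (simp add: emeasure_eq_measure)
    then show False using e' by (simp add: ennreal_le_iff2)
  qed
  obtain K U where KU: "K \<subseteq> A" "compact K" "measure M A < measure M K + e'"
    "A \<subseteq> U" "open U" "measure M U < measure M A + e'" using K U by blast
  obtain f :: "complex \<Rightarrow> real" where f: "continuous_on UNIV f"
    "\<And>x. f x \<in> closed_segment 1 0" "\<And>x. x \<in> K \<Longrightarrow> f x = 1" "\<And>x. x \<in> - U \<Longrightarrow> f x = 0"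
    by (rule Urysohn[of K "- U" "1::real" 0]) (use KU in \<open>auto intro: compact_imp_closed\<close>)
  have f01: "0 \<le> f x" "f x \<le> 1" for x
    using f(2)[of x] by (auto simp: closed_segment_eq_real_ivl)
  have UM: "U \<in> sets M" "K \<in> sets M" using KU sets by (auto simp: borel_compact)
  have fm: "f \<in> borel_measurable M"
    using borel_measurable_continuous_onI[OF f(1)] by (simp add: measurable_cong_sets[OF sets refl])
  have le: "\<bar>indicator A x *\<^sub>R c - c * f x\<bar> \<le> \<bar>c\<bar> * indicator (U - K) x" for x
  proof -
    have "\<bar>indicator A x - f x\<bar> \<le> indicator (U - K) x"
      using f01[of x] f(3,4)[of x] KU by (auto simp: indicator_def)
    then have "\<bar>c\<bar> * \<bar>indicator A x - f x\<bar> \<le> \<bar>c\<bar> * indicator (U - K) x" by (rule mult_left_mono) simp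
    then show ?thesis by (simp add: abs_mult[symmetric] algebra_simps)
  qed
  have mUK: "measure M (U - K) < 2 * e'"
    using finite_measure_Diff[OF UM] KU by auto
  have "(\<integral>x. \<bar>indicator A x *\<^sub>R c - c * f x\<bar> \<partial>M) \<le> (\<integral>x. \<bar>c\<bar> * indicator (U - K) x \<partial>M)"
    by (rule integral_mono'[OF _ le]) (use UM in \<open>auto intro!: integrable_real_indicator simp: less_top[symmetric]\<close>)
  also have "\<dots> = \<bar>c\<bar> * measure M (U - K)" using UM by simp
  also have "\<dots> \<le> \<bar>c\<bar> * (2 * e')" using mUK by (intro mult_left_mono) auto
  also have "\<dots> < e" using base(3) by (simp add: e'_def field_simps)
  finally have "(\<integral>x. \<bar>indicator A x *\<^sub>R c - c * f x\<bar> \<partial>M) < e" .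
  moreover have "continuous_on UNIV (\<lambda>x. c * f x)" using f by (intro continuous_intros)
  moreover have "bounded (range (\<lambda>x. c * f x))"
    using f01 by (auto simp: bounded_iff abs_mult intro!: exI[of _ "\<bar>c\<bar>"] mult_left_le)
  ultimately show ?case by blast
next
  case (add u v)
  interpret finite_measure M by fact
  have "0 < e / 2" using add.prems by simp
  then obtain g k where g: "continuous_on UNIV g" "bounded (range g)" "(\<integral>z. \<bar>u z - g z\<bar> \<partial>M) < e / 2"
    and k: "continuous_on UNIV k" "bounded (range k)" "(\<integral>z. \<bar>v z - k z\<bar> \<partial>M) < e / 2"
    using add.IH by meson
  have int: "integrable M w" if w: "continuous_on UNIV w" "bounded (range w)" for w :: "complex \<Rightarrow> real"
  proof -
    obtain B where "\<And>x. norm (w x) \<le> B" using w(2) by (auto simp: bounded_iff)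
    then show ?thesis using borel_measurable_continuous_onI[OF w(1)]
      by (intro integrable_const_bound[of _ B]) (auto simp: measurable_cong_sets[OF sets refl])
  qed
  have "(\<integral>z. \<bar>u z + v z - (g z + k z)\<bar> \<partial>M) \<le> (\<integral>z. \<bar>u z - g z\<bar> + \<bar>v z - k z\<bar> \<partial>M)"
    using int g k add by (intro integral_mono) auto
  also have "\<dots> = (\<integral>z. \<bar>u z - g z\<bar> \<partial>M) + (\<integral>z. \<bar>v z - k z\<bar> \<partial>M)"
    using int g k add by simp
  also have "\<dots> < e" using g k by simp
  finally have "(\<integral>z. \<bar>u z + v z - (g z + k z)\<bar> \<partial>M) < e" .
  moreover have "continuous_on UNIV (\<lambda>z. g z + k z)" using g k by (intro continuous_intros)
  moreover have "bounded (range (\<lambda>z. g z + k z))" using g k by (intro bounded_plus_comp)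
  ultimately show ?case by blast
next
  case (lim u s)
  interpret finite_measure M by fact
  have [measurable]: "u \<in> borel_measurable M" "\<And>i. s i \<in> borel_measurable M" using lim by auto
  have "(\<lambda>i. \<integral>z. \<bar>u z - s i z\<bar> \<partial>M) \<longlonglongrightarrow> (\<integral>z. 0 \<partial>M)"
  proof (rule integral_dominated_convergence[where w = "\<lambda>z. 3 * \<bar>u z\<bar>"])
    show "AE z in M. (\<lambda>i. \<bar>u z - s i z\<bar>) \<longlonglongrightarrow> 0"
    proof (rule AE_I2)
      fix z assume "z \<in> space M"
      then have "(\<lambda>i. \<bar>u z - s i z\<bar>) \<longlonglongrightarrow> \<bar>u z - u z\<bar>" using lim by (intro tendsto_intros) auto
      then show "(\<lambda>i. \<bar>u z - s i z\<bar>) \<longlonglongrightarrow> 0" by simp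
    qed
    show "AE z in M. norm \<bar>u z - s i z\<bar> \<le> 3 * \<bar>u z\<bar>" for i
    proof (rule AE_I2)
      fix z assume "z \<in> space M"
      then have "\<bar>s i z\<bar> \<le> 2 * \<bar>u z\<bar>" using lim by auto
      then show "norm \<bar>u z - s i z\<bar> \<le> 3 * \<bar>u z\<bar>" by simp
    qed
  qed (use lim in auto)
  then have l: "(\<lambda>i. \<integral>z. \<bar>u z - s i z\<bar> \<partial>M) \<longlonglongrightarrow> 0" by simp
  have "\<forall>\<^sub>F i in sequentially. (\<integral>z. \<bar>u z - s i z\<bar> \<partial>M) < e / 2"
    by (rule order_tendstoD(2)[OF l]) (use lim.prems in simp)
  then obtain i where i: "(\<integral>z. \<bar>u z - s i z\<bar> \<partial>M) < e / 2" by (auto simp: eventually_sequentially)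
  obtain g where g: "continuous_on UNIV g" "bounded (range g)" "(\<integral>z. \<bar>s i z - g z\<bar> \<partial>M) < e / 2"
    using lim.IH[of "e / 2" i] lim.prems by auto
  have gi: "integrable M g"
  proof -
    obtain B where "\<And>x. norm (g x) \<le> B" using g(2) by (auto simp: bounded_iff)
    then show ?thesis using borel_measurable_continuous_onI[OF g(1)]
      by (intro integrable_const_bound[of _ B]) (auto simp: measurable_cong_sets[OF sets refl])
  qed
  have "(\<integral>z. \<bar>u z - g z\<bar> \<partial>M) \<le> (\<integral>z. \<bar>u z - s i z\<bar> + \<bar>s i z - g z\<bar> \<partial>M)"
    using gi lim by (intro integral_mono) auto
  also have "\<dots> = (\<integral>z. \<bar>u z - s i z\<bar> \<partial>M) + (\<integral>z. \<bar>s i z - g z\<bar> \<partial>M)"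
    using gi lim by simp
  also have "\<dots> < e" using g i by simp
  finally show ?case using g by blast
qed


text \<open>Two measures are both absolutely continuous with respect to their sum, so convergence
  almost everywhere for the sum gives it for both.\<close>

lemma sum_measure_exists:
  assumes sets: "sets N = sets M"
  obtains m where "sets m = sets M" "\<And>A. A \<in> sets M \<Longrightarrow> emeasure m A = emeasure M A + emeasure N A"
proof
  let ?m = "measure_of (space M) (sets M) (\<lambda>A. emeasure M A + emeasure N A)"
  show s: "sets ?m = sets M" by simp
  show "emeasure ?m A = emeasure M A + emeasure N A" if "A \<in> sets M" for A
  proof (rule emeasure_measure_of[OF refl])
    show "positive (sets ?m) (\<lambda>A. emeasure M A + emeasure N A)"
      by (simp add: positive_def)
    show "countably_additive (sets ?m) (\<lambda>A. emeasure M A + emeasure N A)"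
      unfolding countably_additive_def s
    proof (intro allI impI)
      fix A :: "nat \<Rightarrow> 'a set" assume A: "range A \<subseteq> sets M" "disjoint_family A" "\<Union> (range A) \<in> sets M"
      have "(\<Sum>i. emeasure M (A i) + emeasure N (A i)) = (\<Sum>i. emeasure M (A i)) + (\<Sum>i. emeasure N (A i))"
        by (rule suminf_add[symmetric]) (rule summableI)+
      then show "(\<Sum>i. emeasure M (A i) + emeasure N (A i)) = emeasure M (\<Union> (range A)) + emeasure N (\<Union> (range A))"
        using A sets by (simp add: suminf_emeasure)
    qed
  qed (use that sets.sets_into_space in auto)
qed

text \<open>One sequence must serve both measures, because \<open>szego_upper\<close> contains an
  integral over each and M may have a singular part. The measures are carried over to the plane,
  where the regularity argument applies, and h is extended by 0.\<close>

lemma bounded_borel_approx_Re_poly: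
  fixes h :: "complex \<Rightarrow> real"
  assumes fin: "finite_measure M" and sets: "sets M = sets circle_lebesgue"
    and h: "h \<in> borel_measurable circle_lebesgue" and C: "\<And>z. z \<in> circle \<Longrightarrow> \<bar>h z\<bar> \<le> C"
  obtains q where "\<forall>n. \<forall>z\<in>circle. \<bar>Re (poly (q n) z)\<bar> \<le> C + 1"
    "AE z in circle_lebesgue. (\<lambda>n. Re (poly (q n) z)) \<longlonglongrightarrow> h z"
    "AE z in M. (\<lambda>n. Re (poly (q n) z)) \<longlonglongrightarrow> h z"
proof -
  interpret L: prob_space circle_lebesgue by (rule prob_space_circle_lebesgue)
  interpret M: finite_measure M by fact
  have C0: "0 \<le> C" using C[of 1] by simp
  have id1: "(\<lambda>z. z) \<in> circle_lebesgue \<rightarrow>\<^sub>M (borel :: complex measure)"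
    by (intro borel_measurable_circle refl continuous_intros)
  have id2: "(\<lambda>z. z) \<in> M \<rightarrow>\<^sub>M (borel :: complex measure)"
    by (intro borel_measurable_circle sets continuous_intros)
  let ?L = "distr circle_lebesgue borel (\<lambda>z. z)" and ?M = "distr M borel (\<lambda>z. z)"
  obtain m where ms: "sets m = sets ?L" and me: "\<And>A. A \<in> sets ?L \<Longrightarrow> emeasure m A = emeasure ?L A + emeasure ?M A"
    by (rule sum_measure_exists[of ?M ?L]) auto
  have ms': "sets m = sets borel" using ms by simp
  interpret m: finite_measure m
  proof (rule finite_measureI)
    interpret L': finite_measure ?L by (rule L.finite_measure_distr[OF id1])
    interpret M': finite_measure ?M by (rule M.finite_measure_distr[OF id2])
    have "space m = UNIV" using sets_eq_imp_space_eq[OF ms'] by simp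
    then show "emeasure m (space m) \<noteq> \<infinity>"
      using me[of UNIV] by (simp add: L'.emeasure_eq_measure M'.emeasure_eq_measure)
  qed
  have acL: "absolutely_continuous m ?L" "absolutely_continuous m ?M"
    using me ms by (auto simp: absolutely_continuous_def null_sets_def)
  define h' where "h' z = indicator circle z *\<^sub>R h z" for z
  have h'_eq: "h' z = h z" if "z \<in> circle" for z using that by (simp add: h'_def)
  have "h \<in> borel_measurable (restrict_space borel circle)"
    using h by (simp add: measurable_cong_sets[OF sets_circle_lebesgue refl])
  then have h'b: "h' \<in> borel_measurable borel"
    unfolding h'_def[abs_def] by (subst (asm) borel_measurable_restrict_space_iff) auto
  then have h'm [measurable]: "h' \<in> borel_measurable m"
    by (simp add: measurable_cong_sets[OF ms' refl])
  have h'C: "\<bar>h' z\<bar> \<le> C" for z using C[of z] C0 by (simp add: h'_def indicator_def del: mem_sphere_0)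
  have h'i: "integrable m h'"
    by (rule m.integrable_const_bound[of _ C]) (use h'C in auto)
  have "\<exists>g. continuous_on UNIV g \<and> bounded (range g) \<and> (\<integral>z. \<bar>h' z - g z\<bar> \<partial>m) < (1/2)^n" for n :: nat
    by (rule L1_approx_continuous[OF m.finite_measure_axioms ms' h'i]) simp
  then have "\<forall>n. \<exists>g. continuous_on UNIV g \<and> bounded (range g) \<and> (\<integral>z. \<bar>h' z - g z\<bar> \<partial>m) < (1/2)^n" ..
  from choice[OF this] obtain g where g: "\<And>n::nat. continuous_on UNIV (g n)" "\<And>n. bounded (range (g n))"
    "\<And>n. (\<integral>z. \<bar>h' z - g n z\<bar> \<partial>m) < (1/2)^n" by blast
  \<comment> \<open>Clipping to [-C, C] cannot increase the distance to \<open>h'\<close>, which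
    takes its values there, and it provides the uniform bound that dominated convergence needs
    later.\<close>
  define k where "k n z = max (- C) (min C (g n z))" for n z
  have kc: "continuous_on UNIV (k n)" for n unfolding k_def[abs_def] by (intro continuous_intros g)
  have kC: "\<bar>k n z\<bar> \<le> C" for n z using C0 by (auto simp: k_def)
  have meas: "w \<in> borel_measurable m" if "continuous_on UNIV w" for w :: "complex \<Rightarrow> real"
    using borel_measurable_continuous_onI[OF that] by (simp add: measurable_cong_sets[OF ms' refl])
  have gi: "integrable m (g n)" for n
  proof -
    obtain B where "\<And>x. norm (g n x) \<le> B" using g(2)[of n] unfolding bounded_iff by blast
    then show ?thesis by (intro m.integrable_const_bound[of _ B] meas g) auto
  qed
  have ki: "integrable m (k n)" for n
    by (rule m.integrable_const_bound[of _ C]) (use kC meas[OF kc] in auto)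
  have kle: "\<bar>h' z - k n z\<bar> \<le> \<bar>h' z - g n z\<bar>" for n z
    using h'C[of z] by (auto simp: k_def max_def min_def abs_le_iff abs_if split: if_splits)
  have "AE z in m. (\<lambda>n. \<bar>h' z - k n z\<bar>) \<longlonglongrightarrow> 0"
  proof (rule AE_tendsto_zero_of_summable)
    show "summable (\<lambda>n. \<integral>z. \<bar>h' z - k n z\<bar> \<partial>m)"
    proof (rule summable_comparison_test')
      show "summable (\<lambda>i. (1/2::real)^i)" by (rule summable_geometric) simp
      show "norm (\<integral>z. \<bar>h' z - k n z\<bar> \<partial>m) \<le> (1/2)^n" for n
      proof -
        have "(\<integral>z. \<bar>h' z - k n z\<bar> \<partial>m) \<le> (\<integral>z. \<bar>h' z - g n z\<bar> \<partial>m)"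
          by (intro integral_mono kle) (use h'i ki gi in auto)
        then show ?thesis using g(3)[of n] by simp
      qed
    qed
  qed (use h'i ki in auto)
  then have aem: "AE z in m. (\<lambda>n. k n z) \<longlonglongrightarrow> h' z"
  proof eventually_elim
    case (elim z)
    then have "(\<lambda>n. h' z - k n z) \<longlonglongrightarrow> 0" by (rule tendsto_rabs_zero_cancel)
    then have "(\<lambda>n. h' z - (h' z - k n z)) \<longlonglongrightarrow> h' z - 0" by (intro tendsto_intros)
    then show ?case by simp
  qed
  have "\<exists>q. \<forall>z\<in>circle. \<bar>k n z - Re (poly q z)\<bar> < 1 / real (Suc n)" for n
  proof -
    have "continuous_on circle (k n)" using kc continuous_on_subset by blast
    then obtain q where "\<And>z. z \<in> circle \<Longrightarrow> \<bar>k n z - Re (poly q z)\<bar> < 1 / real (Suc n)"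
      by (rule continuous_circle_approx_Re_poly[of "k n" "1 / real (Suc n)"]) auto
    then show ?thesis by blast
  qed
  then have "\<forall>n. \<exists>q. \<forall>z\<in>circle. \<bar>k n z - Re (poly q z)\<bar> < 1 / real (Suc n)" ..
  from choice[OF this] obtain q where q: "\<And>n z. z \<in> circle \<Longrightarrow> \<bar>k n z - Re (poly (q n) z)\<bar> < 1 / real (Suc n)"
    by blast
  have lim: "(\<lambda>n. Re (poly (q n) z)) \<longlonglongrightarrow> h z" if z: "z \<in> circle" and l: "(\<lambda>n. k n z) \<longlonglongrightarrow> h' z" for z
  proof -
    have s0: "(\<lambda>n. 1 / real (Suc n)) \<longlonglongrightarrow> 0" by (rule LIMSEQ_Suc[OF lim_const_over_n])
    have "(\<lambda>n. k n z - Re (poly (q n) z)) \<longlonglongrightarrow> 0"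
      by (rule Lim_null_comparison[OF _ s0]) (use q[OF z] in \<open>auto intro!: always_eventually less_imp_le\<close>)
    from tendsto_diff[OF l this] show ?thesis using h'_eq[OF z] by simp
  qed
  show ?thesis
  proof (rule that)
    show "\<forall>n. \<forall>z\<in>circle. \<bar>Re (poly (q n) z)\<bar> \<le> C + 1"
    proof (intro allI ballI)
      fix n z assume z: "z \<in> circle"
      have "1 / real (Suc n) \<le> 1" by simp
      then show "\<bar>Re (poly (q n) z)\<bar> \<le> C + 1" using q[OF z, of n] kC[of n z] by linarith
    qed
    have "AE z in ?L. (\<lambda>n. k n z) \<longlonglongrightarrow> h' z" "AE z in ?M. (\<lambda>n. k n z) \<longlonglongrightarrow> h' z"
      by (rule absolutely_continuous_AE[OF _ acL(1) aem], simp add: ms)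
        (rule absolutely_continuous_AE[OF _ acL(2) aem], simp add: ms)
    note ae = AE_distrD[OF id1 this(1)] AE_distrD[OF id2 this(2)]
    show "AE z in circle_lebesgue. (\<lambda>n. Re (poly (q n) z)) \<longlonglongrightarrow> h z"
      using ae(1) AE_space by eventually_elim (use lim in auto)
    show "AE z in M. (\<lambda>n. Re (poly (q n) z)) \<longlonglongrightarrow> h z"
      using ae(2) AE_space by eventually_elim (use lim sets_eq_imp_space_eq[OF sets] in auto)
  qed
qed

lemma integral_bounded_limit:
  fixes g :: "nat \<Rightarrow> complex \<Rightarrow> real"
  assumes fin: "finite_measure M" and sets: "sets M = sets circle_lebesgue"
    and "\<And>n. g n \<in> borel_measurable M" "h \<in> borel_measurable M"
    and "AE z in M. (\<lambda>n. g n z) \<longlonglongrightarrow> h z" and b: "\<And>n z. z \<in> circle \<Longrightarrow> \<bar>g n z\<bar> \<le> B"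
  shows "(\<lambda>n. \<integral>z. g n z \<partial>M) \<longlonglongrightarrow> (\<integral>z. h z \<partial>M)"
proof -
  interpret finite_measure M by fact
  show ?thesis
    by (rule integral_dominated_convergence[where w = "\<lambda>_. B", OF assms(4,3) _ assms(5)])
      (use b sets_eq_imp_space_eq[OF sets] in \<open>auto intro!: AE_I2\<close>)
qed

lemma szego_upper:
  assumes fin: "finite_measure M" and sets: "sets M = sets circle_lebesgue"
    and S: "\<And>p. poly p 0 = 1 \<Longrightarrow> S \<le> (\<integral>z. (cmod (poly p z))\<^sup>2 \<partial>M)"
    and h: "h \<in> borel_measurable circle_lebesgue" and C: "\<And>z. z \<in> circle \<Longrightarrow> \<bar>h z\<bar> \<le> C"
  shows "S \<le> exp (\<integral>z. h z \<partial>circle_lebesgue) * (\<integral>z. exp (- h z) \<partial>M)"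
proof -
  obtain q where q': "\<forall>n. \<forall>z\<in>circle. \<bar>Re (poly (q n) z)\<bar> \<le> C + 1"
    and qL: "AE z in circle_lebesgue. (\<lambda>n. Re (poly (q n) z)) \<longlonglongrightarrow> h z"
    and qM: "AE z in M. (\<lambda>n. Re (poly (q n) z)) \<longlonglongrightarrow> h z"
    by (rule bounded_borel_approx_Re_poly[OF fin sets h C])
  note q = q'[rule_format] qL qM
  interpret prob_space circle_lebesgue by (rule prob_space_circle_lebesgue)
  have hM [measurable]: "h \<in> borel_measurable M" using h by (simp add: measurable_cong_sets[OF sets refl])
  have 1: "(\<lambda>n. \<integral>z. Re (poly (q n) z) \<partial>circle_lebesgue) \<longlonglongrightarrow> (\<integral>z. h z \<partial>circle_lebesgue)"
    by (rule integral_bounded_limit[OF finite_measure_axioms refl _ h q(2) q(1)])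
      (intro borel_measurable_circle refl continuous_intros)
  have 2: "(\<lambda>n. \<integral>z. exp (- Re (poly (q n) z)) \<partial>M) \<longlonglongrightarrow> (\<integral>z. exp (- h z) \<partial>M)"
  proof (rule integral_bounded_limit[OF fin sets])
    show "AE z in M. (\<lambda>n. exp (- Re (poly (q n) z))) \<longlonglongrightarrow> exp (- h z)"
      using q(3) by eventually_elim (intro tendsto_intros)
    show "\<bar>exp (- Re (poly (q n) z))\<bar> \<le> exp (C + 1)" if "z \<in> circle" for n z
      using q(1)[OF that, of n] by simp
    show "(\<lambda>z. exp (- Re (poly (q n) z))) \<in> borel_measurable M" for n
      by (intro borel_measurable_circle sets continuous_intros)
  qed measurable
  show ?thesis
    by (rule LIMSEQ_le_const[OF tendsto_mult[OF tendsto_exp[OF 1] 2]])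
      (intro exI allI impI szego_upper_poly[OF fin sets S])
qed

lemma szego_lower:
  assumes p: "poly p 0 = 1"
    and h: "h \<in> borel_measurable circle_lebesgue" and C: "\<And>z. z \<in> circle \<Longrightarrow> \<bar>h z\<bar> \<le> C"
  shows "exp (\<integral>z. h z \<partial>circle_lebesgue) \<le> (\<integral>z. (cmod (poly p z))\<^sup>2 * exp (h z) \<partial>circle_lebesgue)"
proof -
  interpret prob_space circle_lebesgue by (rule prob_space_circle_lebesgue)
  note [measurable] = h
  obtain q where q': "\<forall>n. \<forall>z\<in>circle. \<bar>Re (poly (q n) z)\<bar> \<le> C + 1"
    and qL: "AE z in circle_lebesgue. (\<lambda>n. Re (poly (q n) z)) \<longlonglongrightarrow> h z"
    by (rule bounded_borel_approx_Re_poly[OF finite_measure_axioms refl h C])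
  note q = q'[rule_format] qL
  obtain B where B: "\<And>z. z \<in> circle \<Longrightarrow> cmod (poly p z) \<le> B" using poly_bounded_circle[of p] by blast
  have pm [measurable]: "(\<lambda>z. cmod (poly p z)) \<in> borel_measurable circle_lebesgue"
    by (intro borel_measurable_circle refl continuous_intros)
  have 1: "(\<lambda>n. \<integral>z. Re (poly (q n) z) \<partial>circle_lebesgue) \<longlonglongrightarrow> (\<integral>z. h z \<partial>circle_lebesgue)"
    by (rule integral_bounded_limit[OF finite_measure_axioms refl _ h q(2) q(1)])
      (intro borel_measurable_circle refl continuous_intros)
  have 2: "(\<lambda>n. \<integral>z. (cmod (poly p z))\<^sup>2 * exp (Re (poly (q n) z)) \<partial>circle_lebesgue) \<longlonglongrightarrow>
    (\<integral>z. (cmod (poly p z))\<^sup>2 * exp (h z) \<partial>circle_lebesgue)"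
  proof (rule integral_bounded_limit[OF finite_measure_axioms refl])
    show "AE z in circle_lebesgue. (\<lambda>n. (cmod (poly p z))\<^sup>2 * exp (Re (poly (q n) z))) \<longlonglongrightarrow> (cmod (poly p z))\<^sup>2 * exp (h z)"
      using q(2) by eventually_elim (intro tendsto_intros)
    show "\<bar>(cmod (poly p z))\<^sup>2 * exp (Re (poly (q n) z))\<bar> \<le> B\<^sup>2 * exp (C + 1)" if "z \<in> circle" for n z
      using q(1)[OF that, of n] B[OF that] by (auto simp: abs_mult intro!: mult_mono power_mono)
    show "(\<lambda>z. (cmod (poly p z))\<^sup>2 * exp (Re (poly (q n) z))) \<in> borel_measurable circle_lebesgue" for n
      by (intro borel_measurable_circle refl continuous_intros)
  qed measurable
  show ?thesis
    by (rule LIMSEQ_le[OF tendsto_exp[OF 1] 2]) (intro exI allI impI szego_lower_poly[OF p])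
qed

section \<open>The truncated density and the singular part\<close>

lemma ac_density_nn_integral:
  assumes sets: "sets N = sets M" and f: "is_ac_density M N f"
  obtains A where "A \<in> sets M" "AE x in M. x \<in> A"
    "\<forall>g\<in>borel_measurable M. (\<integral>\<^sup>+x. g x * indicator A x \<partial>N) = (\<integral>\<^sup>+x. g x * ennreal (f x) \<partial>M)"
proof -
  have fm [measurable]: "f \<in> borel_measurable M" using f by (simp add: is_ac_density_def)
  obtain S where S: "mutually_singular S M"
    and N: "\<And>A. A \<in> sets M \<Longrightarrow> emeasure N A = emeasure (density M (\<lambda>x. ennreal (f x))) A + emeasure S A"
    using f unfolding is_ac_density_def by blast
  \<comment> \<open>A is null for the singular part and has full measure for M; on A the measure N
    is therefore exactly \<open>f\<close> times M.\<close>
  then obtain A where A: "A \<in> sets S" "emeasure S A = 0" "emeasure M (space M - A) = 0" "sets S = sets M"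
    unfolding mutually_singular_def by blast
  then have AM [measurable]: "A \<in> sets M" by simp
  have ae: "AE x in M. x \<in> A"
    by (rule AE_I[of _ _ "space M - A"]) (use A in auto)
  have eq: "density N (indicator A) = density M (\<lambda>x. ennreal (f x))"
  proof (rule measure_eqI)
    show "sets (density N (indicator A)) = sets (density M (\<lambda>x. ennreal (f x)))" using sets by simp
    fix B assume "B \<in> sets (density N (indicator A))"
    then have B [measurable]: "B \<in> sets M" using sets by simp
    have AN: "A \<in> sets N" "B \<in> sets N" using sets by auto
    have "emeasure S (A \<inter> B) \<le> emeasure S A" by (rule emeasure_mono) (use A in auto)
    then have S0: "emeasure S (A \<inter> B) = 0" using A by simp
    have "emeasure (density N (indicator A)) B = emeasure N (A \<inter> B)"
      using AN by (subst emeasure_density) (auto simp: indicator_inter_arith[symmetric] Int_commute)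
    also have "\<dots> = emeasure (density M (\<lambda>x. ennreal (f x))) (A \<inter> B)" using N[of "A \<inter> B"] S0 by simp
    also have "\<dots> = (\<integral>\<^sup>+x. ennreal (f x) * indicator (A \<inter> B) x \<partial>M)" by (rule emeasure_density) auto
    also have "\<dots> = (\<integral>\<^sup>+x. ennreal (f x) * indicator B x \<partial>M)"
      by (rule nn_integral_cong_AE, rule AE_mp[OF ae], rule AE_I2) (auto simp: indicator_def)
    also have "\<dots> = emeasure (density M (\<lambda>x. ennreal (f x))) B" by (rule emeasure_density[symmetric]) auto
    finally show "emeasure (density N (indicator A)) B = emeasure (density M (\<lambda>x. ennreal (f x))) B" .
  qed
  show ?thesis
  proof (rule that[OF AM ae], rule ballI)
    fix g :: "'a \<Rightarrow> ennreal" assume [measurable]: "g \<in> borel_measurable M"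
    have gN: "g \<in> borel_measurable N" by (simp add: measurable_cong_sets[OF sets refl])
    have "(\<integral>\<^sup>+x. g x \<partial>density N (indicator A)) = (\<integral>\<^sup>+x. indicator A x * g x \<partial>N)"
      by (rule nn_integral_density) (use gN sets in auto)
    moreover have "(\<integral>\<^sup>+x. g x \<partial>density M (\<lambda>x. ennreal (f x))) = (\<integral>\<^sup>+x. ennreal (f x) * g x \<partial>M)"
      by (rule nn_integral_density) auto
    ultimately show "(\<integral>\<^sup>+x. g x * indicator A x \<partial>N) = (\<integral>\<^sup>+x. g x * ennreal (f x) \<partial>M)"
      using eq by (simp add: mult.commute)
  qed
qed

text \<open>\<open>f\<close> is cut to \<open>[1/(n+1), n+1]\<close>. On the set carrying the singular part of \<open>M\<close>, which is
  negligible for \<open>circle_lebesgue\<close>, the exponent in \<open>szego_upper\<close> may be taken arbitrarily large.\<close>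

definition cut :: "nat \<Rightarrow> real \<Rightarrow> real" where
  "cut n t = min (max t (1 / real (Suc n))) (real (Suc n))"

lemma cut_bounds: "1 / real (Suc n) \<le> cut n t" "cut n t \<le> real (Suc n)" "0 < cut n t"
proof -
  have "1 / real (Suc n) \<le> 1" "1 \<le> real (Suc n)" by (auto simp: field_simps)
  then have "1 / real (Suc n) \<le> real (Suc n)" by linarith
  then show "1 / real (Suc n) \<le> cut n t" "cut n t \<le> real (Suc n)" by (auto simp: cut_def)
  then show "0 < cut n t" by (smt (verit) of_nat_0_less_iff zero_less_Suc zero_less_divide_1_iff)
qed

lemma abs_ln_cut_le: "\<bar>ln (cut n t)\<bar> \<le> ln (real (Suc n))"
proof -
  have "ln (1 / real (Suc n)) \<le> ln (cut n t)" "ln (cut n t) \<le> ln (real (Suc n))"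
    using cut_bounds[of n t] by (auto intro!: ln_mono simp del: of_nat_Suc)
  then show ?thesis by (simp add: ln_div del: of_nat_Suc)
qed

lemma cut_le: "0 \<le> t \<Longrightarrow> cut n t \<le> t + 1 / real (Suc n)"
proof -
  assume "0 \<le> t"
  moreover have "0 \<le> 1 / real (Suc n)" by simp
  ultimately show ?thesis unfolding cut_def by linarith
qed

text \<open>Only t > N, with N = n + 1, costs anything, namely the factor t / N. Integrated with t =
  f this is at most the integral of f divided by N.\<close>

lemma le_cut:
  assumes t: "0 \<le> t"
  shows "t / cut n t \<le> 1 + t / real (Suc n)"
proof -
  define N where "N = real (Suc n)"
  have N: "0 < N" "1 / N \<le> N" using cut_bounds(1,2)[of n t] unfolding N_def by (simp, linarith)
  have c: "0 < cut n t" by (rule cut_bounds)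
  show ?thesis unfolding N_def[symmetric]
  proof (cases "t \<le> N")
    case True
    then have "t \<le> cut n t" using N unfolding cut_def N_def[symmetric] by linarith
    then have "t / cut n t \<le> 1" using c by simp
    moreover have "0 \<le> t / N" using t N by simp
    ultimately show "t / cut n t \<le> 1 + t / N" by linarith
  next
    case False
    then have "cut n t = N" using N unfolding cut_def N_def[symmetric] by linarith
    then show "t / cut n t \<le> 1 + t / N" by simp
  qed
qed

lemma integrable_ac_density:
  assumes fin: "finite_measure M" and sets: "sets M = sets circle_lebesgue" and f: "is_ac_density circle_lebesgue M f"
  shows "integrable circle_lebesgue f"
proof -
  interpret finite_measure M by fact
  obtain A where A [measurable]: "A \<in> sets circle_lebesgue" and aeA: "AE z in circle_lebesgue. z \<in> A"
    and nn': "\<forall>g\<in>borel_measurable circle_lebesgue.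
      (\<integral>\<^sup>+x. g x * indicator A x \<partial>M) = (\<integral>\<^sup>+x. g x * ennreal (f x) \<partial>circle_lebesgue)"
    by (rule ac_density_nn_integral[OF sets f])
  note nn = bspec[OF nn']
  have "(\<integral>\<^sup>+x. ennreal (f x) \<partial>circle_lebesgue) = emeasure M A"
    using nn[of "\<lambda>_. 1"] A sets by simp
  then show ?thesis using f
    by (intro integrableI_nonneg) (auto simp: is_ac_density_def less_top[symmetric])
qed

text \<open>Dropping the singular part can only decrease the integral of a nonnegative function;
  this is the direction that the lower Szego bound needs.\<close>

lemma integral_ac_density_le:
  assumes fin: "finite_measure M" and sets: "sets M = sets circle_lebesgue" and f: "is_ac_density circle_lebesgue M f"
    and g: "g \<in> borel_measurable circle_lebesgue" "\<And>z. 0 \<le> g z" and b: "\<And>z. z \<in> circle \<Longrightarrow> g z \<le> B"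
  shows "integrable circle_lebesgue (\<lambda>z. g z * f z)" "(\<integral>z. g z * f z \<partial>circle_lebesgue) \<le> (\<integral>z. g z \<partial>M)"
proof -
  interpret finite_measure M by fact
  have f0: "\<And>z. z \<in> circle \<Longrightarrow> 0 \<le> f z" and [measurable]: "f \<in> borel_measurable circle_lebesgue"
    using f by (auto simp: is_ac_density_def)
  note [measurable] = g(1)
  obtain A where A [measurable]: "A \<in> sets circle_lebesgue" and aeA: "AE z in circle_lebesgue. z \<in> A"
    and nn': "\<forall>g\<in>borel_measurable circle_lebesgue.
      (\<integral>\<^sup>+x. g x * indicator A x \<partial>M) = (\<integral>\<^sup>+x. g x * ennreal (f x) \<partial>circle_lebesgue)"
    by (rule ac_density_nn_integral[OF sets f])
  note nn = bspec[OF nn']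
  have gM: "integrable M g"
    by (rule integrable_circle[OF fin sets]) (use g b in \<open>auto simp: measurable_cong_sets[OF sets refl]\<close>)
  have "(\<integral>\<^sup>+z. ennreal (g z * f z) \<partial>circle_lebesgue) = (\<integral>\<^sup>+z. ennreal (g z) * indicator A z \<partial>M)"
    by (subst nn) (auto intro!: nn_integral_cong simp: ennreal_mult' g(2))
  also have "\<dots> \<le> (\<integral>\<^sup>+z. ennreal (g z) \<partial>M)"
    by (intro nn_integral_mono) (auto simp: indicator_def)
  also have "\<dots> = ennreal (\<integral>z. g z \<partial>M)" by (rule nn_integral_eq_integral[OF gM]) (use g in auto)
  finally have le: "(\<integral>\<^sup>+z. ennreal (g z * f z) \<partial>circle_lebesgue) \<le> ennreal (\<integral>z. g z \<partial>M)" .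
  show int: "integrable circle_lebesgue (\<lambda>z. g z * f z)"
    by (rule integrableI_nonneg) (use g f0 le in \<open>auto intro: le_less_trans\<close>)
  have "ennreal (\<integral>z. g z * f z \<partial>circle_lebesgue) \<le> ennreal (\<integral>z. g z \<partial>M)"
    using le by (subst nn_integral_eq_integral[symmetric, OF int]) (use g f0 in auto)
  then show "(\<integral>z. g z * f z \<partial>circle_lebesgue) \<le> (\<integral>z. g z \<partial>M)"
    using g by (subst (asm) ennreal_le_iff) auto
qed

lemma szego_cut_upper:
  assumes fin: "finite_measure M" and sets: "sets M = sets circle_lebesgue" and f: "is_ac_density circle_lebesgue M f"
    and S: "\<And>p. poly p 0 = 1 \<Longrightarrow> S \<le> (\<integral>z. (cmod (poly p z))\<^sup>2 \<partial>M)"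
  shows "S \<le> exp (\<integral>z. ln (cut n (f z)) \<partial>circle_lebesgue) * (1 + (\<integral>z. f z \<partial>circle_lebesgue) / real (Suc n))"
proof -
  interpret L: prob_space circle_lebesgue by (rule prob_space_circle_lebesgue)
  interpret finite_measure M by fact
  let ?N = "real (Suc n)"
  have f0: "\<And>z. z \<in> circle \<Longrightarrow> 0 \<le> f z" and [measurable]: "f \<in> borel_measurable circle_lebesgue"
    using f by (auto simp: is_ac_density_def)
  have fi: "integrable circle_lebesgue f" by (rule integrable_ac_density[OF fin sets f])
  obtain A where A [measurable]: "A \<in> sets circle_lebesgue" and aeA: "AE z in circle_lebesgue. z \<in> A"
    and nn': "\<forall>g\<in>borel_measurable circle_lebesgue.
      (\<integral>\<^sup>+x. g x * indicator A x \<partial>M) = (\<integral>\<^sup>+x. g x * ennreal (f x) \<partial>circle_lebesgue)"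
    by (rule ac_density_nn_integral[OF sets f])
  note nn = bspec[OF nn']
  define \<phi> where "\<phi> z = ln (cut n (f z))" for z
  have [measurable]: "\<phi> \<in> borel_measurable circle_lebesgue" unfolding \<phi>_def cut_def by measurable
  have \<phi>b: "\<bar>\<phi> z\<bar> \<le> ln ?N" for z unfolding \<phi>_def by (rule abs_ln_cut_le)
  define h where "h k z = (if z \<in> A then \<phi> z else real k)" for k :: nat and z
  have hm [measurable]: "h k \<in> borel_measurable circle_lebesgue" for k unfolding h_def by measurable
  have le: "S \<le> exp (\<integral>z. \<phi> z \<partial>circle_lebesgue) * (\<integral>z. exp (- h k z) \<partial>M)" for k
  proof -
    have "S \<le> exp (\<integral>z. h k z \<partial>circle_lebesgue) * (\<integral>z. exp (- h k z) \<partial>M)"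
    proof (rule szego_upper[OF fin sets S hm])
      show "\<bar>h k z\<bar> \<le> max (ln ?N) (real k)" for z using \<phi>b[of z] by (auto simp: h_def)
    qed
    moreover have "(\<integral>z. h k z \<partial>circle_lebesgue) = (\<integral>z. \<phi> z \<partial>circle_lebesgue)"
      by (rule integral_cong_AE) (auto intro: AE_mp[OF aeA] simp: h_def)
    ultimately show ?thesis by simp
  qed
  \<comment> \<open>On A the integrand does not depend on k; off A it is exp (-k), so the mass of
    the singular part disappears in the limit. The Lebesgue integral of \<open>h k\<close> does not
    notice, since A has full Lebesgue measure.\<close>
  have lim: "(\<lambda>k. \<integral>z. exp (- h k z) \<partial>M) \<longlonglongrightarrow> (\<integral>z. indicator A z * exp (- \<phi> z) \<partial>M)"
  proof (rule integral_bounded_limit[OF fin sets])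
    show "(\<lambda>z. exp (- h k z)) \<in> borel_measurable M" for k by (simp add: measurable_cong_sets[OF sets refl])
    show "(\<lambda>z. indicator A z * exp (- \<phi> z)) \<in> borel_measurable M" by (simp add: measurable_cong_sets[OF sets refl])
    show "AE z in M. (\<lambda>k. exp (- h k z)) \<longlonglongrightarrow> indicator A z * exp (- \<phi> z)"
    proof (rule AE_I2)
      fix z
      have "(\<lambda>k. exp (- real k)) \<longlonglongrightarrow> 0"
        by (rule filterlim_compose[OF exp_at_bot filterlim_compose[OF filterlim_uminus_at_bot_at_top filterlim_real_sequentially]])
      then show "(\<lambda>k. exp (- h k z)) \<longlonglongrightarrow> indicator A z * exp (- \<phi> z)"
        by (cases "z \<in> A") (auto simp: h_def)
    qed
    show "\<bar>exp (- h k z)\<bar> \<le> exp (ln ?N)" for k z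
    proof -
      have "0 \<le> ln ?N" by simp
      then have "- h k z \<le> ln ?N" using \<phi>b[of z] by (auto simp: h_def)
      then show ?thesis by (simp del: exp_ln of_nat_Suc)
    qed
  qed
  have 1: "S \<le> exp (\<integral>z. \<phi> z \<partial>circle_lebesgue) * (\<integral>z. indicator A z * exp (- \<phi> z) \<partial>M)"
    by (rule LIMSEQ_le_const[OF tendsto_mult[OF tendsto_const lim]]) (use le in blast)
  have 2: "(\<integral>z. indicator A z * exp (- \<phi> z) \<partial>M) \<le> 1 + (\<integral>z. f z \<partial>circle_lebesgue) / ?N"
  proof -
    have "(\<integral>\<^sup>+z. ennreal (indicator A z * exp (- \<phi> z)) \<partial>M) = (\<integral>\<^sup>+z. ennreal (exp (- \<phi> z)) * indicator A z \<partial>M)"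
      by (intro nn_integral_cong) (auto simp: indicator_def)
    also have "\<dots> = (\<integral>\<^sup>+z. ennreal (exp (- \<phi> z)) * ennreal (f z) \<partial>circle_lebesgue)" by (rule nn) measurable
    also have "\<dots> \<le> (\<integral>\<^sup>+z. ennreal (1 + f z / ?N) \<partial>circle_lebesgue)"
    proof (rule nn_integral_mono)
      fix z assume "z \<in> space circle_lebesgue"
      then have z: "0 \<le> f z" using f0 by simp
      have "exp (- \<phi> z) * f z = f z / cut n (f z)"
        using cut_bounds(3)[of n "f z"] by (simp add: \<phi>_def exp_minus field_simps)
      also have "\<dots> \<le> 1 + f z / ?N" by (rule le_cut[OF z])
      finally show "ennreal (exp (- \<phi> z)) * ennreal (f z) \<le> ennreal (1 + f z / ?N)"
        by (subst ennreal_mult[symmetric]) (use z in \<open>auto intro!: ennreal_leI simp del: ennreal_plus\<close>)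
    qed
    also have "\<dots> = ennreal (\<integral>z. 1 + f z / ?N \<partial>circle_lebesgue)"
      by (rule nn_integral_eq_integral) (use fi f0 in \<open>auto intro!: add_nonneg_nonneg\<close>)
    also have "(\<integral>z. 1 + f z / ?N \<partial>circle_lebesgue) = 1 + (\<integral>z. f z \<partial>circle_lebesgue) / ?N"
      using fi by (simp add: L.prob_space[unfolded space_circle_lebesgue] del: of_nat_Suc)
    finally have le: "(\<integral>\<^sup>+z. ennreal (indicator A z * exp (- \<phi> z)) \<partial>M) \<le> ennreal (1 + (\<integral>z. f z \<partial>circle_lebesgue) / ?N)" .
    have pos: "0 \<le> 1 + (\<integral>z. f z \<partial>circle_lebesgue) / ?N"
      using f0 by (intro add_nonneg_nonneg divide_nonneg_nonneg integral_nonneg_AE AE_I2) auto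
    have "integrable M (\<lambda>z. indicator A z * exp (- \<phi> z))"
    proof (rule integrable_circle[OF fin sets])
      show "(\<lambda>z. indicator A z * exp (- \<phi> z)) \<in> borel_measurable M" by (simp add: measurable_cong_sets[OF sets refl])
      show "norm (indicator A z * exp (- \<phi> z)) \<le> exp (ln ?N)" for z
        using \<phi>b[of z] by (auto simp: indicator_def abs_le_iff simp del: exp_ln of_nat_Suc)
    qed
    then have "ennreal (\<integral>z. indicator A z * exp (- \<phi> z) \<partial>M) \<le> ennreal (1 + (\<integral>z. f z \<partial>circle_lebesgue) / ?N)"
      using le by (subst nn_integral_eq_integral[symmetric]) auto
    then show ?thesis using pos by (subst (asm) ennreal_le_iff) auto
  qed
  show ?thesis
    using order_trans[OF 1 mult_left_mono[OF 2 exp_ge_zero]] unfolding \<phi>_def .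
qed

text \<open>The truncation raises f by at most 1 / (n + 1). This is paid by the Lebesgue norm of p,
  which is a constant when p is fixed and n grows.\<close>

lemma szego_cut_lower:
  assumes fin: "finite_measure M" and sets: "sets M = sets circle_lebesgue" and f: "is_ac_density circle_lebesgue M f"
    and p: "poly p 0 = 1"
  shows "exp (\<integral>z. ln (cut n (f z)) \<partial>circle_lebesgue) \<le>
    (\<integral>z. (cmod (poly p z))\<^sup>2 \<partial>M) + (\<integral>z. (cmod (poly p z))\<^sup>2 \<partial>circle_lebesgue) / real (Suc n)"
proof -
  interpret L: prob_space circle_lebesgue by (rule prob_space_circle_lebesgue)
  let ?N = "real (Suc n)" and ?P = "\<lambda>z. (cmod (poly p z))\<^sup>2"
  have f0: "\<And>z. z \<in> circle \<Longrightarrow> 0 \<le> f z" and [measurable]: "f \<in> borel_measurable circle_lebesgue"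
    using f by (auto simp: is_ac_density_def)
  obtain B where B: "\<And>z. z \<in> circle \<Longrightarrow> cmod (poly p z) \<le> B" using poly_bounded_circle[of p] by blast
  have Pm [measurable]: "?P \<in> borel_measurable circle_lebesgue"
    by (intro borel_measurable_circle refl continuous_intros)
  have Pi: "integrable circle_lebesgue ?P"
    by (intro integrable_circle_continuous L.finite_measure_axioms refl continuous_intros)
  have PB: "?P z \<le> B\<^sup>2" if "z \<in> circle" for z using B[OF that] by (simp add: power_mono)
  note ac = integral_ac_density_le[OF fin sets f Pm _ PB, simplified]
  have "exp (\<integral>z. ln (cut n (f z)) \<partial>circle_lebesgue) \<le> (\<integral>z. ?P z * exp (ln (cut n (f z))) \<partial>circle_lebesgue)"
    by (rule szego_lower[OF p _ abs_ln_cut_le]) (unfold cut_def, measurable)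
  also have "\<dots> = (\<integral>z. ?P z * cut n (f z) \<partial>circle_lebesgue)" using cut_bounds(3)[of n] by simp
  also have "\<dots> \<le> (\<integral>z. ?P z * f z + ?P z / ?N \<partial>circle_lebesgue)"
  proof (rule integral_mono)
    show "integrable circle_lebesgue (\<lambda>z. ?P z * cut n (f z))"
    proof (rule integrable_circle[OF L.finite_measure_axioms refl])
      show "(\<lambda>z. ?P z * cut n (f z)) \<in> borel_measurable circle_lebesgue" unfolding cut_def by measurable
      show "norm (?P z * cut n (f z)) \<le> B\<^sup>2 * ?N" if "z \<in> circle" for z
        using PB[OF that] cut_bounds[of n "f z"] by (auto simp: abs_mult simp del: of_nat_Suc intro!: mult_mono)
    qed
    show "integrable circle_lebesgue (\<lambda>z. ?P z * f z + ?P z / ?N)" using ac(1) Pi by auto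
    fix z assume "z \<in> space circle_lebesgue"
    then have "cut n (f z) \<le> f z + 1 / ?N" using f0 by (intro cut_le) simp
    then have "?P z * cut n (f z) \<le> ?P z * (f z + 1 / ?N)" by (rule mult_left_mono) simp
    then show "?P z * cut n (f z) \<le> ?P z * f z + ?P z / ?N" by (simp add: distrib_left del: of_nat_Suc)
  qed
  also have "\<dots> = (\<integral>z. ?P z * f z \<partial>circle_lebesgue) + (\<integral>z. ?P z \<partial>circle_lebesgue) / ?N"
    using ac(1) Pi by simp
  also have "\<dots> \<le> (\<integral>z. ?P z \<partial>M) + (\<integral>z. ?P z \<partial>circle_lebesgue) / ?N" using ac(2) by simp
  finally show ?thesis .
qed

lemma szego_cut_limit:
  assumes fin: "finite_measure M" and sets: "sets M = sets circle_lebesgue" and f: "is_ac_density circle_lebesgue M f"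
    and S: "\<And>p. poly p 0 = 1 \<Longrightarrow> S \<le> (\<integral>z. (cmod (poly p z))\<^sup>2 \<partial>M)"
    and inf: "\<And>e. 0 < e \<Longrightarrow> \<exists>p. poly p 0 = 1 \<and> (\<integral>z. (cmod (poly p z))\<^sup>2 \<partial>M) < S + e"
  shows "(\<lambda>n. exp (\<integral>z. ln (cut n (f z)) \<partial>circle_lebesgue)) \<longlonglongrightarrow> S"
proof (rule order_tendstoI)
  let ?J = "\<lambda>n. exp (\<integral>z. ln (cut n (f z)) \<partial>circle_lebesgue)"
  have f0: "\<And>z. z \<in> circle \<Longrightarrow> 0 \<le> f z" using f by (auto simp: is_ac_density_def)
  fix a assume "a < S"
  define c where "c n = 1 + (\<integral>z. f z \<partial>circle_lebesgue) / real (Suc n)" for n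
  have "c \<longlonglongrightarrow> 1 + 0"
    unfolding c_def[abs_def] by (intro tendsto_intros LIMSEQ_Suc[OF lim_const_over_n])
  then have "(\<lambda>n. S / c n) \<longlonglongrightarrow> S / (1 + 0)" by (intro tendsto_divide tendsto_const) auto
  then have "\<forall>\<^sub>F n in sequentially. a < S / c n" using \<open>a < S\<close> by (intro order_tendstoD(1)) auto
  then show "\<forall>\<^sub>F n in sequentially. a < ?J n"
  proof eventually_elim
    case (elim n)
    have c: "0 < c n" unfolding c_def using f0
      by (intro add_pos_nonneg divide_nonneg_nonneg integral_nonneg_AE AE_I2) auto
    have "S \<le> ?J n * c n" unfolding c_def by (rule szego_cut_upper[OF fin sets f S])
    then have "S / c n \<le> ?J n" using c by (simp add: divide_le_eq)
    with elim show ?case by simp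
  qed
next
  let ?J = "\<lambda>n. exp (\<integral>z. ln (cut n (f z)) \<partial>circle_lebesgue)"
  fix a assume "S < a"
  then obtain p where p: "poly p 0 = 1" "(\<integral>z. (cmod (poly p z))\<^sup>2 \<partial>M) < a" using inf[of "a - S"] by auto
  have "(\<lambda>n. (\<integral>z. (cmod (poly p z))\<^sup>2 \<partial>M) + (\<integral>z. (cmod (poly p z))\<^sup>2 \<partial>circle_lebesgue) / real (Suc n)) \<longlonglongrightarrow>
    (\<integral>z. (cmod (poly p z))\<^sup>2 \<partial>M) + 0"
    by (intro tendsto_intros LIMSEQ_Suc[OF lim_const_over_n])
  then have "\<forall>\<^sub>F n in sequentially. (\<integral>z. (cmod (poly p z))\<^sup>2 \<partial>M) +
      (\<integral>z. (cmod (poly p z))\<^sup>2 \<partial>circle_lebesgue) / real (Suc n) < a"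
    using p by (intro order_tendstoD(2)) auto
  then show "\<forall>\<^sub>F n in sequentially. ?J n < a"
    by eventually_elim (use szego_cut_lower[OF fin sets f p(1)] le_less_trans in blast)
qed

lemma ln_tendsto_ext_ln:
  assumes J: "(\<lambda>n. exp (a n)) \<longlonglongrightarrow> (S::real)"
  shows "(\<lambda>n. ereal (a n)) \<longlonglongrightarrow> ext_ln S"
proof (cases "S = 0")
  case True
  have "filterlim (\<lambda>n. ln (exp (a n))) at_bot sequentially"
    by (rule filterlim_compose[OF ln_at_0]) (use J True in \<open>auto simp: filterlim_at\<close>)
  then have "(\<lambda>n. ereal (a n)) \<longlonglongrightarrow> - \<infinity>" by (simp add: tendsto_MInfty filterlim_at_bot_dense)
  then show ?thesis using True by (simp add: ext_ln_def)
next
  case False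
  have "(\<lambda>n. ln (exp (a n))) \<longlonglongrightarrow> ln S" by (rule tendsto_ln[OF J False])
  then show ?thesis using False by (simp add: ext_ln_def)
qed

lemma ennreal_ln_cut_tendsto:
  assumes t: "0 \<le> t"
  shows "(\<lambda>n. ennreal (ln (cut n t))) \<longlonglongrightarrow> e2ennreal (ext_ln t)"
    and "(\<lambda>n. ennreal (- ln (cut n t))) \<longlonglongrightarrow> e2ennreal (- ext_ln t)"
proof -
  have "(\<lambda>n. cut n t) \<longlonglongrightarrow> t"
  proof (rule tendsto_sandwich[OF _ _ tendsto_const])
    obtain m where "t \<le> real m" using real_arch_simple by blast
    then show "\<forall>\<^sub>F n in sequentially. t \<le> cut n t"
      by (auto simp: eventually_sequentially cut_def intro!: exI[of _ m])
    show "\<forall>\<^sub>F n in sequentially. cut n t \<le> t + 1 / real (Suc n)" using cut_le[OF t] by simp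
    have "(\<lambda>n. t + 1 / real (Suc n)) \<longlonglongrightarrow> t + 0"
      by (intro tendsto_intros LIMSEQ_Suc[OF lim_const_over_n])
    then show "(\<lambda>n. t + 1 / real (Suc n)) \<longlonglongrightarrow> t" by simp
  qed
  then have "(\<lambda>n. exp (ln (cut n t))) \<longlonglongrightarrow> t" using cut_bounds(3) by simp
  then have l: "(\<lambda>n. ereal (ln (cut n t))) \<longlonglongrightarrow> ext_ln t" by (rule ln_tendsto_ext_ln)
  from tendsto_e2ennrealI[OF l] show "(\<lambda>n. ennreal (ln (cut n t))) \<longlonglongrightarrow> e2ennreal (ext_ln t)"
    by (simp add: ennreal.abs_eq e2ennreal_ereal)
  have "(\<lambda>n. - ereal (ln (cut n t))) \<longlonglongrightarrow> - ext_ln t" using l by (intro tendsto_intros)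
  from tendsto_e2ennrealI[OF this] show "(\<lambda>n. ennreal (- ln (cut n t))) \<longlonglongrightarrow> e2ennreal (- ext_ln t)"
    by (simp add: e2ennreal_ereal)
qed

text \<open>As n grows, \<open>cut n t\<close> moves away from 1 on whichever side it lies, so the
  positive and the negative part of its logarithm both increase and monotone convergence applies to
  each.\<close>

lemma ln_cut_mono:
  assumes "m \<le> n"
  shows "ennreal (ln (cut m t)) \<le> ennreal (ln (cut n t))" "ennreal (- ln (cut m t)) \<le> ennreal (- ln (cut n t))"
proof -
  have mn: "1 / real (Suc n) \<le> 1 / real (Suc m)" "real (Suc m) \<le> real (Suc n)"
    using assms by (auto simp: field_simps)
  have m1: "1 / real (Suc m) \<le> 1" "1 \<le> real (Suc m)" by (auto simp: field_simps)
  show "ennreal (ln (cut m t)) \<le> ennreal (ln (cut n t))"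
  proof (cases "cut m t \<le> 1")
    case True
    then have "ln (cut m t) \<le> 0" using cut_bounds(3)[of m t] by simp
    then show ?thesis by (simp add: ennreal_neg)
  next
    case False
    then have "cut m t \<le> cut n t" using mn m1 unfolding cut_def by linarith
    then show ?thesis using cut_bounds(3)[of m t] cut_bounds(3)[of n t] by (intro ennreal_leI) simp
  qed
  show "ennreal (- ln (cut m t)) \<le> ennreal (- ln (cut n t))"
  proof (cases "1 \<le> cut m t")
    case True
    then have "- ln (cut m t) \<le> 0" by simp
    then show ?thesis by (simp add: ennreal_neg)
  next
    case False
    then have "cut n t \<le> cut m t" using mn m1 unfolding cut_def by linarith
    then show ?thesis using cut_bounds(3)[of m t] cut_bounds(3)[of n t] by (intro ennreal_leI) simp
  qed
qed

theorem szego: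
  assumes fin: "finite_measure M" and sets: "sets M = sets circle_lebesgue" and f: "is_ac_density circle_lebesgue M f"
    and S: "\<And>p. poly p 0 = 1 \<Longrightarrow> S \<le> (\<integral>z. (cmod (poly p z))\<^sup>2 \<partial>M)"
    and inf: "\<And>e. 0 < e \<Longrightarrow> \<exists>p. poly p 0 = 1 \<and> (\<integral>z. (cmod (poly p z))\<^sup>2 \<partial>M) < S + e"
  shows "ext_integral circle_lebesgue (\<lambda>z. ext_ln (f z)) = ext_ln S"
proof -
  interpret L: prob_space circle_lebesgue by (rule prob_space_circle_lebesgue)
  \<comment> \<open>\<open>f\<close> is nonnegative only on the circle, whereas the monotone limits
    below are taken pointwise at every z.\<close>
  define g where "g z = \<bar>f z\<bar>" for z
  have f0: "\<And>z. z \<in> circle \<Longrightarrow> 0 \<le> f z" and [measurable]: "f \<in> borel_measurable circle_lebesgue"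
    using f by (auto simp: is_ac_density_def)
  have gf: "g z = f z" if "z \<in> space circle_lebesgue" for z using f0 that by (simp add: g_def)
  have [measurable]: "g \<in> borel_measurable circle_lebesgue" unfolding g_def by measurable
  have g0: "0 \<le> g z" for z by (simp add: g_def)
  have fi: "integrable circle_lebesgue f" by (rule integrable_ac_density[OF fin sets f])
  let ?\<phi> = "\<lambda>n z. ln (cut n (g z))"
  have \<phi>m [measurable]: "?\<phi> n \<in> borel_measurable circle_lebesgue" for n unfolding cut_def by measurable
  have \<phi>i: "integrable circle_lebesgue (?\<phi> n)" for n
    by (rule integrable_circle[OF L.finite_measure_axioms refl \<phi>m, where B = "ln (real (Suc n))"])
      (use abs_ln_cut_le[of n] in auto)
  have cong: "(\<integral>z. ln (cut n (f z)) \<partial>circle_lebesgue) = (\<integral>z. ?\<phi> n z \<partial>circle_lebesgue)" for n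
    using gf by (intro Bochner_Integration.integral_cong) auto
  let ?A = "\<integral>\<^sup>+z. e2ennreal (ext_ln (g z)) \<partial>circle_lebesgue" and ?B = "\<integral>\<^sup>+z. e2ennreal (- ext_ln (g z)) \<partial>circle_lebesgue"
  have lA: "(\<lambda>n. \<integral>\<^sup>+z. ennreal (?\<phi> n z) \<partial>circle_lebesgue) \<longlonglongrightarrow> ?A"
    by (rule nn_integral_LIMSEQ)
      (auto simp: incseq_def le_fun_def g0 intro!: ln_cut_mono ennreal_ln_cut_tendsto)
  have lB: "(\<lambda>n. \<integral>\<^sup>+z. ennreal (- ?\<phi> n z) \<partial>circle_lebesgue) \<longlonglongrightarrow> ?B"
    by (rule nn_integral_LIMSEQ)
      (auto simp: incseq_def le_fun_def g0 intro!: ln_cut_mono ennreal_ln_cut_tendsto)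
  \<comment> \<open>Since log t \<le> t, the positive part has finite integral. The subtraction in
    \<open>ereal\<close> is then continuous at the limit even when the negative part has infinite
    integral.\<close>
  have Afin: "?A \<noteq> \<infinity>"
  proof -
    have "?A \<le> (\<integral>\<^sup>+z. ennreal (f z) \<partial>circle_lebesgue)"
    proof (rule nn_integral_mono)
      fix z assume z: "z \<in> space circle_lebesgue"
      show "e2ennreal (ext_ln (g z)) \<le> ennreal (f z)"
      proof (cases "f z = 0")
        case True then show ?thesis using gf[OF z] by (simp add: ext_ln_def e2ennreal_neg)
      next
        case False
        then have p: "0 < f z" using f0[of z] z by simp
        then have "ln (f z) \<le> f z" using ln_le_minus_one[OF p] by simp
        then show ?thesis using False gf[OF z] by (simp add: ext_ln_def e2ennreal_ereal ennreal_leI)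
      qed
    qed
    also have "\<dots> < \<infinity>" using fi f0 by (subst nn_integral_eq_integral) auto
    finally show ?thesis by simp
  qed
  have eq: "ereal (\<integral>z. ?\<phi> n z \<partial>circle_lebesgue) =
      enn2ereal (\<integral>\<^sup>+z. ennreal (?\<phi> n z) \<partial>circle_lebesgue) - enn2ereal (\<integral>\<^sup>+z. ennreal (- ?\<phi> n z) \<partial>circle_lebesgue)" for n
  proof -
    have fa: "(\<integral>\<^sup>+z. ennreal (?\<phi> n z) \<partial>circle_lebesgue) < \<infinity>" "(\<integral>\<^sup>+z. ennreal (- ?\<phi> n z) \<partial>circle_lebesgue) < \<infinity>"
      using \<phi>i[of n] by (auto simp: real_integrable_def less_top)
    obtain u v where u: "(\<integral>\<^sup>+z. ennreal (?\<phi> n z) \<partial>circle_lebesgue) = ennreal u" "0 \<le> u"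
      and v: "(\<integral>\<^sup>+z. ennreal (- ?\<phi> n z) \<partial>circle_lebesgue) = ennreal v" "0 \<le> v"
      using fa by (cases "\<integral>\<^sup>+z. ennreal (?\<phi> n z) \<partial>circle_lebesgue"; cases "\<integral>\<^sup>+z. ennreal (- ?\<phi> n z) \<partial>circle_lebesgue") auto
    show ?thesis unfolding real_lebesgue_integral_def[OF \<phi>i[of n]] u v using u(2) v(2) by simp
  qed
  have "(\<lambda>n. enn2ereal (\<integral>\<^sup>+z. ennreal (?\<phi> n z) \<partial>circle_lebesgue) - enn2ereal (\<integral>\<^sup>+z. ennreal (- ?\<phi> n z) \<partial>circle_lebesgue))
    \<longlonglongrightarrow> enn2ereal ?A - enn2ereal ?B"
    by (rule tendsto_diff_ereal_general[OF tendsto_enn2erealI[OF lA] tendsto_enn2erealI[OF lB]])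
      (use Afin enn2ereal_nonneg[of ?B] in \<open>auto simp: enn2ereal_eq_top_iff top_ereal_def\<close>)
  then have l1: "(\<lambda>n. ereal (\<integral>z. ?\<phi> n z \<partial>circle_lebesgue)) \<longlonglongrightarrow> enn2ereal ?A - enn2ereal ?B"
    by (simp only: eq)
  have l2: "(\<lambda>n. ereal (\<integral>z. ?\<phi> n z \<partial>circle_lebesgue)) \<longlonglongrightarrow> ext_ln S"
    by (rule ln_tendsto_ext_ln) (use szego_cut_limit[OF fin sets f S inf] in \<open>simp add: cong\<close>)
  have "ext_integral circle_lebesgue (\<lambda>z. ext_ln (f z)) = enn2ereal ?A - enn2ereal ?B"
  proof -
    have "(\<integral>\<^sup>+z. e2ennreal (ext_ln (f z)) \<partial>circle_lebesgue) = ?A"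
      "(\<integral>\<^sup>+z. e2ennreal (- ext_ln (f z)) \<partial>circle_lebesgue) = ?B"
      by (intro nn_integral_cong, simp only: gf)+
    then show ?thesis by (simp only: ext_integral_def)
  qed
  also have "\<dots> = ext_ln S" by (rule LIMSEQ_unique[OF l1 l2])
  finally show ?thesis .
qed


section \<open>Prediction residuals of Gaussian sequences\<close>

lemma coord_spanI:
  assumes "finite K" "K \<subseteq> I" "Y = (\<lambda>x. \<Sum>k\<in>K. c k * coord k x)"
  shows "Y \<in> coord_span I"
  using assms unfolding coord_span_def by blast

lemma coord_span_zero: "(\<lambda>x. 0) \<in> coord_span I"
  by (rule coord_spanI[of "{}"]) auto

lemma coord_span_coord: "k \<in> I \<Longrightarrow> coord k \<in> coord_span I"
  by (rule coord_spanI[of "{k}" _ _ "\<lambda>_. 1"]) auto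

lemma coord_span_mono: "I \<subseteq> J \<Longrightarrow> coord_span I \<subseteq> coord_span J"
  unfolding coord_span_def by blast

lemma coord_span_scale: "Y \<in> coord_span I \<Longrightarrow> (\<lambda>x. a * Y x) \<in> coord_span I"
proof -
  assume "Y \<in> coord_span I"
  then obtain K c where K: "finite K" "K \<subseteq> I" and Y: "Y = (\<lambda>x. \<Sum>k\<in>K. c k * coord k x)"
    unfolding coord_span_def by blast
  show ?thesis
    by (rule coord_spanI[OF K, of _ "\<lambda>k. a * c k"]) (simp add: Y sum_distrib_left mult.assoc)
qed

lemma coord_span_add:
  assumes "Y \<in> coord_span I" "Z \<in> coord_span I"
  shows "(\<lambda>x. Y x + Z x) \<in> coord_span I"
proof -
  obtain K c where K: "finite K" "K \<subseteq> I" and Y: "Y = (\<lambda>x. \<Sum>k\<in>K. c k * coord k x)"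
    using assms(1) unfolding coord_span_def by blast
  obtain L d where L: "finite L" "L \<subseteq> I" and Z: "Z = (\<lambda>x. \<Sum>k\<in>L. d k * coord k x)"
    using assms(2) unfolding coord_span_def by blast
  show ?thesis
  proof (rule coord_spanI[of "K \<union> L" _ _ "\<lambda>k. (if k \<in> K then c k else 0) + (if k \<in> L then d k else 0)"])
    show "(\<lambda>x. Y x + Z x) = (\<lambda>x. \<Sum>k\<in>K \<union> L. ((if k \<in> K then c k else 0) + (if k \<in> L then d k else 0)) * coord k x)"
    proof
      fix x
      have "(\<Sum>k\<in>K. c k * coord k x) = (\<Sum>k\<in>K \<union> L. (if k \<in> K then c k else 0) * coord k x)"
        using K L by (intro sum.mono_neutral_cong_left) auto
      moreover have "(\<Sum>k\<in>L. d k * coord k x) = (\<Sum>k\<in>K \<union> L. (if k \<in> L then d k else 0) * coord k x)"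
        using K L by (intro sum.mono_neutral_cong_left) auto
      ultimately show "Y x + Z x = (\<Sum>k\<in>K \<union> L. ((if k \<in> K then c k else 0) + (if k \<in> L then d k else 0)) * coord k x)"
        by (simp add: Y Z distrib_right sum.distrib)
    qed
  qed (use K L in auto)
qed

lemma coord_span_diff:
  "Y \<in> coord_span I \<Longrightarrow> Z \<in> coord_span I \<Longrightarrow> (\<lambda>x. Y x - Z x) \<in> coord_span I"
  using coord_span_add[OF _ coord_span_scale[of Z I "-1"]] by simp

lemma coord_span_induct [consumes 1, case_names zero add]:
  assumes Y: "Y \<in> coord_span I" and zero: "P (\<lambda>x. 0)"
    and add: "\<And>a k Z. k \<in> I \<Longrightarrow> Z \<in> coord_span I \<Longrightarrow> P Z \<Longrightarrow> P (\<lambda>x. a * coord k x + Z x)"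
  shows "P Y"
proof -
  obtain K c where K: "finite K" "K \<subseteq> I" and Y': "Y = (\<lambda>x. \<Sum>k\<in>K. c k * coord k x)"
    using Y unfolding coord_span_def by blast
  have "P (\<lambda>x. \<Sum>k\<in>K. c k * coord k x)" using K
  proof (induction K rule: finite_induct)
    case empty then show ?case using zero by simp
  next
    case (insert k K)
    have "(\<lambda>x. \<Sum>k\<in>K. c k * coord k x) \<in> coord_span I"
      by (rule coord_spanI[of K _ _ c]) (use insert in auto)
    then have "P (\<lambda>x. c k * coord k x + (\<Sum>k\<in>K. c k * coord k x))"
      using insert by (intro add) auto
    then show ?case using insert by simp
  qed
  then show ?thesis by (simp add: Y')
qed

text \<open>Substitution of indices. Translations give the powers of the shift and of its inverse;
  reflections give time reversal, which compares forward with backward prediction.\<close>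

definition pull :: "(int \<Rightarrow> int) \<Rightarrow> (int \<Rightarrow> real) \<Rightarrow> (int \<Rightarrow> real)" where
  "pull \<phi> x = (\<lambda>k. x (\<phi> k))"

lemma coord_pull: "coord k (pull \<phi> x) = coord (\<phi> k) x"
  by (simp add: coord_def pull_def)

lemma coord_span_pull: "Y \<in> coord_span I \<Longrightarrow> (\<lambda>x. Y (pull \<phi> x)) \<in> coord_span (\<phi> ` I)"
proof (induction rule: coord_span_induct)
  case zero then show ?case by (rule coord_span_zero)
next
  case (add a k Z)
  show ?case unfolding coord_pull
    by (rule coord_span_add[OF coord_span_scale[OF coord_span_coord] add(3)]) (use add in auto)
qed

text \<open>Evaluation at \<open>unit_seq i\<close> reads off the coefficient of
  \<open>coord i\<close> in a linear combination, so coefficients need not be carried along as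
  data.\<close>

definition unit_seq :: "int \<Rightarrow> int \<Rightarrow> real" where
  "unit_seq i k = (if k = i then 1 else 0)"

lemma coord_unit_seq: "coord k (unit_seq i) = (if k = i then 1 else 0)"
  by (simp add: coord_def unit_seq_def)

lemma coord_span_unit_seq_notin: "Y \<in> coord_span I \<Longrightarrow> i \<notin> I \<Longrightarrow> Y (unit_seq i) = 0"
  by (induction rule: coord_span_induct) (auto simp: coord_unit_seq)

lemma coord_span_expand:
  assumes "Y \<in> coord_span I" "finite I"
  shows "Y x = (\<Sum>i\<in>I. Y (unit_seq i) * coord i x)"
  using assms(1)
proof (induction rule: coord_span_induct)
  case (add a k Z)
  have "(\<Sum>i\<in>I. (a * coord k (unit_seq i) + Z (unit_seq i)) * coord i x) =
    (\<Sum>i\<in>I. if k = i then a * coord i x else 0) + (\<Sum>i\<in>I. Z (unit_seq i) * coord i x)"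
    by (subst sum.distrib[symmetric]) (auto intro!: sum.cong simp: coord_unit_seq algebra_simps)
  then show ?case using add assms(2) by (simp add: sum.delta')
qed simp

section \<open>Second and fourth moments on the span of the coordinates\<close>

locale gaussian_seq =
  fixes \<mu> :: "(int \<Rightarrow> real) measure" and r :: "int \<Rightarrow> real"
  assumes r_sym: "\<And>n. r (- n) = r n" and r_posdef: "strictly_posdef r"
    and \<mu>_prob: "prob_space \<mu>" and \<mu>_sets: "sets \<mu> = sets seq_space"
    and \<mu>_gauss: "centered_gaussian \<mu>" and \<mu>_inv: "shift_invariant \<mu>" and \<mu>_cov: "has_covariance \<mu> r"
begin

sublocale prob_space \<mu> by (rule \<mu>_prob)

definition ip :: "((int \<Rightarrow> real) \<Rightarrow> real) \<Rightarrow> ((int \<Rightarrow> real) \<Rightarrow> real) \<Rightarrow> real" where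
  "ip Y Z = (\<integral>x. Y x * Z x \<partial>\<mu>)"

abbreviation "W \<equiv> coord_span UNIV"

lemma span_W: "Y \<in> coord_span I \<Longrightarrow> Y \<in> W"
  using coord_span_mono[of I UNIV] by blast

lemma measurable_coord [measurable]: "coord k \<in> borel_measurable \<mu>"
proof -
  have "coord k = (\<lambda>x. x k)" by (simp add: coord_def fun_eq_iff)
  then have "coord k \<in> borel_measurable seq_space" by (simp add: seq_space_def)
  then show ?thesis by (simp add: measurable_cong_sets[OF \<mu>_sets refl])
qed

lemma measurable_span: "Y \<in> coord_span I \<Longrightarrow> Y \<in> borel_measurable \<mu>"
  by (induction rule: coord_span_induct) auto

lemma integrable_coord_mult: "integrable \<mu> (\<lambda>x. coord i x * coord j x)"
  and ip_coord: "ip (coord i) (coord j) = r (i - j)"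
  using \<mu>_cov by (auto simp: has_covariance_def ip_def)

lemma integrable_mult:
  assumes "Y \<in> W" "Z \<in> W"
  shows "integrable \<mu> (\<lambda>x. Y x * Z x)"
  using assms(1)
proof (induction rule: coord_span_induct)
  case (add a k Y)
  have "integrable \<mu> (\<lambda>x. coord k x * Z x)"
    using assms(2)
  proof (induction rule: coord_span_induct)
    case (add b j Z)
    have "integrable \<mu> (\<lambda>x. b * (coord k x * coord j x) + coord k x * Z x)"
      using integrable_coord_mult add by auto
    then show ?case by (simp add: algebra_simps)
  qed simp
  then have "integrable \<mu> (\<lambda>x. a * (coord k x * Z x) + Y x * Z x)" using add by auto
  then show ?case by (simp add: algebra_simps)
qed simp

lemma ip_commute: "ip Y Z = ip Z Y"
  by (simp add: ip_def mult.commute)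

lemma ip_zero_left [simp]: "ip (\<lambda>x. 0) Z = 0" and ip_zero_right [simp]: "ip Z (\<lambda>x. 0) = 0"
  by (simp_all add: ip_def)

lemma ip_scale_left [simp]: "ip (\<lambda>x. a * Y x) Z = a * ip Y Z"
  by (simp add: ip_def mult.assoc)

lemma ip_scale_right [simp]: "ip Y (\<lambda>x. a * Z x) = a * ip Y Z"
  by (simp add: ip_commute[of Y])

lemma ip_add_left: "Y \<in> W \<Longrightarrow> Z \<in> W \<Longrightarrow> U \<in> W \<Longrightarrow> ip (\<lambda>x. Y x + Z x) U = ip Y U + ip Z U"
  by (simp add: ip_def distrib_right integrable_mult)

lemma ip_add_right: "Y \<in> W \<Longrightarrow> Z \<in> W \<Longrightarrow> U \<in> W \<Longrightarrow> ip U (\<lambda>x. Y x + Z x) = ip U Y + ip U Z"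
  by (simp add: ip_def distrib_left integrable_mult)

lemma ip_diff_left: "Y \<in> W \<Longrightarrow> Z \<in> W \<Longrightarrow> U \<in> W \<Longrightarrow> ip (\<lambda>x. Y x - Z x) U = ip Y U - ip Z U"
  by (simp add: ip_def left_diff_distrib integrable_mult)

lemma ip_diff_right: "Y \<in> W \<Longrightarrow> Z \<in> W \<Longrightarrow> U \<in> W \<Longrightarrow> ip U (\<lambda>x. Y x - Z x) = ip U Y - ip U Z"
  by (simp add: ip_def right_diff_distrib integrable_mult)

lemma ip_nonneg: "0 \<le> ip Y Y"
  by (simp add: ip_def)

lemma ip_pythagoras:
  assumes "Y \<in> W" "Z \<in> W" "ip Y Z = 0"
  shows "ip (\<lambda>x. Y x + Z x) (\<lambda>x. Y x + Z x) = ip Y Y + ip Z Z"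
  using assms coord_span_add[OF assms(1,2)] by (simp add: ip_add_left ip_add_right ip_commute[of Z Y])

lemma ip_sum_left:
  assumes "Z \<in> W"
  shows "ip (\<lambda>x. \<Sum>k\<in>K. c k * coord (g k) x) Z = (\<Sum>k\<in>K. c k * ip (coord (g k)) Z)"
proof -
  have "integrable \<mu> (\<lambda>x. c k * coord (g k) x * Z x)" for k
  proof -
    have "integrable \<mu> (\<lambda>x. c k * (coord (g k) x * Z x))"
      by (intro integrable_mult_right impI integrable_mult assms coord_span_coord) simp
    then show ?thesis by (simp add: mult.assoc)
  qed
  then show ?thesis
    by (simp add: ip_def sum_distrib_right Bochner_Integration.integral_sum mult.assoc)
qed

text \<open>Strict positive definiteness makes \<open>ip\<close> definite on functions, not merely
  on classes modulo null sets; pointwise uniqueness of residuals rests on this.\<close>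

lemma ip_eq_0_imp:
  assumes "Y \<in> W" "ip Y Y = 0"
  shows "Y = (\<lambda>x. 0)"
proof -
  obtain K c where K: "finite K" and Y: "Y = (\<lambda>x. \<Sum>k\<in>K. c k * coord k x)"
    using assms(1) unfolding coord_span_def by blast
  have "ip Y Y = (\<Sum>i\<in>K. \<Sum>j\<in>K. c i * c j * r (i - j))"
  proof -
    have "ip Y Y = (\<Sum>i\<in>K. c i * ip (coord i) Y)" by (subst (1) Y) (rule ip_sum_left[OF assms(1)])
    also have "\<dots> = (\<Sum>i\<in>K. c i * ip Y (coord i))" by (simp add: ip_commute)
    also have "\<dots> = (\<Sum>i\<in>K. c i * (\<Sum>j\<in>K. c j * r (j - i)))"
      unfolding Y by (subst ip_sum_left) (auto simp: ip_coord coord_span_coord)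
    also have "\<dots> = (\<Sum>i\<in>K. \<Sum>j\<in>K. c i * c j * r (i - j))"
    proof -
      have "r (j - i) = r (i - j)" for i j using r_sym[of "i - j"] by simp
      then show ?thesis by (simp add: sum_distrib_left mult.assoc)
    qed
    finally show ?thesis .
  qed
  moreover have "\<exists>k\<in>K. c k \<noteq> 0 \<Longrightarrow> 0 < (\<Sum>i\<in>K. \<Sum>j\<in>K. c i * c j * r (i - j))"
    using r_posdef[unfolded strictly_posdef_def, rule_format, OF K] .
  ultimately have "\<forall>k\<in>K. c k = 0" using assms(2) by fastforce
  then show ?thesis by (simp add: Y)
qed

lemma span_integrable_square: "Y \<in> W \<Longrightarrow> integrable \<mu> (\<lambda>x. (Y x)\<^sup>2)"
  using integrable_mult[of Y Y] by (simp add: power2_eq_square)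

lemma integral_square: "(\<integral>x. (Y x)\<^sup>2 \<partial>\<mu>) = ip Y Y"
  by (simp add: ip_def power2_eq_square)

lemma fourth_moment:
  assumes "Y \<in> W"
  shows "integrable \<mu> (\<lambda>x. (Y x)^4)" "(\<integral>x. (Y x)^4 \<partial>\<mu>) = 3 * (ip Y Y)\<^sup>2"
proof -
  have "centered_gaussian_rv \<mu> Y"
    using assms \<mu>_gauss unfolding centered_gaussian_def coord_span_def by auto
  then consider "AE x in \<mu>. Y x = 0" "Y \<in> borel_measurable \<mu>"
    | s where "s > 0" "distributed \<mu> lborel Y (\<lambda>t. ennreal (normal_density 0 s t))" "Y \<in> borel_measurable \<mu>"
    unfolding centered_gaussian_rv_def by blast
  then have "integrable \<mu> (\<lambda>x. (Y x)^4) \<and> (\<integral>x. (Y x)^4 \<partial>\<mu>) = 3 * (ip Y Y)\<^sup>2"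
  proof cases
    case 1
    note [measurable] = 1(2)
    have a: "AE x in \<mu>. (Y x)^4 = 0" using 1(1) by eventually_elim simp
    have b: "AE x in \<mu>. (Y x)\<^sup>2 = 0" using 1(1) by eventually_elim simp
    have "integrable \<mu> (\<lambda>x. (Y x)^4) \<longleftrightarrow> integrable \<mu> (\<lambda>x. 0::real)"
      by (rule integrable_cong_AE) (use a in auto)
    moreover have "(\<integral>x. (Y x)^4 \<partial>\<mu>) = (\<integral>x. 0 \<partial>\<mu>)" by (rule integral_cong_AE) (use a in auto)
    moreover have "(\<integral>x. (Y x)\<^sup>2 \<partial>\<mu>) = (\<integral>x. 0 \<partial>\<mu>)" by (rule integral_cong_AE) (use b in auto)
    ultimately show ?thesis by (simp add: integral_square[symmetric])
  next
    case (2 s)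
    have mom: "has_bochner_integral lborel (\<lambda>x. normal_density 0 s x * x ^ (2 * k)) (fact (2 * k) / ((2 / s\<^sup>2)^k * fact k))" for k
      using normal_moment_even[OF 2(1), of 0 k] by simp
    have "integrable lborel (\<lambda>x. normal_density 0 s x * x ^ 4)"
      using mom[of 2] by (simp add: has_bochner_integral_iff)
    then have "integrable \<mu> (\<lambda>x. (Y x)^4)"
      using distributed_integrable[OF 2(2), of "\<lambda>x. x^4"] by simp
    moreover have "(\<integral>x. (Y x)^4 \<partial>\<mu>) = 3 * s^4"
    proof -
      have "(\<integral>x. (Y x)^4 \<partial>\<mu>) = (\<integral>x. normal_density 0 s x * x^4 \<partial>lborel)"
        by (rule distributed_integral[OF 2(2), symmetric]) auto
      also have "\<dots> = fact 4 / ((2 / s\<^sup>2)^2 * fact 2)"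
        using has_bochner_integral_integral_eq[OF mom[of 2]] by simp
      also have "\<dots> = 3 * s^4" using 2(1) by (simp add: fact_numeral power_divide)
      finally show ?thesis .
    qed
    moreover have "ip Y Y = s\<^sup>2"
    proof -
      have "(\<integral>x. (Y x)\<^sup>2 \<partial>\<mu>) = (\<integral>x. normal_density 0 s x * x\<^sup>2 \<partial>lborel)"
        by (rule distributed_integral[OF 2(2), symmetric]) auto
      also have "\<dots> = fact 2 / ((2 / s\<^sup>2)^1 * fact 1)"
        using has_bochner_integral_integral_eq[OF mom[of 1]] by simp
      also have "\<dots> = s\<^sup>2" using 2(1) by (simp add: fact_numeral)
      finally show ?thesis by (simp add: integral_square)
    qed
    ultimately show ?thesis by simp
  qed
  then show "integrable \<mu> (\<lambda>x. (Y x)^4)" "(\<integral>x. (Y x)^4 \<partial>\<mu>) = 3 * (ip Y Y)\<^sup>2" by auto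
qed

text \<open>Polarization of the fourth moment replaces independence of orthogonal variables.\<close>

lemma orthogonal_squares:
  assumes Y: "Y \<in> W" and Z: "Z \<in> W" and o: "ip Y Z = 0"
  shows "integrable \<mu> (\<lambda>x. (Y x)\<^sup>2 * (Z x)\<^sup>2)" "(\<integral>x. (Y x)\<^sup>2 * (Z x)\<^sup>2 \<partial>\<mu>) = ip Y Y * ip Z Z"
proof -
  let ?P = "\<lambda>x. Y x + Z x" and ?M = "\<lambda>x. Y x - Z x"
  have PM: "?P \<in> W" "?M \<in> W" using Y Z by (auto intro: coord_span_add coord_span_diff)
  have eq: "(\<lambda>x. (Y x)\<^sup>2 * (Z x)\<^sup>2) = (\<lambda>x. ((?P x)^4 + (?M x)^4 - 2 * (Y x)^4 - 2 * (Z x)^4) / 12)"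
    by (rule ext) (simp add: power2_eq_square power4_eq_xxxx algebra_simps)
  note i = fourth_moment[OF Y] fourth_moment[OF Z] fourth_moment[OF PM(1)] fourth_moment[OF PM(2)]
  show "integrable \<mu> (\<lambda>x. (Y x)\<^sup>2 * (Z x)\<^sup>2)" unfolding eq using i by simp
  have P: "ip ?P ?P = ip Y Y + ip Z Z"
    using Y Z PM o by (simp add: ip_add_left ip_add_right ip_commute[of Z Y])
  have M: "ip ?M ?M = ip Y Y + ip Z Z"
    using Y Z PM o by (simp add: ip_diff_left ip_diff_right ip_commute[of Z Y])
  have "(\<integral>x. (Y x)\<^sup>2 * (Z x)\<^sup>2 \<partial>\<mu>) =
    ((\<integral>x. (?P x)^4 \<partial>\<mu>) + (\<integral>x. (?M x)^4 \<partial>\<mu>) - 2 * (\<integral>x. (Y x)^4 \<partial>\<mu>) - 2 * (\<integral>x. (Z x)^4 \<partial>\<mu>)) / 12"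
    unfolding eq using i by simp
  also have "\<dots> = ip Y Y * ip Z Z"
    unfolding i P M by (simp add: power2_eq_square algebra_simps)
  finally show "(\<integral>x. (Y x)\<^sup>2 * (Z x)\<^sup>2 \<partial>\<mu>) = ip Y Y * ip Z Z" .
qed

lemma slln_orthogonal:
  assumes e: "\<And>k. e k \<in> W" and o: "\<And>j k. j < k \<Longrightarrow> ip (e j) (e k) = 0"
    and v: "(\<lambda>k. ip (e k) (e k)) \<longlonglongrightarrow> c" and B: "\<And>k. ip (e k) (e k) \<le> B"
  shows "conv_to \<mu> (\<lambda>N x. (\<Sum>k<N. (e k x)\<^sup>2) / real N) (\<lambda>x. c)"
proof -
  let ?v = "\<lambda>k. ip (e k) (e k)"
  have [measurable]: "e k \<in> borel_measurable \<mu>" for k using measurable_span[OF e] .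
  have o': "ip (e j) (e k) = 0" if "j \<noteq> k" for j k
    using that o[of j k] o[of k j] by (cases "j < k") (auto simp: ip_commute)
  have e4: "(e k x)\<^sup>2 * (e k x)\<^sup>2 = (e k x)^4" for k x by (simp add: power2_eq_square power4_eq_xxxx)
  \<comment> \<open>The diagonal term 2 v^2 is 3 v^2 - v^2, the variance of the square of a centered
    Gaussian variable with variance v.\<close>
  have m22: "integrable \<mu> (\<lambda>x. (e j x)\<^sup>2 * (e k x)\<^sup>2) \<and>
    (\<integral>x. (e j x)\<^sup>2 * (e k x)\<^sup>2 \<partial>\<mu>) = ?v j * ?v k + (if j = k then 2 * (?v k)\<^sup>2 else 0)" for j k
  proof (cases "j = k")
    case True
    have "3 * (?v k)\<^sup>2 = ?v k * ?v k + 2 * (?v k)\<^sup>2" by (simp add: power2_eq_square)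
    then show ?thesis unfolding True e4 using fourth_moment[OF e, of k] by simp
  next
    case False
    then show ?thesis using orthogonal_squares[OF e e o'[OF False]] by simp
  qed
  have i22: "integrable \<mu> (\<lambda>x. (e j x)\<^sup>2 * (e k x)\<^sup>2)" for j k using m22[of j k] ..
  have E22: "(\<integral>x. (e j x)\<^sup>2 * (e k x)\<^sup>2 \<partial>\<mu>) = ?v j * ?v k + (if j = k then 2 * (?v k)\<^sup>2 else 0)" for j k
    using m22[of j k] ..
  have i2: "integrable \<mu> (\<lambda>x. (e k x)\<^sup>2)" for k by (rule span_integrable_square[OF e])
  have iC: "integrable \<mu> (\<lambda>x. ((e j x)\<^sup>2 - ?v j) * ((e k x)\<^sup>2 - ?v k))"
    and EC: "(\<integral>x. ((e j x)\<^sup>2 - ?v j) * ((e k x)\<^sup>2 - ?v k) \<partial>\<mu>) = (if j = k then 2 * (?v k)\<^sup>2 else 0)" for j k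
  proof -
    have eq: "(\<lambda>x. ((e j x)\<^sup>2 - ?v j) * ((e k x)\<^sup>2 - ?v k)) =
      (\<lambda>x. (e j x)\<^sup>2 * (e k x)\<^sup>2 - ?v j * (e k x)\<^sup>2 - ?v k * (e j x)\<^sup>2 + ?v j * ?v k)"
      by (rule ext) (simp add: algebra_simps)
    show "integrable \<mu> (\<lambda>x. ((e j x)\<^sup>2 - ?v j) * ((e k x)\<^sup>2 - ?v k))"
      unfolding eq using i22 i2 by simp
    show "(\<integral>x. ((e j x)\<^sup>2 - ?v j) * ((e k x)\<^sup>2 - ?v k) \<partial>\<mu>) = (if j = k then 2 * (?v k)\<^sup>2 else 0)"
      unfolding eq using i22 i2 by (simp add: E22 integral_square prob_space)
  qed
  have sq: "((\<Sum>k<N. (e k x)\<^sup>2) - (\<Sum>k<N. ?v k))\<^sup>2 = (\<Sum>j<N. \<Sum>k<N. ((e j x)\<^sup>2 - ?v j) * ((e k x)\<^sup>2 - ?v k))" for N x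
    by (simp add: sum_subtractf[symmetric] power2_eq_square[of "sum _ _"] sum_product)
  show ?thesis
  proof (rule slln_nonneg[where m = ?v and C = "2 * B\<^sup>2"])
    show "integrable \<mu> (\<lambda>x. ((\<Sum>k<N. (e k x)\<^sup>2) - (\<Sum>k<N. ?v k))\<^sup>2)" for N
      unfolding sq using iC by (intro Bochner_Integration.integrable_sum)
    show "(\<integral>x. ((\<Sum>k<N. (e k x)\<^sup>2) - (\<Sum>k<N. ?v k))\<^sup>2 \<partial>\<mu>) \<le> 2 * B\<^sup>2 * real N" for N
    proof -
      have "(\<integral>x. ((\<Sum>k<N. (e k x)\<^sup>2) - (\<Sum>k<N. ?v k))\<^sup>2 \<partial>\<mu>) = (\<Sum>j<N. \<Sum>k<N. if j = k then 2 * (?v k)\<^sup>2 else 0)"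
        unfolding sq using iC by (simp add: Bochner_Integration.integral_sum Bochner_Integration.integrable_sum EC)
      also have "\<dots> = (\<Sum>j<N. 2 * (?v j)\<^sup>2)" by (intro sum.cong) (auto simp: sum.delta)
      also have "\<dots> \<le> (\<Sum>j<N. 2 * B\<^sup>2)"
        by (intro sum_mono mult_left_mono power_mono B ip_nonneg) auto
      finally show ?thesis by (simp add: mult_ac)
    qed
    have "conv_to \<mu> (\<lambda>k x. ?v k) (\<lambda>x. c)" by (rule conv_to_const[OF \<mu>_prob v])
    from conv_to_mean[OF this] show "(\<lambda>N. (\<Sum>k<N. ?v k) / real N) \<longlonglongrightarrow> c"
      by (auto simp: conv_to_def)
  qed (use \<mu>_prob in auto)
qed

text \<open>\<open>R\<close> is the prediction error of \<open>coord m\<close> given the coordinates in \<open>K\<close>. By strict positive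
  definiteness it is unique as a function on sequences, not only almost everywhere.\<close>

definition is_res :: "int \<Rightarrow> int set \<Rightarrow> ((int \<Rightarrow> real) \<Rightarrow> real) \<Rightarrow> bool" where
  "is_res m K R \<longleftrightarrow> (\<lambda>x. coord m x - R x) \<in> coord_span K \<and> (\<forall>Y\<in>coord_span K. ip R Y = 0)"

lemma coord_W [simp]: "coord k \<in> W" by (rule coord_span_coord) simp

lemma is_res_span: "is_res m K R \<Longrightarrow> R \<in> coord_span (insert m K)"
proof -
  assume "is_res m K R"
  then have "(\<lambda>x. coord m x - R x) \<in> coord_span (insert m K)"
    using coord_span_mono[of K "insert m K"] by (auto simp: is_res_def)
  from coord_span_diff[OF coord_span_coord[of m "insert m K"] this] show ?thesis by simp
qed

lemma is_res_unique:
  assumes "is_res m K R" "is_res m K R'"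
  shows "R = R'"
proof -
  let ?D = "\<lambda>x. R x - R' x"
  have W: "R \<in> W" "R' \<in> W" using is_res_span assms span_W by blast+
  have "(\<lambda>x. (coord m x - R' x) - (coord m x - R x)) \<in> coord_span K"
    using assms coord_span_diff[of "\<lambda>x. coord m x - R' x" K "\<lambda>x. coord m x - R x"]
    by (simp add: is_res_def)
  then have D: "?D \<in> coord_span K" by simp
  have "ip ?D ?D = ip R ?D - ip R' ?D" using W by (intro ip_diff_left coord_span_diff)
  also have "\<dots> = 0" using assms D by (simp add: is_res_def)
  finally have "?D = (\<lambda>x. 0)" using ip_eq_0_imp span_W[OF D] by blast
  then show ?thesis by (simp add: fun_eq_iff)
qed

lemma orthogonal_spanI:
  assumes "R \<in> W" "\<And>j. j \<in> K \<Longrightarrow> ip R (coord j) = 0" "Y \<in> coord_span K"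
  shows "ip R Y = 0"
  using assms(3)
proof (induction rule: coord_span_induct)
  case (add a k Z)
  have "ip R (\<lambda>x. a * coord k x + Z x) = a * ip R (coord k) + ip R Z"
    by (subst ip_add_right) (use add assms span_W in \<open>auto intro: coord_span_scale\<close>)
  then show ?case using add assms by simp
qed simp

lemma is_res_nonzero:
  assumes "is_res m K R" "m \<notin> K"
  shows "0 < ip R R"
proof (rule ccontr)
  assume "\<not> 0 < ip R R"
  then have "ip R R = 0" using ip_nonneg[of R] by simp
  then have R: "R = (\<lambda>x. 0)" using ip_eq_0_imp is_res_span[OF assms(1)] span_W by blast
  then have "coord m \<in> coord_span K" using assms(1) by (simp add: is_res_def)
  from coord_span_unit_seq_notin[OF this assms(2)] show False by (simp add: coord_unit_seq)
qed

text \<open>Gram-Schmidt: the residual given \<open>insert k K\<close> is the residual given K minus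
  its component along the residual of \<open>coord k\<close>. The quantifier over m is inside
  because the induction step needs the hypothesis for m and for k.\<close>

lemma is_res_exists: "finite K \<Longrightarrow> \<forall>m. \<exists>R. is_res m K R"
proof (induction K rule: finite_induct)
  case empty
  show ?case
  proof
    fix m
  have "is_res m {} (coord m)"
    unfolding is_res_def
  proof (intro conjI ballI)
    show "(\<lambda>x. coord m x - coord m x) \<in> coord_span {}" using coord_span_zero by simp
    show "ip (coord m) Y = 0" if "Y \<in> coord_span {}" for Y
      by (rule orthogonal_spanI[OF coord_W _ that]) simp
  qed
    then show "\<exists>R. is_res m {} R" by blast
  qed
next
  case (insert k K)
  show ?case
  proof
    fix m
  obtain u where u: "is_res m K u" using insert.IH by blast
  obtain e where e: "is_res k K e" using insert.IH by blast
  have W: "u \<in> W" "e \<in> W" using is_res_span u e span_W by blast+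
  have pos: "0 < ip e e" using is_res_nonzero[OF e] insert by blast
  define c where "c = ip u e / ip e e"
  let ?R = "\<lambda>x. u x - c * e x"
  have RW: "?R \<in> W" using W by (intro coord_span_diff coord_span_scale)
  have sub: "coord_span K \<subseteq> coord_span (insert k K)" by (rule coord_span_mono) auto
  have RY: "ip ?R Y = ip u Y - c * ip e Y" if "Y \<in> W" for Y
    using W that by (subst ip_diff_left) (auto intro: coord_span_scale)
  have "is_res m (insert k K) ?R" unfolding is_res_def
  proof (intro conjI ballI)
    have "(\<lambda>x. (coord m x - u x) + c * e x) \<in> coord_span (insert k K)"
      using u sub is_res_span[OF e] by (intro coord_span_add coord_span_scale) (auto simp: is_res_def)
    then show "(\<lambda>x. coord m x - ?R x) \<in> coord_span (insert k K)" by (simp add: algebra_simps)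
    show "ip ?R Y = 0" if Y: "Y \<in> coord_span (insert k K)" for Y
    proof (rule orthogonal_spanI[OF RW _ Y])
      have K0: "ip ?R (coord j) = 0" if "j \<in> K" for j
        using u e coord_span_coord[OF that] RY[of "coord j"] by (simp add: is_res_def)
      have ck: "(\<lambda>x. coord k x - e x) \<in> coord_span K" using e by (simp add: is_res_def)
      have "ip ?R (\<lambda>x. coord k x - e x) = 0" by (rule orthogonal_spanI[OF RW K0 ck])
      then have "ip ?R (coord k) = ip ?R e" using W RW by (simp add: ip_diff_right)
      also have "\<dots> = 0" using RY[OF W(2)] pos by (simp add: c_def)
      finally show "ip ?R (coord j) = 0" if "j \<in> insert k K" for j using K0 that by auto
    qed
  qed
    then show "\<exists>R. is_res m (insert k K) R" by blast
  qed
qed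

definition res :: "int \<Rightarrow> int set \<Rightarrow> (int \<Rightarrow> real) \<Rightarrow> real" where
  "res m K = (SOME R. is_res m K R)"

lemma is_res_res: "finite K \<Longrightarrow> is_res m K (res m K)"
  unfolding res_def by (rule someI_ex[OF is_res_exists[THEN spec]])

lemma res_eqI: "is_res m K R \<Longrightarrow> finite K \<Longrightarrow> res m K = R"
  by (rule is_res_unique[OF is_res_res])

lemma res_span: "finite K \<Longrightarrow> res m K \<in> coord_span (insert m K)"
  by (rule is_res_span[OF is_res_res])

lemma res_W [simp]: "finite K \<Longrightarrow> res m K \<in> W"
  by (rule span_W[OF res_span])

lemma res_orthogonal: "finite K \<Longrightarrow> Y \<in> coord_span K \<Longrightarrow> ip (res m K) Y = 0"
  using is_res_res by (auto simp: is_res_def)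

lemma coord_minus_res: "finite K \<Longrightarrow> (\<lambda>x. coord m x - res m K x) \<in> coord_span K"
  using is_res_res by (auto simp: is_res_def)

lemma res_pos: "finite K \<Longrightarrow> m \<notin> K \<Longrightarrow> 0 < ip (res m K) (res m K)"
  by (rule is_res_nonzero[OF is_res_res])

lemma res_pythagoras:
  assumes "finite K" "Y \<in> coord_span K"
  shows "ip (\<lambda>x. coord m x - Y x) (\<lambda>x. coord m x - Y x) =
    ip (res m K) (res m K) + ip (\<lambda>x. coord m x - Y x - res m K x) (\<lambda>x. coord m x - Y x - res m K x)"
proof -
  let ?R = "res m K" and ?Z = "\<lambda>x. coord m x - Y x - res m K x"
  have "(\<lambda>x. (coord m x - ?R x) - Y x) \<in> coord_span K"
    by (rule coord_span_diff[OF coord_minus_res[OF assms(1)] assms(2)])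
  then have Z: "?Z \<in> coord_span K" by (simp add: algebra_simps)
  have W: "?R \<in> W" "?Z \<in> W" using assms span_W[OF Z] by auto
  have o: "ip ?R ?Z = 0" by (rule res_orthogonal[OF assms(1) Z])
  from ip_pythagoras[OF W o] show ?thesis by simp
qed

lemma res_minimal:
  assumes "finite K" "Y \<in> coord_span K"
  shows "ip (res m K) (res m K) \<le> ip (\<lambda>x. coord m x - Y x) (\<lambda>x. coord m x - Y x)"
  unfolding res_pythagoras[OF assms] using ip_nonneg by simp

text \<open>Enlarging the set of predictors changes the residual by an element orthogonal to the new
  residual, so the change carries exactly the drop in the prediction error. Fourth moments of
  increments thereby become squares of differences of \<open>d\<close>.\<close>

lemma ip_res_diff:
  assumes "finite L" "K \<subseteq> L"
  shows "ip (\<lambda>x. res m L x - res m K x) (\<lambda>x. res m L x - res m K x) =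
    ip (res m K) (res m K) - ip (res m L) (res m L)"
proof -
  have fK: "finite K" using assms finite_subset by blast
  let ?Y = "\<lambda>x. coord m x - res m K x"
  have "?Y \<in> coord_span L" using coord_minus_res[OF fK] coord_span_mono[OF assms(2)] by blast
  from res_pythagoras[OF assms(1) this, of m]
  have "ip (res m K) (res m K) = ip (res m L) (res m L) +
      ip (\<lambda>x. res m K x - res m L x) (\<lambda>x. res m K x - res m L x)" by simp
  moreover have "ip (\<lambda>x. res m K x - res m L x) (\<lambda>x. res m K x - res m L x) =
    ip (\<lambda>x. res m L x - res m K x) (\<lambda>x. res m L x - res m K x)"
    by (simp add: ip_def algebra_simps)
  ultimately show ?thesis by simp
qed

text \<open>The hypothesis says that \<open>\<phi>\<close> preserves covariances. It holds for
  translations and, because r is even, for reflections.\<close>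

lemma ip_pull:
  assumes r: "\<And>i j. r (\<phi> i - \<phi> j) = r (i - j)" and Y: "Y \<in> W" and Z: "Z \<in> W"
  shows "ip (\<lambda>x. Y (pull \<phi> x)) (\<lambda>x. Z (pull \<phi> x)) = ip Y Z"
proof -
  have pW: "(\<lambda>x. Y (pull \<phi> x)) \<in> W" if "Y \<in> W" for Y
    using coord_span_pull[OF that] span_W by blast
  show ?thesis using Y
  proof (induction rule: coord_span_induct)
    case (add a k Y)
    have k: "ip (coord (\<phi> k)) (\<lambda>x. Z (pull \<phi> x)) = ip (coord k) Z"
      using Z
    proof (induction rule: coord_span_induct)
      case (add b j Z)
      then show ?case using pW[OF add(2)] unfolding coord_pull
        by (simp add: ip_add_right coord_span_scale ip_coord r)
    qed simp
    then show ?case using add pW[OF add(2)] pW[OF Z] Z unfolding coord_pull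
      by (simp add: ip_add_left coord_span_scale)
  qed simp
qed

lemma res_pull:
  assumes r: "\<And>i j. r (\<phi> i - \<phi> j) = r (i - j)" and K: "finite K"
  shows "res (\<phi> m) (\<phi> ` K) = (\<lambda>x. res m K (pull \<phi> x))"
proof (rule res_eqI)
  show "is_res (\<phi> m) (\<phi> ` K) (\<lambda>x. res m K (pull \<phi> x))"
    unfolding is_res_def
  proof (intro conjI ballI)
    show "(\<lambda>x. coord (\<phi> m) x - res m K (pull \<phi> x)) \<in> coord_span (\<phi> ` K)"
      using coord_span_pull[OF coord_minus_res[OF K, of m], of \<phi>] by (simp add: coord_pull)
    have pW: "(\<lambda>x. res m K (pull \<phi> x)) \<in> W"
      using coord_span_pull[OF res_W[OF K]] span_W by blast
    show "ip (\<lambda>x. res m K (pull \<phi> x)) Y = 0" if "Y \<in> coord_span (\<phi> ` K)" for Y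
    proof (rule orthogonal_spanI[OF pW _ that])
      fix j assume "j \<in> \<phi> ` K"
      then obtain i where i: "i \<in> K" "j = \<phi> i" by blast
      have "ip (\<lambda>x. res m K (pull \<phi> x)) (\<lambda>x. coord i (pull \<phi> x)) = ip (res m K) (coord i)"
        by (rule ip_pull[OF r res_W[OF K] coord_W])
      also have "\<dots> = 0" by (rule res_orthogonal[OF K coord_span_coord[OF i(1)]])
      finally show "ip (\<lambda>x. res m K (pull \<phi> x)) (coord j) = 0" by (simp add: coord_pull i)
    qed
  qed
qed (use K in simp)

text \<open>By stationarity, the mean square error of predicting any coordinate from the \<open>n\<close> coordinates
  before or after it.\<close>

definition d :: "nat \<Rightarrow> real" where
  "d n = ip (res 0 {- int n..-1}) (res 0 {- int n..-1})"

section \<open>Stationarity and time reversal\<close>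

lemma translate_image: "(\<lambda>i. i + m) ` {a..b} = {a + m..b + (m::int)}"
  by (auto simp: image_iff intro!: bexI[of _ "_ - m"])

lemma reflect_image: "(\<lambda>i. m - i) ` {a..b} = {m - b..m - (a::int)}"
  by (auto simp: image_iff intro!: bexI[of _ "m - _"])

lemma res_translate: "finite K \<Longrightarrow> res (j + m) ((\<lambda>i. i + m) ` K) = (\<lambda>x. res j K (pull (\<lambda>i. i + m) x))"
  by (rule res_pull) auto

lemma res_reflect: "finite K \<Longrightarrow> res (m - j) ((\<lambda>i. m - i) ` K) = (\<lambda>x. res j K (pull (\<lambda>i. m - i) x))"
proof (rule res_pull)
  show "r (m - i - (m - j)) = r (i - j)" for i j using r_sym[of "i - j"] by simp
qed

lemma ip_res_forward: "ip (res m {m - int n..m - 1}) (res m {m - int n..m - 1}) = d n"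
proof -
  have "res (0 + m) ((\<lambda>i. i + m) ` {- int n..-1}) = (\<lambda>x. res 0 {- int n..-1} (pull (\<lambda>i. i + m) x))"
    by (rule res_translate) simp
  then have eq: "res m {m - int n..m - 1} = (\<lambda>x. res 0 {- int n..-1} (pull (\<lambda>i. i + m) x))"
    by (simp add: translate_image algebra_simps)
  show ?thesis unfolding eq d_def by (rule ip_pull) auto
qed

text \<open>Reflection exchanges past and future without changing covariances, so backward
  prediction has the same error as forward prediction.\<close>

lemma ip_res_backward: "ip (res m {m + 1..m + int n}) (res m {m + 1..m + int n}) = d n"
proof -
  have "res (m - 0) ((\<lambda>i. m - i) ` {- int n..-1}) = (\<lambda>x. res 0 {- int n..-1} (pull (\<lambda>i. m - i) x))"
    by (rule res_reflect) simp
  then have eq: "res m {m + 1..m + int n} = (\<lambda>x. res 0 {- int n..-1} (pull (\<lambda>i. m - i) x))"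
    by (simp add: reflect_image algebra_simps)
  show ?thesis unfolding eq d_def
  proof (rule ip_pull)
    show "r (m - i - (m - j)) = r (i - j)" for i j using r_sym[of "i - j"] by simp
  qed auto
qed

lemma d_pos: "0 < d n" unfolding d_def by (rule res_pos) auto

lemma d_antimono: "i \<le> j \<Longrightarrow> d j \<le> d i"
proof -
  assume "i \<le> j"
  then have "{- int i..-1} \<subseteq> {- int j..-1}" by auto
  from ip_res_diff[OF _ this, of 0] show ?thesis
    using ip_nonneg[of "\<lambda>x. res 0 {- int j..-1} x - res 0 {- int i..-1} x"] by (simp add: d_def)
qed

end


section \<open>Sums and index shifts of convergent averages\<close>

lemma conv_to_self: "integrable M h \<Longrightarrow> conv_to M (\<lambda>n. h) h"
  by (simp add: conv_to_def)

lemma conv_to_sum: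
  assumes "finite A" "\<And>j. j \<in> A \<Longrightarrow> conv_to M (g j) (\<lambda>x. 0)"
  shows "conv_to M (\<lambda>n x. \<Sum>j\<in>A. g j n x) (\<lambda>x. 0)"
  using assms
proof (induction A rule: finite_induct)
  case empty
  show ?case using conv_to_self[of M "\<lambda>x. 0"] by simp
next
  case (insert j A)
  have "conv_to M (\<lambda>n x. g j n x + (\<Sum>j\<in>A. g j n x)) (\<lambda>x. 0 + 0)"
    using insert by (intro conv_to_add) auto
  then show ?case using insert by simp
qed

lemma conv_to_Suc:
  assumes "conv_to M g h"
  shows "conv_to M (\<lambda>n. g (Suc n)) h"
proof -
  have "AE x in M. (\<lambda>n. g n x) \<longlonglongrightarrow> h x" using assms by (auto simp: conv_to_def)
  then have "AE x in M. (\<lambda>n. g (Suc n) x) \<longlonglongrightarrow> h x" by eventually_elim (rule LIMSEQ_Suc)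
  moreover have "(\<lambda>n. \<integral>x. \<bar>g n x - h x\<bar> \<partial>M) \<longlonglongrightarrow> 0" using assms by (auto simp: conv_to_def)
  from LIMSEQ_Suc[OF this] have "(\<lambda>n. \<integral>x. \<bar>g (Suc n) x - h x\<bar> \<partial>M) \<longlonglongrightarrow> 0" .
  ultimately show ?thesis using assms by (auto simp: conv_to_def)
qed

lemma Suc_over_tendsto_1: "(\<lambda>n. real (Suc n) / real n) \<longlonglongrightarrow> 1"
  using tendsto_inverse[OF LIMSEQ_n_over_Suc_n] by simp

lemma conv_to_average_Suc:
  assumes "conv_to M (\<lambda>N x. g N x / real N) h"
  shows "conv_to M (\<lambda>N x. g (Suc N) x / real N) h"
proof -
  have "conv_to M (\<lambda>N x. real (Suc N) / real N * (g (Suc N) x / real (Suc N))) (\<lambda>x. 1 * h x)"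
    by (rule conv_to_scale[OF conv_to_Suc[OF assms] Suc_over_tendsto_1])
  then show ?thesis by (simp del: of_nat_Suc)
qed

section \<open>Gaussian densities and averages of squared residuals\<close>

text \<open>Row k holds the coefficients of \<open>b k\<close>. With A this matrix and R the
  covariance matrix, A R A^T is the Gram matrix of the \<open>b k\<close>.\<close>

definition coef_mat :: "nat \<Rightarrow> (nat \<Rightarrow> (int \<Rightarrow> real) \<Rightarrow> real) \<Rightarrow> real Matrix.mat" where
  "coef_mat n b = Matrix.mat n n (\<lambda>(k, i). b k (unit_seq (int i)))"

lemma coef_mat_carrier [simp]: "coef_mat n b \<in> carrier_mat n n"
  by (simp add: coef_mat_def)

lemma cov_mat_carrier [simp]: "cov_mat r n \<in> carrier_mat n n"
  by (simp add: cov_mat_def)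

lemma coord_span_nat_expand:
  assumes "b \<in> coord_span {0..<int n}"
  shows "b x = (\<Sum>i<n. b (unit_seq (int i)) * coord (int i) x)"
proof -
  have im: "{0..<int n} = int ` {..<n}"
    by (auto simp: image_iff intro!: bexI[of _ "nat _"])
  have "b x = (\<Sum>i\<in>{0..<int n}. b (unit_seq i) * coord i x)"
    by (rule coord_span_expand[OF assms]) simp
  also have "\<dots> = (\<Sum>i<n. b (unit_seq (int i)) * coord (int i) x)"
    unfolding im by (subst sum.reindex) auto
  finally show ?thesis .
qed

context gaussian_seq
begin

lemma d_nonzero [simp]: "d n \<noteq> 0" using d_pos[of n] by simp

lemma ip_nat_expand:
  assumes b: "b \<in> coord_span {0..<int n}" and c: "c \<in> coord_span {0..<int n}"
  shows "ip b c = (\<Sum>l<n. (\<Sum>i<n. b (unit_seq (int i)) * r (int i - int l)) * c (unit_seq (int l)))"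
proof -
  have b': "b = (\<lambda>x. \<Sum>i<n. b (unit_seq (int i)) * coord (int i) x)"
    using coord_span_nat_expand[OF b] by (rule ext)
  have c': "c = (\<lambda>x. \<Sum>i<n. c (unit_seq (int i)) * coord (int i) x)"
    using coord_span_nat_expand[OF c] by (rule ext)
  have "ip c b = (\<Sum>l<n. c (unit_seq (int l)) * ip (coord (int l)) b)"
    by (subst (1) c') (rule ip_sum_left[OF span_W[OF b]])
  also have "\<dots> = (\<Sum>l<n. c (unit_seq (int l)) * (\<Sum>i<n. b (unit_seq (int i)) * r (int i - int l)))"
  proof (rule sum.cong[OF refl])
    fix l
    have "ip b (coord (int l)) = (\<Sum>i<n. b (unit_seq (int i)) * ip (coord (int i)) (coord (int l)))"
      by (subst (1) b') (rule ip_sum_left[OF coord_W])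
    then show "c (unit_seq (int l)) * ip (coord (int l)) b =
      c (unit_seq (int l)) * (\<Sum>i<n. b (unit_seq (int i)) * r (int i - int l))"
      by (simp add: ip_commute[of _ b] ip_coord)
  qed
  finally show ?thesis by (simp add: ip_commute[of b] mult.commute)
qed

lemma gram_mat:
  assumes b: "\<And>k. k < n \<Longrightarrow> b k \<in> coord_span {0..<int n}"
    and o: "\<And>j k. j < n \<Longrightarrow> k < n \<Longrightarrow> ip (b j) (b k) = (if j = k then 1 else 0)"
  shows "coef_mat n b * cov_mat r n * transpose_mat (coef_mat n b) = 1\<^sub>m n"
proof (rule eq_matI)
  fix j k assume "j < dim_row (1\<^sub>m n :: real Matrix.mat)" "k < dim_col (1\<^sub>m n :: real Matrix.mat)"
  then have jk: "j < n" "k < n" by auto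
  have "(coef_mat n b * cov_mat r n * transpose_mat (coef_mat n b)) $$ (j, k) =
    (\<Sum>l = 0..<n. (\<Sum>i = 0..<n. b j (unit_seq (int i)) * r (int i - int l)) * b k (unit_seq (int l)))"
    using jk by (simp add: coef_mat_def cov_mat_def scalar_prod_def)
  also have "\<dots> = ip (b j) (b k)"
    using ip_nat_expand[OF b[OF jk(1)] b[OF jk(2)]] by (simp add: atLeast0LessThan)
  finally show "(coef_mat n b * cov_mat r n * transpose_mat (coef_mat n b)) $$ (j, k) = 1\<^sub>m n $$ (j, k)"
    using o[OF jk] jk by simp
qed (auto simp: coef_mat_def)

text \<open>For orthonormal b the Gram identity A R A^T = 1 gives R^(-1) = A^T A, and A maps (x_0,
  ..., x_(n-1)) to the vector of the values \<open>b k x\<close>, so the form is the squared length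
  of that vector.\<close>

lemma quad_form_orthonormal:
  assumes b: "\<And>k. k < n \<Longrightarrow> b k \<in> coord_span {0..<int n}"
    and o: "\<And>j k. j < n \<Longrightarrow> k < n \<Longrightarrow> ip (b j) (b k) = (if j = k then 1 else 0)"
  shows "(\<Sum>i<n. \<Sum>j<n. the (mat_inverse (cov_mat r n)) $$ (i, j) * coord (int i) x * coord (int j) x) =
    (\<Sum>k<n. (b k x)\<^sup>2)"
proof -
  let ?A = "coef_mat n b" and ?R = "cov_mat r n"
  let ?T = "transpose_mat ?A"
  have cT [simp]: "?T \<in> carrier_mat n n" by simp
  have ART: "?A * ?R * ?T = 1\<^sub>m n" by (rule gram_mat[OF b o])
  have cAR: "?A * ?R \<in> carrier_mat n n" by (rule mult_carrier_mat[OF coef_mat_carrier cov_mat_carrier])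
  have cTA: "?T * ?A \<in> carrier_mat n n" by (rule mult_carrier_mat[OF cT coef_mat_carrier])
  have "?T * (?A * ?R) = 1\<^sub>m n" by (rule mat_mult_left_right_inverse[OF cAR cT ART])
  then have TAR: "?T * ?A * ?R = 1\<^sub>m n" by (subst assoc_mult_mat[of _ n n _ n _ n]) auto
  then have RTA: "?R * (?T * ?A) = 1\<^sub>m n" by (intro mat_mult_left_right_inverse[OF cTA]) auto
  have "Determinant.det ?R \<noteq> 0"
  proof
    assume "Determinant.det ?R = 0"
    then have "Determinant.det (?R * (?T * ?A)) = 0"
      by (subst Determinant.det_mult[OF cov_mat_carrier cTA]) simp
    then show False unfolding RTA by simp
  qed
  \<comment> \<open>\<open>the (mat_inverse ?R)\<close> has a meaning only once
    \<open>mat_inverse\<close> is known to return \<open>Some\<close>, which is decided by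
    membership in the units of the matrix ring.\<close>
  then have "?R \<in> Units (ring_mat TYPE(real) n undefined)"
    by (rule det_non_zero_imp_unit[OF cov_mat_carrier])
  then obtain B where B: "mat_inverse ?R = Some B"
    using mat_inverse(1)[OF cov_mat_carrier, of r n undefined] by (cases "mat_inverse ?R") auto
  have Bp: "?R * B = 1\<^sub>m n" "B * ?R = 1\<^sub>m n" "B \<in> carrier_mat n n"
    using mat_inverse(2)[OF cov_mat_carrier B] by auto
  have "B = (?T * ?A * ?R) * B" unfolding TAR using Bp(3) by simp
  also have "\<dots> = (?T * ?A) * (?R * B)" by (rule assoc_mult_mat[OF cTA cov_mat_carrier Bp(3)])
  also have "\<dots> = ?T * ?A" unfolding Bp(1) by (rule right_mult_one_mat[OF cTA])
  finally have inv: "the (mat_inverse ?R) = ?T * ?A" using B by simp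
  have ent: "the (mat_inverse ?R) $$ (i, j) = (\<Sum>k<n. b k (unit_seq (int i)) * b k (unit_seq (int j)))"
    if "i < n" "j < n" for i j
    unfolding inv using that by (simp add: coef_mat_def scalar_prod_def atLeast0LessThan)
  have "(\<Sum>i<n. \<Sum>j<n. the (mat_inverse ?R) $$ (i, j) * coord (int i) x * coord (int j) x) =
    (\<Sum>i<n. \<Sum>j<n. \<Sum>k<n. (b k (unit_seq (int i)) * coord (int i) x) * (b k (unit_seq (int j)) * coord (int j) x))"
    by (intro sum.cong refl) (simp add: ent sum_distrib_left sum_distrib_right mult_ac)
  also have "\<dots> = (\<Sum>i<n. \<Sum>k<n. \<Sum>j<n. (b k (unit_seq (int i)) * coord (int i) x) * (b k (unit_seq (int j)) * coord (int j) x))"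
    by (rule sum.cong[OF refl]) (rule sum.swap)
  also have "\<dots> = (\<Sum>k<n. \<Sum>i<n. \<Sum>j<n. (b k (unit_seq (int i)) * coord (int i) x) * (b k (unit_seq (int j)) * coord (int j) x))"
    by (rule sum.swap)
  also have "\<dots> = (\<Sum>k<n. (b k x)\<^sup>2)"
  proof (rule sum.cong[OF refl])
    fix k assume "k \<in> {..<n}"
    then have bx: "b k x = (\<Sum>i<n. b k (unit_seq (int i)) * coord (int i) x)"
      using coord_span_nat_expand[OF b] by simp
    show "(\<Sum>i<n. \<Sum>j<n. (b k (unit_seq (int i)) * coord (int i) x) * (b k (unit_seq (int j)) * coord (int j) x)) = (b k x)\<^sup>2"
      unfolding bx power2_eq_square by (rule sum_product[symmetric])
  qed
  finally show ?thesis .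
qed

lemma normalized_orthonormal:
  assumes o: "\<And>j k. j < n \<Longrightarrow> k < n \<Longrightarrow> j \<noteq> k \<Longrightarrow> ip (b j) (b k) = 0"
    and v: "\<And>k. k < n \<Longrightarrow> ip (b k) (b k) = v k" "\<And>k. k < n \<Longrightarrow> 0 < v k" and jk: "j < n" "k < n"
  shows "ip (\<lambda>x. 1 / sqrt (v j) * b j x) (\<lambda>x. 1 / sqrt (v k) * b k x) = (if j = k then 1 else 0)"
proof (cases "j = k")
  case True
  have "sqrt (v k) * sqrt (v k) = v k" using v(2)[OF jk(2)] by simp
  then show ?thesis unfolding True ip_scale_left ip_scale_right using v[OF jk(2)] by (simp add: field_simps)
next
  case False
  then show ?thesis unfolding ip_scale_left ip_scale_right using o jk by simp
qed

lemma quad_form_orthogonal: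
  assumes b: "\<And>k. k < n \<Longrightarrow> b k \<in> coord_span {0..<int n}"
    and o: "\<And>j k. j < n \<Longrightarrow> k < n \<Longrightarrow> j \<noteq> k \<Longrightarrow> ip (b j) (b k) = 0"
    and v: "\<And>k. k < n \<Longrightarrow> ip (b k) (b k) = v k" "\<And>k. k < n \<Longrightarrow> 0 < v k"
  shows "(\<Sum>i<n. \<Sum>j<n. the (mat_inverse (cov_mat r n)) $$ (i, j) * coord (int i) x * coord (int j) x) =
    (\<Sum>k<n. (b k x)\<^sup>2 / v k)"
proof -
  have "(\<Sum>i<n. \<Sum>j<n. the (mat_inverse (cov_mat r n)) $$ (i, j) * coord (int i) x * coord (int j) x) =
    (\<Sum>k<n. (1 / sqrt (v k) * b k x)\<^sup>2)"
    by (rule quad_form_orthonormal[OF coord_span_scale[OF b] normalized_orthonormal[OF o v]])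
  also have "\<dots> = (\<Sum>k<n. (b k x)\<^sup>2 / v k)"
  proof (rule sum.cong[OF refl])
    fix k assume "k \<in> {..<n}"
    then have "0 < v k" using v(2) by simp
    then show "(1 / sqrt (v k) * b k x)\<^sup>2 = (b k x)\<^sup>2 / v k" by (simp add: power_mult_distrib power_divide)
  qed
  finally show ?thesis .
qed

section \<open>Innovations, determinant and information\<close>

definition fwd :: "nat \<Rightarrow> (int \<Rightarrow> real) \<Rightarrow> real" where
  "fwd k = res (int k) {0..<int k}"

lemma ip_fwd: "ip (fwd k) (fwd k) = d k"
proof -
  have "{0..<int k} = {int k - int k..int k - 1}" by auto
  then show ?thesis unfolding fwd_def using ip_res_forward[of "int k" k] by simp
qed

lemma fwd_span: "k < n \<Longrightarrow> fwd k \<in> coord_span {0..<int n}"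
  using res_span[of "{0..<int k}" "int k"] coord_span_mono[of "insert (int k) {0..<int k}" "{0..<int n}"]
  unfolding fwd_def by (auto simp: subset_iff)

lemma fwd_W [simp]: "fwd k \<in> W" by (simp add: fwd_def)

lemma fwd_orthogonal: "j < k \<Longrightarrow> ip (fwd j) (fwd k) = 0"
  using res_orthogonal[of "{0..<int k}" "fwd j" "int k"] fwd_span[of j k]
  by (simp add: ip_commute[of "fwd j"] fwd_def[of k])

lemma fwd_orthogonal': "j \<noteq> k \<Longrightarrow> ip (fwd j) (fwd k) = 0"
  using fwd_orthogonal[of j k] fwd_orthogonal[of k j] by (cases "j < k") (auto simp: ip_commute)

text \<open>The quadratic form of the inverse covariance matrix in the basis of innovations. In this
  basis passing from n to n + 1 adds a single term.\<close>

definition Qf :: "nat \<Rightarrow> (int \<Rightarrow> real) \<Rightarrow> real" where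
  "Qf n x = (\<Sum>k<n. (fwd k x)\<^sup>2 / d k)"

lemma quad_form_eq_Qf:
  "(\<Sum>i<n. \<Sum>j<n. the (mat_inverse (cov_mat r n)) $$ (i, j) * coord (int i) x * coord (int j) x) = Qf n x"
  unfolding Qf_def
  by (rule quad_form_orthogonal[OF fwd_span fwd_orthogonal' ip_fwd d_pos])

text \<open>The quadratic form does not depend on the orthogonal basis that diagonalizes it.\<close>

lemma Qf_eq:
  assumes "\<And>k. k < n \<Longrightarrow> b k \<in> coord_span {0..<int n}"
    and "\<And>j k. j < n \<Longrightarrow> k < n \<Longrightarrow> j \<noteq> k \<Longrightarrow> ip (b j) (b k) = 0"
    and "\<And>k. k < n \<Longrightarrow> ip (b k) (b k) = v k" "\<And>k. k < n \<Longrightarrow> 0 < v k"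
  shows "Qf n x = (\<Sum>k<n. (b k x)\<^sup>2 / v k)"
  unfolding quad_form_eq_Qf[symmetric] by (rule quad_form_orthogonal[OF assms])

text \<open>The coefficient matrix of the normalized innovations is lower triangular with diagonal
  entries 1 / sqrt (d k), because X_k enters its own residual with coefficient 1.\<close>

lemma det_cov_mat: "Determinant.det (cov_mat r n) = (\<Prod>k<n. d k)"
proof -
  let ?b = "\<lambda>k x. 1 / sqrt (d k) * fwd k x"
  let ?A = "coef_mat n ?b" and ?R = "cov_mat r n"
  have b: "?b k \<in> coord_span {0..<int n}" if "k < n" for k
    by (rule coord_span_scale[OF fwd_span[OF that]])
  have ART: "?A * ?R * transpose_mat ?A = 1\<^sub>m n"
    by (rule gram_mat[OF b normalized_orthonormal[OF fwd_orthogonal' ip_fwd d_pos]])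
  have cAR: "?A * ?R \<in> carrier_mat n n" by (rule mult_carrier_mat[OF coef_mat_carrier cov_mat_carrier])
  have "Determinant.det (?A * ?R * transpose_mat ?A) = Determinant.det ?A * Determinant.det ?R * Determinant.det ?A"
    unfolding Determinant.det_mult[OF cAR transpose_carrier_mat[THEN iffD2, OF coef_mat_carrier]]
      Determinant.det_mult[OF coef_mat_carrier cov_mat_carrier] Determinant.det_transpose[OF coef_mat_carrier] ..
  then have 1: "Determinant.det ?A * Determinant.det ?R * Determinant.det ?A = 1" unfolding ART by simp
  have diag: "fwd k (unit_seq (int k)) = 1" for k
  proof -
    have "(\<lambda>x. coord (int k) x - fwd k x) \<in> coord_span {0..<int k}"
      unfolding fwd_def by (rule coord_minus_res) simp
    from coord_span_unit_seq_notin[OF this, of "int k"] show ?thesis by (simp add: coord_unit_seq)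
  qed
  have low: "fwd k (unit_seq (int i)) = 0" if "k < i" for k i
    by (rule coord_span_unit_seq_notin[OF fwd_span[of k "Suc k"]]) (use that in auto)
  have "Determinant.det ?A = prod_list (diag_mat ?A)"
    by (rule det_lower_triangular[of n]) (auto simp: coef_mat_def low)
  also have "\<dots> = (\<Prod>k<n. 1 / sqrt (d k))"
    unfolding prod_list_diag_prod by (simp add: coef_mat_def diag atLeast0LessThan)
  finally have A: "Determinant.det ?A = (\<Prod>k<n. 1 / sqrt (d k))" .
  have "Determinant.det ?A * Determinant.det ?A = (\<Prod>k<n. 1 / d k)"
    unfolding A prod.distrib[symmetric] using d_pos by (intro prod.cong) (auto simp: less_imp_le)
  also have "\<dots> = 1 / (\<Prod>k<n. d k)" by (simp add: prod_dividef)
  finally have AA: "Determinant.det ?A * Determinant.det ?A = 1 / (\<Prod>k<n. d k)" .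
  have "Determinant.det ?R * (Determinant.det ?A * Determinant.det ?A) = 1" using 1 by (simp only: mult_ac)
  then have "Determinant.det ?R / (\<Prod>k<n. d k) = 1" unfolding AA by (simp only: times_divide_eq_right mult_1_right)
  moreover have "(\<Prod>k<n. d k) \<noteq> 0" by simp
  ultimately show ?thesis by (rule right_inverse_eq[THEN iffD1, rotated])
qed

text \<open>The deterministic part of the information; the random part is \<open>Qf n x / 2\<close>,
  with mean n / 2.\<close>

definition info_const :: "nat \<Rightarrow> real" where
  "info_const n = real n / 2 * ln (2 * pi) + (\<Sum>k<n. ln (d k)) / 2"

lemma gauss_density_eq: "gauss_density r n x = exp (- (info_const n + Qf n x / 2))"
proof -
  have D: "0 < (\<Prod>k<n. d k)" using d_pos by (intro prod_pos) auto
  have "gauss_density r n x = (2 * pi) powr (- real n / 2) * (\<Prod>k<n. d k) powr (- 1 / 2) * exp (- (1 / 2) * Qf n x)"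
    unfolding gauss_density_def det_cov_mat quad_form_eq_Qf ..
  also have "(2 * pi) powr (- real n / 2) = exp (- (real n / 2 * ln (2 * pi)))"
    by (simp add: powr_def)
  also have "(\<Prod>k<n. d k) powr (- 1 / 2) = exp (- ((\<Sum>k<n. ln (d k)) / 2))"
  proof -
    have "ln (\<Prod>k<n. d k) = (\<Sum>k<n. ln (d k))" by (rule ln_prod) (use d_pos in \<open>auto\<close>)
    then show ?thesis using D by (simp add: powr_def)
  qed
  finally show ?thesis by (simp add: info_const_def exp_add[symmetric])
qed

lemma information_eq: "information r n x = info_const n + Qf n x / 2"
  by (simp add: information_def gauss_density_eq)

lemma fwd_square_integrable: "integrable \<mu> (\<lambda>x. (fwd k x)\<^sup>2)"
  by (rule span_integrable_square) simp

lemma Qf_integrable: "integrable \<mu> (Qf n)"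
  unfolding Qf_def[abs_def] by (intro Bochner_Integration.integrable_sum integrable_divide fwd_square_integrable)

lemma integral_Qf: "(\<integral>x. Qf n x \<partial>\<mu>) = real n"
proof -
  have "(\<integral>x. Qf n x \<partial>\<mu>) = (\<Sum>k<n. (\<integral>x. (fwd k x)\<^sup>2 / d k \<partial>\<mu>))"
    unfolding Qf_def by (intro Bochner_Integration.integral_sum integrable_divide fwd_square_integrable)
  also have "\<dots> = (\<Sum>k<n. 1)"
    using d_pos by (intro sum.cong) (auto simp: integral_square ip_fwd less_le)
  finally show ?thesis by simp
qed

lemma information_integrable: "integrable \<mu> (information r n)"
  unfolding information_eq[abs_def] using Qf_integrable by auto

lemma block_entropy_eq: "block_entropy \<mu> r n = info_const n + real n / 2"
proof -
  have "block_entropy \<mu> r n = (\<integral>x. info_const n + Qf n x / 2 \<partial>\<mu>)"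
    unfolding block_entropy_def information_eq ..
  also have "\<dots> = info_const n + (\<integral>x. Qf n x \<partial>\<mu>) / 2"
    using Qf_integrable by (simp add: prob_space)
  finally show ?thesis by (simp add: integral_Qf)
qed

lemma Qf_average: "conv_to \<mu> (\<lambda>n x. Qf n x / real n) (\<lambda>x. 1)"
proof -
  let ?e = "\<lambda>k x. 1 / sqrt (d k) * fwd k x"
  have on: "ip (?e j) (?e k) = (if j = k then 1 else 0)" for j k
    by (rule normalized_orthonormal[of "max (Suc j) (Suc k)", OF fwd_orthogonal' ip_fwd d_pos]) auto
  have "conv_to \<mu> (\<lambda>N x. (\<Sum>k<N. (?e k x)\<^sup>2) / real N) (\<lambda>x. 1)"
  proof (rule slln_orthogonal[where B = 1])
    show "?e k \<in> W" for k by (rule coord_span_scale[OF fwd_W])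
    show "ip (?e j) (?e k) = 0" if "j < k" for j k unfolding on using that by simp
    show "(\<lambda>k. ip (?e k) (?e k)) \<longlonglongrightarrow> 1" unfolding on by simp
    show "ip (?e k) (?e k) \<le> 1" for k unfolding on by simp
  qed
  moreover have "(?e k x)\<^sup>2 = (fwd k x)\<^sup>2 / d k" for k x
    using d_pos[of k] by (simp add: power_mult_distrib power_divide)
  ultimately show ?thesis by (simp only: Qf_def)
qed

lemma information_conv:
  assumes lim: "d \<longlonglongrightarrow> S" and S: "0 < S"
  shows "conv_to \<mu> (\<lambda>n x. 1 / real n * information r n x) (\<lambda>x. ln (2 * pi) / 2 + ln S / 2 + 1 / 2 * 1)"
proof (rule conv_to_eventually[where ?n0.0 = 1])
  have "(\<lambda>k. ln (d k)) \<longlonglongrightarrow> ln S" using lim S by (intro tendsto_ln) auto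
  then have "conv_to \<mu> (\<lambda>k x. ln (d k)) (\<lambda>x. ln S)" by (rule conv_to_const[OF \<mu>_prob])
  from conv_to_mean[OF this] have "conv_to \<mu> (\<lambda>n x. (\<Sum>k<n. ln (d k)) / real n) (\<lambda>x. ln S)" .
  from conv_to_scale[OF this tendsto_const[of "1/2"]]
  have a: "conv_to \<mu> (\<lambda>n x. 1/2 * ((\<Sum>k<n. ln (d k)) / real n)) (\<lambda>x. ln S / 2)" by simp
  show "conv_to \<mu> (\<lambda>n x. (ln (2 * pi) / 2 + 1/2 * ((\<Sum>k<n. ln (d k)) / real n)) + 1/2 * (Qf n x / real n))
    (\<lambda>x. (ln (2 * pi) / 2 + ln S / 2) + 1 / 2 * 1)"
    by (intro conv_to_add a conv_to_const[OF \<mu>_prob] tendsto_const conv_to_scale[OF Qf_average])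
  show "integrable \<mu> (\<lambda>x. 1 / real n * information r n x)" for n
    using information_integrable by auto
  show "1 / real n * information r n x =
      (ln (2 * pi) / 2 + 1/2 * ((\<Sum>k<n. ln (d k)) / real n)) + 1/2 * (Qf n x / real n)" if "1 \<le> n" for n x
    using that by (simp add: information_eq info_const_def field_simps)
qed

section \<open>Backward residuals with a moving end point\<close>

lemma span_square_over_n:
  assumes Y: "\<And>n. Y n \<in> W" and C: "\<And>n. ip (Y n) (Y n) \<le> C"
  shows "conv_to \<mu> (\<lambda>n x. (Y n x)\<^sup>2 / real n) (\<lambda>x. 0)"
proof (rule conv_to_square_over_n[OF \<mu>_prob, where C = "3 * C\<^sup>2"])
  show "(\<integral>x. (Y n x)^4 \<partial>\<mu>) \<le> 3 * C\<^sup>2" for n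
    unfolding fourth_moment(2)[OF Y] by (intro mult_left_mono power_mono C ip_nonneg) auto
qed (use measurable_span[OF Y] fourth_moment(1)[OF Y] in auto)

text \<open>The block X_0, ..., X_N is exhausted from its right end. Truncated subtraction makes
  \<open>bwd N j\<close> equal to \<open>bwd N N\<close> for j > N, whence the \<open>min\<close> in
  \<open>ip_bwd\<close>; so for each fixed j the errors stay bounded for every N, also for N <
  j.\<close>

definition bwd :: "nat \<Rightarrow> nat \<Rightarrow> (int \<Rightarrow> real) \<Rightarrow> real" where
  "bwd N j = res (int (N - j)) {int (N - j) + 1..int N}"

lemma bwd_W [simp]: "bwd N j \<in> W" by (simp add: bwd_def)

lemma ip_bwd: "ip (bwd N j) (bwd N j) = d (min j N)"
proof -
  have "int N = int (N - j) + int (min j N)" by simp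
  then show ?thesis unfolding bwd_def using ip_res_backward[of "int (N - j)" "min j N"] by metis
qed

lemma bwd_span: "bwd N j \<in> coord_span {int (N - j)..int N}"
  using res_span[of "{int (N - j) + 1..int N}" "int (N - j)"]
    coord_span_mono[of "insert (int (N - j)) {int (N - j) + 1..int N}" "{int (N - j)..int N}"]
  unfolding bwd_def by (auto simp: subset_iff)

lemma bwd_orthogonal: "j < k \<Longrightarrow> k \<le> N \<Longrightarrow> ip (bwd N j) (bwd N k) = 0"
proof -
  assume jk: "j < k" "k \<le> N"
  have "{int (N - j)..int N} \<subseteq> {int (N - k) + 1..int N}" using jk by auto
  then have "bwd N j \<in> coord_span {int (N - k) + 1..int N}" using bwd_span coord_span_mono by blast
  then have "ip (bwd N k) (bwd N j) = 0"
    unfolding bwd_def[of N k] by (intro res_orthogonal) auto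
  then show ?thesis by (simp add: ip_commute)
qed

lemma Qf_bwd: "Qf (Suc N) x = (\<Sum>j<Suc N. (bwd N j x)\<^sup>2 / d j)"
proof (rule Qf_eq)
  fix j k assume "j < Suc N" "k < Suc N" "j \<noteq> k"
  then show "ip (bwd N j) (bwd N k) = 0"
    using bwd_orthogonal[of j k N] bwd_orthogonal[of k j N] by (cases "j < k") (auto simp: ip_commute)
next
  fix k
  have "coord_span {int (N - k)..int N} \<subseteq> coord_span {0..<int (Suc N)}" by (rule coord_span_mono) auto
  then show "bwd N k \<in> coord_span {0..<int (Suc N)}" using bwd_span by blast
qed (auto simp: ip_bwd d_pos min_def)

text \<open>No strong law is applied to the array itself. The sum of the squares over j = 0, ..., N
  minus S times \<open>Qf (Suc N)\<close> has the weights 1 - S / d_j, which are nonnegative as d_j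
  decreases to S, and small apart from a fixed number of initial terms. Each of those is o(N) by
  \<open>span_square_over_n\<close>.\<close>

lemma backward_average:
  assumes lim: "d \<longlonglongrightarrow> S" and S: "0 < S"
  shows "conv_to \<mu> (\<lambda>N x. 1 / real N * (\<Sum>j\<in>{1..N-1}. (bwd N j x)\<^sup>2)) (\<lambda>x. S)"
proof -
  have dS: "S \<le> d i" for i
    by (rule LIMSEQ_le_const2[OF lim]) (auto intro: exI[of _ i] d_antimono)
  let ?T = "\<lambda>N x. \<Sum>j\<in>{1..N-1}. (bwd N j x)\<^sup>2"
  have bi: "integrable \<mu> (\<lambda>x. (bwd N j x)\<^sup>2)" for N j by (rule span_integrable_square) simp
  have Q1: "conv_to \<mu> (\<lambda>N x. Qf (Suc N) x / real N) (\<lambda>x. 1)" by (rule conv_to_average_Suc[OF Qf_average])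
  have b0: "conv_to \<mu> (\<lambda>N x. (bwd N j x)\<^sup>2 / real N) (\<lambda>x. 0)" for j
    by (rule span_square_over_n[where C = "d 0"]) (auto simp: ip_bwd d_antimono)
  have bN: "conv_to \<mu> (\<lambda>N x. (bwd N N x)\<^sup>2 / real N) (\<lambda>x. 0)"
    by (rule span_square_over_n[where C = "d 0"]) (auto simp: ip_bwd d_antimono)
  let ?g = "\<lambda>N x. (?T N x - S * Qf (Suc N) x) / real N"
  have g: "conv_to \<mu> ?g (\<lambda>x. 0)"
  proof (rule conv_to_zero_approx[where c = 1, OF _ _ \<mu>_prob])
    show "integrable \<mu> (?g N)" for N
      using Qf_integrable bi by (intro integrable_divide Bochner_Integration.integrable_diff Bochner_Integration.integrable_sum integrable_mult_right) auto
    fix i :: nat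
    have "\<forall>\<^sub>F j in sequentially. d j < S + 1 / real (Suc i)"
      using lim by (rule order_tendstoD(2)) simp
    then obtain J where J: "\<And>j. J \<le> j \<Longrightarrow> d j < S + 1 / real (Suc i)" by (auto simp: eventually_sequentially)
    let ?k = "\<lambda>N x. 1 / real (Suc i) * (Qf (Suc N) x / real N) +
      ((\<Sum>j<J. (bwd N j x)\<^sup>2 / real N) + ((bwd N 0 x)\<^sup>2 / real N + (bwd N N x)\<^sup>2 / real N))"
    have "conv_to \<mu> ?k (\<lambda>x. 1 / real (Suc i) * 1 + (0 + (0 + 0)))"
      by (intro conv_to_add conv_to_scale[OF Q1] tendsto_const conv_to_sum b0 bN) simp
    then have k: "conv_to \<mu> ?k (\<lambda>x. 1 / real (Suc i))" by simp
    have le: "\<bar>?g N x\<bar> \<le> ?k N x" for N x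
    proof -
      let ?b = "\<lambda>j. (bwd N j x)\<^sup>2"
      \<comment> \<open>From J on the weight is at most 1 / (i + 1) divided by d_j, so these terms
        are absorbed by the quadratic form; before J the weight is bounded by 1.\<close>
      have t: "(1 - S / d j) * ?b j \<le> 1 / real (Suc i) * (?b j / d j) + (if j < J then ?b j else 0)" for j
      proof (cases "j < J")
        case True
        have "(1 - S / d j) * ?b j \<le> 1 * ?b j" using S d_pos[of j] by (intro mult_right_mono) auto
        moreover have "0 \<le> 1 / real (Suc i) * (?b j / d j)" using d_pos[of j] by simp
        ultimately show ?thesis using True by simp
      next
        case False
        then have "d j - S \<le> 1 / real (Suc i)" using J[of j] by simp
        then have "(d j - S) * (?b j / d j) \<le> 1 / real (Suc i) * (?b j / d j)"
          using d_pos[of j] by (intro mult_right_mono) auto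
        moreover have "(d j - S) * (?b j / d j) = (1 - S / d j) * ?b j" using d_pos[of j] by (simp add: field_simps)
        ultimately show ?thesis using False by simp
      qed
      have t0: "0 \<le> (1 - S / d j) * ?b j" for j using dS[of j] d_pos[of j] by simp
      have J': "(\<Sum>j<Suc N. if j < J then ?b j else 0) \<le> (\<Sum>j<J. ?b j)"
        by (subst sum.inter_filter[symmetric]) (auto intro!: sum_mono2)
      have "(\<Sum>j<Suc N. (1 - S / d j) * ?b j) \<le> (\<Sum>j<Suc N. 1 / real (Suc i) * (?b j / d j) + (if j < J then ?b j else 0))"
        by (rule sum_mono) (rule t)
      also have "\<dots> = 1 / real (Suc i) * Qf (Suc N) x + (\<Sum>j<Suc N. if j < J then ?b j else 0)"
        unfolding Qf_bwd sum.distrib sum_distrib_left ..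
      finally have up: "(\<Sum>j<Suc N. (1 - S / d j) * ?b j) \<le> 1 / real (Suc i) * Qf (Suc N) x + (\<Sum>j<J. ?b j)"
        using J' by linarith
      have low: "0 \<le> (\<Sum>j<Suc N. (1 - S / d j) * ?b j)" by (rule sum_nonneg) (rule t0)
      have eq: "(\<Sum>j<Suc N. (1 - S / d j) * ?b j) = (\<Sum>j<Suc N. ?b j) - S * Qf (Suc N) x"
        unfolding Qf_bwd sum_distrib_left sum_subtractf[symmetric] by (intro sum.cong) (auto simp: algebra_simps)
      \<comment> \<open>The orthogonal basis runs over j = 0, ..., N, whereas (ii) sums over 1, ...,
        N - 1; the two end terms are part of the error.\<close>
      have T: "(\<Sum>j<Suc N. ?b j) \<le> ?T N x + ?b 0 + ?b N" "?T N x \<le> (\<Sum>j<Suc N. ?b j)"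
      proof -
        have "(\<Sum>j\<in>{..<Suc N}. ?b j) \<le> (\<Sum>j\<in>{1..N-1} \<union> {0, N}. ?b j)"
          by (rule sum_mono2) auto
        also have "\<dots> \<le> ?T N x + (\<Sum>j\<in>{0, N}. ?b j)"
          by (subst sum_Un) (auto intro: sum_nonneg)
        also have "(\<Sum>j\<in>{0, N}. ?b j) \<le> ?b 0 + ?b N" by (cases "N = 0") auto
        finally show "(\<Sum>j<Suc N. ?b j) \<le> ?T N x + ?b 0 + ?b N" by simp
        show "?T N x \<le> (\<Sum>j<Suc N. ?b j)" by (rule sum_mono2) auto
      qed
      have "\<bar>?T N x - S * Qf (Suc N) x\<bar> \<le> 1 / real (Suc i) * Qf (Suc N) x + ((\<Sum>j<J. ?b j) + (?b 0 + ?b N))"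
      proof -
        have "0 \<le> ?b 0" "0 \<le> ?b N" "0 \<le> (\<Sum>j<J. ?b j)" by (auto intro: sum_nonneg)
        then show ?thesis using up low eq T by linarith
      qed
      then have "\<bar>?T N x - S * Qf (Suc N) x\<bar> / real N \<le>
          (1 / real (Suc i) * Qf (Suc N) x + ((\<Sum>j<J. ?b j) + (?b 0 + ?b N))) / real N"
        by (rule divide_right_mono) simp
      then show ?thesis by (simp add: abs_divide add_divide_distrib sum_divide_distrib del: of_nat_Suc)
    qed
    show "\<exists>k. conv_to \<mu> k (\<lambda>x. 1 / real (Suc i)) \<and> (\<forall>n x. \<bar>?g n x\<bar> \<le> k n x)"
      by (rule exI[of _ ?k], rule conjI[OF k], intro allI le)
  qed
  have "conv_to \<mu> (\<lambda>N x. ?g N x + S * (Qf (Suc N) x / real N)) (\<lambda>x. 0 + S * 1)"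
    by (intro conv_to_add g conv_to_scale[OF Q1] tendsto_const)
  moreover have "?g N x + S * (Qf (Suc N) x / real N) = 1 / real N * ?T N x" for N x
    by (simp add: diff_divide_distrib)
  ultimately show ?thesis by simp
qed

section \<open>The density ratio in (v)\<close>

lemma backward_limit:
  assumes lim: "d \<longlonglongrightarrow> S"
  obtains h where "conv_to \<mu> (\<lambda>n x. (res 0 {1..int n} x)\<^sup>2) h"
proof -
  \<comment> \<open>The second moments of the increments are differences of \<open>d\<close>; a
    Gaussian fourth moment is three times the square of the second, whence the constant 3
    below.\<close>
  have diff: "ip (\<lambda>x. res 0 {1..int j} x - res 0 {1..int i} x) (\<lambda>x. res 0 {1..int j} x - res 0 {1..int i} x) = d i - d j"
    if "i \<le> j" for i j
    using ip_res_diff[of "{1..int j}" "{1..int i}" 0] ip_res_backward[of 0 i] ip_res_backward[of 0 j] that by simp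
  have W: "(\<lambda>x. res 0 {1..int j} x - res 0 {1..int i} x) \<in> W" for i j by (intro coord_span_diff) auto
  show ?thesis
  proof (rule fourth_moment_convergence[OF \<mu>_prob, of "\<lambda>n. res 0 {1..int n}" 3 d S])
    show "res 0 {1..int k} \<in> borel_measurable \<mu>" for k by (rule measurable_span[OF res_W]) simp
    show "integrable \<mu> (\<lambda>x. (res 0 {1..int j} x - res 0 {1..int i} x) ^ 4)" for i j
      by (rule fourth_moment(1)[OF W])
    show "(\<integral>x. (res 0 {1..int j} x - res 0 {1..int i} x) ^ 4 \<partial>\<mu>) \<le> 3 * (d i - d j)\<^sup>2" if "i \<le> j" for i j
      using fourth_moment(2)[OF W[of j i]] diff[OF that] by simp
    show "integrable \<mu> (\<lambda>x. (res 0 {1..int 0} x)\<^sup>2)" by (rule span_integrable_square) simp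
  qed (use d_antimono lim that in auto)
qed

text \<open>The innovations of X_1, ..., X_n among themselves are the \<open>fwd k\<close> read at
  \<open>shift x\<close>. Adding X_0 last contributes its residual given X_1, ..., X_n, and by
  \<open>Qf_eq\<close> this basis computes the same form on X_0, ..., X_n as the forward
  one.\<close>

lemma Qf_shift: "Qf n (shift x) = Qf (Suc n) x - (res 0 {1..int n} x)\<^sup>2 / d n"
proof -
  have sh: "shift x = pull (\<lambda>i. i + 1) x" by (simp add: shift_def pull_def)
  let ?f = "\<lambda>k. res (int k + 1) {1..int k}"
  have f: "fwd k (shift x) = ?f k x" for k
  proof -
    have "(\<lambda>i. i + 1) ` {0..<int k} = {1..int k}" by (auto simp: image_iff intro!: bexI[of _ "_ - 1"])
    then show ?thesis using res_translate[of "{0..<int k}" "int k" 1] by (simp add: fwd_def sh)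
  qed
  have ipf: "ip (?f k) (?f k) = d k" for k
    using ip_res_forward[of "int k + 1" k] by simp
  have fs: "?f k \<in> coord_span {1..int k + 1}" for k
  proof -
    have "insert (int k + 1) {1..int k} \<subseteq> {1..int k + 1}" by auto
    from coord_span_mono[OF this] show ?thesis using res_span[of "{1..int k}" "int k + 1"] by blast
  qed
  have of: "ip (?f k) (?f j) = 0" if "j < k" for j k
  proof -
    have "{1..int j + 1} \<subseteq> {1..int k}" using that by auto
    then have "?f j \<in> coord_span {1..int k}" using fs[of j] coord_span_mono by blast
    then show ?thesis by (intro res_orthogonal) auto
  qed
  let ?a = "res 0 {1..int n}"
  have oa: "ip ?a (?f j) = 0" if "j < n" for j
  proof -
    have "{1..int j + 1} \<subseteq> {1..int n}" using that by auto
    then have "?f j \<in> coord_span {1..int n}" using fs[of j] coord_span_mono by blast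
    then show ?thesis by (intro res_orthogonal) auto
  qed
  let ?b = "\<lambda>k. if k = n then ?a else ?f k"
  have "Qf (Suc n) x = (\<Sum>k<Suc n. (?b k x)\<^sup>2 / d k)"
  proof (rule Qf_eq)
    fix k assume k: "k < Suc n"
    show "?b k \<in> coord_span {0..<int (Suc n)}"
    proof (cases "k = n")
      case True
      have "insert 0 {1..int n} \<subseteq> {0..<int (Suc n)}" by auto
      from coord_span_mono[OF this] show ?thesis using True res_span[of "{1..int n}" 0] by auto
    next
      case False
      then have "{1..int k + 1} \<subseteq> {0..<int (Suc n)}" using k by auto
      from coord_span_mono[OF this] show ?thesis using False fs[of k] by auto
    qed
    show "ip (?b k) (?b k) = d k" using ipf[of k] ip_res_backward[of 0 n] by simp
    show "0 < d k" by (rule d_pos)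
    fix j assume j: "j < Suc n" "j \<noteq> k"
    then show "ip (?b j) (?b k) = 0"
      using k of[of j k] of[of k j] oa[of j] oa[of k] by (auto simp: ip_commute neq_iff)
  qed
  also have "\<dots> = (\<Sum>k<n. (?f k x)\<^sup>2 / d k) + (?a x)\<^sup>2 / d n" by simp
  finally show ?thesis by (simp add: Qf_def[of n] f)
qed

text \<open>Determinants and powers of 2 pi cancel. Both remaining quadratic forms are completed to
  \<open>Qf (Suc n) x\<close>, one by the residual of X_n and the other by that of X_0.\<close>

lemma ln_density_ratio:
  "ln (gauss_density r n x / gauss_density r n (shift x)) = ((fwd n x)\<^sup>2 / d n - (res 0 {1..int n} x)\<^sup>2 / d n) / 2"
proof -
  have "ln (gauss_density r n x / gauss_density r n (shift x)) = (Qf n (shift x) - Qf n x) / 2"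
    by (simp add: gauss_density_eq ln_div field_simps)
  then show ?thesis by (simp add: Qf_shift) (simp add: Qf_def)
qed

text \<open>The forward terms add up to differences of \<open>Qf\<close>, whose averages obey the
  strong law. The backward terms converge one by one, to a limit that may depend on x, and Cesaro
  means keep that limit.\<close>

lemma density_ratio_average:
  assumes lim: "d \<longlonglongrightarrow> S" and S: "0 < S"
  obtains h where "conv_to \<mu> (\<lambda>N x. 1 / real N *
    (\<Sum>n\<in>{2..N}. ln (gauss_density r n x / gauss_density r n (shift x)))) h"
proof -
  let ?a = "\<lambda>n. res 0 {1..int n}"
  obtain h where h: "conv_to \<mu> (\<lambda>n x. (?a n x)\<^sup>2) h" by (rule backward_limit[OF lim])
  define A where "A n x = (\<Sum>k<n. 1 / d k * (?a k x)\<^sup>2)" for n x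
  have "conv_to \<mu> (\<lambda>n x. 1 / d n * (?a n x)\<^sup>2) (\<lambda>x. 1 / S * h x)"
    using S by (intro conv_to_scale[OF h] tendsto_divide tendsto_const lim) auto
  from conv_to_mean[OF this] have A: "conv_to \<mu> (\<lambda>n x. A n x / real n) (\<lambda>x. 1 / S * h x)"
    unfolding A_def .
  have ai: "integrable \<mu> (\<lambda>x. (?a n x)\<^sup>2)" for n by (rule span_integrable_square) simp
  have Ai: "integrable \<mu> (A n)" for n
    unfolding A_def[abs_def] by (intro Bochner_Integration.integrable_sum integrable_mult_right ai)
  let ?U = "\<lambda>n x. 1 / 2 * (Qf n x - A n x)"
  have U: "conv_to \<mu> (\<lambda>n x. 1 / 2 * (Qf n x / real n - A n x / real n)) (\<lambda>x. 1 / 2 * (1 - 1 / S * h x))"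
    by (intro conv_to_scale[OF _ tendsto_const] conv_to_diff Qf_average A)
  then have "conv_to \<mu> (\<lambda>n x. ?U n x / real n) (\<lambda>x. 1 / 2 * (1 - 1 / S * h x))"
    by (simp only: diff_divide_distrib[symmetric] times_divide_eq_right)
  from conv_to_average_Suc[OF this]
  have 1: "conv_to \<mu> (\<lambda>n x. ?U (Suc n) x / real n) (\<lambda>x. 1 / 2 * (1 - 1 / S * h x))" .
  have "conv_to \<mu> (\<lambda>n x. 1 / real n * ?U 2 x) (\<lambda>x. 0 * ?U 2 x)"
    by (intro conv_to_scale[OF conv_to_self] lim_const_over_n) (use Qf_integrable Ai in auto)
  from conv_to_diff[OF 1 this]
  have 2: "conv_to \<mu> (\<lambda>n x. ?U (Suc n) x / real n - 1 / real n * ?U 2 x) (\<lambda>x. 1 / 2 * (1 - 1 / S * h x))" by simp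
  let ?l = "\<lambda>n x. ln (gauss_density r n x / gauss_density r n (shift x))"
  have l: "?l n x = ?U (Suc n) x - ?U n x" for n x
    unfolding ln_density_ratio by (simp add: Qf_def A_def field_simps)
  have "conv_to \<mu> (\<lambda>N x. 1 / real N * (\<Sum>n\<in>{2..N}. ?l n x)) (\<lambda>x. 1 / 2 * (1 - 1 / S * h x))"
  proof (rule conv_to_eventually[OF 2, where ?n0.0 = 1])
    show "integrable \<mu> (\<lambda>x. 1 / real N * (\<Sum>n\<in>{2..N}. ?l n x))" for N
      unfolding l using Qf_integrable Ai
      by (intro integrable_mult_right Bochner_Integration.integrable_sum Bochner_Integration.integrable_diff) auto
    fix N :: nat and x assume N: "1 \<le> N"
    \<comment> \<open>Telescoping. At N = 1 the sum is empty and the right side is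
      \<open>?U 2 x - ?U 2 x\<close>, so the induction can start there.\<close>
    have "(\<Sum>n\<in>{2..N}. ?l n x) = ?U (Suc N) x - ?U 2 x"
      unfolding l using N
    proof (induction N rule: dec_induct)
      case (step n)
      then show ?case by simp
    qed (simp add: numeral_2_eq_2)
    then show "1 / real N * (\<Sum>n\<in>{2..N}. ?l n x) = ?U (Suc N) x / real N - 1 / real N * ?U 2 x"
      by (simp add: diff_divide_distrib)
  qed
  then show ?thesis by (rule that)
qed

end


section \<open>Projections, entropy and the spectral measure\<close>

lemma square_integrable_mult:
  assumes "f \<in> square_integrable M" "g \<in> square_integrable M"
  shows "integrable M (\<lambda>x. f x * g x)"
proof -
  have [measurable]: "f \<in> borel_measurable M" "g \<in> borel_measurable M"
    and i: "integrable M (\<lambda>x. (f x)\<^sup>2)" "integrable M (\<lambda>x. (g x)\<^sup>2)"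
    using assms by (auto simp: square_integrable_def)
  have le: "\<bar>a * b\<bar> \<le> a\<^sup>2 + b\<^sup>2" for a b :: real
  proof -
    have "2 * (\<bar>a\<bar> * \<bar>b\<bar>) \<le> \<bar>a\<bar>\<^sup>2 + \<bar>b\<bar>\<^sup>2" using sum_squares_bound[of "\<bar>a\<bar>" "\<bar>b\<bar>"] by (simp add: mult.assoc)
    moreover have "0 \<le> \<bar>a\<bar> * \<bar>b\<bar>" by simp
    ultimately show ?thesis unfolding abs_mult power2_abs by linarith
  qed
  show ?thesis
    by (rule Bochner_Integration.integrable_bound[OF Bochner_Integration.integrable_add[OF i]]) (use le in auto)
qed

text \<open>Comparison with \<open>max (u k) B\<close>, which converges to \<open>B\<close>; \<open>conv_to_mean\<close> is applied over a
  one-point space.\<close>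

lemma mean_at_bot:
  fixes u :: "nat \<Rightarrow> real"
  assumes "filterlim u at_bot sequentially"
  shows "filterlim (\<lambda>n. (\<Sum>k<n. u k) / real n) at_bot sequentially"
  unfolding filterlim_at_bot_dense
proof
  fix Z :: real
  define B where "B = Z - 1"
  have ps: "prob_space (return (count_space UNIV) ())" by (rule prob_space_return) simp
  have "\<forall>\<^sub>F k in sequentially. u k < B" using assms unfolding filterlim_at_bot_dense by blast
  then have "(\<lambda>k. max (u k) B) \<longlonglongrightarrow> B"
    by (intro tendsto_eventually) (auto elim!: eventually_mono)
  then have "conv_to (return (count_space UNIV) ()) (\<lambda>k x. max (u k) B) (\<lambda>x. B)"
    by (rule conv_to_const[OF ps])
  from conv_to_mean[OF this] have "(\<lambda>n. (\<Sum>k<n. max (u k) B) / real n) \<longlonglongrightarrow> B"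
    by (auto simp: conv_to_def AE_return)
  then have "\<forall>\<^sub>F n in sequentially. (\<Sum>k<n. max (u k) B) / real n < Z"
    by (rule order_tendstoD(2)) (simp add: B_def)
  then show "\<forall>\<^sub>F n in sequentially. (\<Sum>k<n. u k) / real n < Z"
  proof eventually_elim
    case (elim n)
    have "(\<Sum>k<n. u k) / real n \<le> (\<Sum>k<n. max (u k) B) / real n"
      by (intro divide_right_mono sum_mono) auto
    with elim show ?case by linarith
  qed
qed

lemma ext_ln_sqrt: "0 \<le> s \<Longrightarrow> ext_ln (sqrt s) = ereal (1/2) * ext_ln s"
  by (auto simp: ext_ln_def ln_sqrt)

lemma shift_funpow: "(shift ^^ m) x = pull (\<lambda>i. i + int m) x"
  by (induction m) (auto simp: shift_def pull_def fun_eq_iff algebra_simps)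

lemma the_inv_shift: "the_inv shift x = pull (\<lambda>i. i - 1) x"
proof -
  have "inj shift"
  proof (rule injI)
    fix x y :: "int \<Rightarrow> real" assume "shift x = shift y"
    then have "shift x (n - 1) = shift y (n - 1)" for n by simp
    then show "x = y" by (auto simp: shift_def)
  qed
  moreover have "shift (pull (\<lambda>i. i - 1) x) = x" by (simp add: shift_def pull_def)
  ultimately show ?thesis by (metis the_inv_f_f)
qed

lemma the_inv_shift_funpow: "(the_inv shift ^^ m) x = pull (\<lambda>i. i - int m) x"
proof (induction m)
  case (Suc m)
  then show ?case by (simp add: the_inv_shift pull_def algebra_simps)
qed (simp add: pull_def)

lemma minus_int_image: "{- int n..-1} = (\<lambda>i. - int i) ` {1..n}"
proof (intro equalityI subsetI)
  fix k assume "k \<in> {- int n..-1}"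
  then show "k \<in> (\<lambda>i. - int i) ` {1..n}" by (intro image_eqI[of _ _ "nat (- k)"]) auto
qed auto

lemma distr_funpow:
  assumes "f \<in> M \<rightarrow>\<^sub>M M" "distr M M f = M"
  shows "f ^^ m \<in> M \<rightarrow>\<^sub>M M \<and> distr M M (f ^^ m) = M"
proof (induction m)
  case 0
  then show ?case by (simp add: id_def distr_id[unfolded id_def])
next
  case (Suc m)
  have "distr M M (f ^^ Suc m) = distr (distr M M (f ^^ m)) M f"
    using Suc assms by (subst distr_distr) auto
  then show ?case using Suc assms by (auto intro: measurable_compose simp: comp_def)
qed

context gaussian_seq
begin

section \<open>Abstract projections and finite residuals\<close>

lemma span_square_integrable: "Y \<in> coord_span I \<Longrightarrow> Y \<in> square_integrable \<mu>"
  using measurable_span span_integrable_square[OF span_W] by (simp add: square_integrable_def)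

lemma span_closed: "Y \<in> coord_span I \<Longrightarrow> Y \<in> closed_coord_span \<mu> I"
proof -
  assume Y: "Y \<in> coord_span I"
  have "norm2 \<mu> (\<lambda>x. Y x - Y x) = 0" by (simp add: norm2_def)
  then have "\<forall>e>0. \<exists>g\<in>coord_span I. norm2 \<mu> (\<lambda>x. Y x - g x) < e" using Y by (intro allI impI bexI[of _ Y]) auto
  then show ?thesis using span_square_integrable[OF Y] by (simp add: closed_coord_span_def)
qed

text \<open>\<open>T (coord 0)\<close> is a limit of linear combinations and need not lie in
  \<open>W\<close>, so the rules for \<open>ip\<close> on \<open>W\<close> do not apply to it. The
  cross terms vanish by the defining orthogonality, tested on \<open>T (coord 0)\<close> itself and
  on Y.\<close>

lemma projection_pythagoras:
  assumes T: "is_orth_projection \<mu> (closed_coord_span \<mu> I) T" and Y: "Y \<in> coord_span I"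
  shows "integrable \<mu> (\<lambda>x. (T (coord 0) x - Y x)\<^sup>2)"
    and "ip (\<lambda>x. coord 0 x - Y x) (\<lambda>x. coord 0 x - Y x) =
      (\<integral>x. (coord 0 x - T (coord 0) x)\<^sup>2 \<partial>\<mu>) + (\<integral>x. (T (coord 0) x - Y x)\<^sup>2 \<partial>\<mu>)"
proof -
  let ?c = "coord 0" and ?g = "T (coord 0)"
  have c: "?c \<in> square_integrable \<mu>" by (rule span_square_integrable[OF coord_W])
  have Ys: "Y \<in> square_integrable \<mu>" by (rule span_square_integrable[OF Y])
  have g: "?g \<in> closed_coord_span \<mu> I" and o: "\<And>h. h \<in> closed_coord_span \<mu> I \<Longrightarrow> (\<integral>x. (?c x - ?g x) * h x \<partial>\<mu>) = 0"
    using T c by (auto simp: is_orth_projection_def)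
  have gs: "?g \<in> square_integrable \<mu>" using g by (simp add: closed_coord_span_def)
  note i = square_integrable_mult[OF c c] square_integrable_mult[OF c gs] square_integrable_mult[OF c Ys]
    square_integrable_mult[OF gs gs] square_integrable_mult[OF gs Ys] square_integrable_mult[OF Ys Ys]
  have i1: "integrable \<mu> (\<lambda>x. (?c x - ?g x) * ?g x)" "integrable \<mu> (\<lambda>x. (?c x - ?g x) * Y x)"
    using i by (auto simp: left_diff_distrib)
  have "(\<lambda>x. (?c x - ?g x)\<^sup>2) = (\<lambda>x. ?c x * ?c x - 2 * (?c x * ?g x) + ?g x * ?g x)"
    "(\<lambda>x. (?g x - Y x)\<^sup>2) = (\<lambda>x. ?g x * ?g x - 2 * (?g x * Y x) + Y x * Y x)"
    by (auto simp: power2_eq_square algebra_simps)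
  then have i2: "integrable \<mu> (\<lambda>x. (?c x - ?g x)\<^sup>2)" "integrable \<mu> (\<lambda>x. (?g x - Y x)\<^sup>2)"
    using i by auto
  then show "integrable \<mu> (\<lambda>x. (?g x - Y x)\<^sup>2)" by simp
  have "ip (\<lambda>x. ?c x - Y x) (\<lambda>x. ?c x - Y x) =
    (\<integral>x. (?c x - ?g x)\<^sup>2 + (?g x - Y x)\<^sup>2 + 2 * ((?c x - ?g x) * ?g x) - 2 * ((?c x - ?g x) * Y x) \<partial>\<mu>)"
    unfolding ip_def by (intro Bochner_Integration.integral_cong refl) (simp add: power2_eq_square algebra_simps)
  also have "\<dots> = (\<integral>x. (?c x - ?g x)\<^sup>2 \<partial>\<mu>) + (\<integral>x. (?g x - Y x)\<^sup>2 \<partial>\<mu>)"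
    using i1 i2 o[OF g] o[OF span_closed[OF Y]] by simp
  finally show "ip (\<lambda>x. ?c x - Y x) (\<lambda>x. ?c x - Y x) =
    (\<integral>x. (?c x - ?g x)\<^sup>2 \<partial>\<mu>) + (\<integral>x. (?g x - Y x)\<^sup>2 \<partial>\<mu>)" .
qed

lemma projection_approx:
  assumes T: "is_orth_projection \<mu> (closed_coord_span \<mu> I) T" and e: "0 < e"
  obtains Y where "Y \<in> coord_span I" "(\<integral>x. (T (coord 0) x - Y x)\<^sup>2 \<partial>\<mu>) < e"
proof -
  have "T (coord 0) \<in> closed_coord_span \<mu> I"
    using T span_square_integrable[OF coord_W] by (simp add: is_orth_projection_def)
  then have "\<exists>Y\<in>coord_span I. norm2 \<mu> (\<lambda>x. T (coord 0) x - Y x) < sqrt e"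
    using e by (simp add: closed_coord_span_def)
  then obtain Y where "Y \<in> coord_span I" "norm2 \<mu> (\<lambda>x. T (coord 0) x - Y x) < sqrt e" by blast
  then show ?thesis using that by (simp add: norm2_def)
qed

text \<open>Closedness of a finite span is not invoked. The residual has minimal norm over the span,
  and elements of the span come arbitrarily close to \<open>T (coord 0)\<close>, so the two
  predictions are at distance 0. Equality is almost everywhere because T only chooses a
  representative.\<close>

lemma projection_finite:
  assumes T: "is_orth_projection \<mu> (closed_coord_span \<mu> I) T" and I: "finite I"
  shows "AE x in \<mu>. coord 0 x - T (coord 0) x = res 0 I x"
proof -
  let ?Y = "\<lambda>x. coord 0 x - res 0 I x"
  have Y: "?Y \<in> coord_span I" by (rule coord_minus_res[OF I])
  note P0 = projection_pythagoras[OF T Y]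
  have "(\<integral>x. (T (coord 0) x - ?Y x)\<^sup>2 \<partial>\<mu>) \<le> e" if e: "0 < e" for e
  proof -
    obtain Z where Z: "Z \<in> coord_span I" "(\<integral>x. (T (coord 0) x - Z x)\<^sup>2 \<partial>\<mu>) < e"
      by (rule projection_approx[OF T e])
    have "ip (res 0 I) (res 0 I) \<le> ip (\<lambda>x. coord 0 x - Z x) (\<lambda>x. coord 0 x - Z x)"
      by (rule res_minimal[OF I Z(1)])
    moreover have "ip (\<lambda>x. coord 0 x - ?Y x) (\<lambda>x. coord 0 x - ?Y x) = ip (res 0 I) (res 0 I)" by simp
    ultimately show ?thesis using P0(2) projection_pythagoras(2)[OF T Z(1)] Z(2) by linarith
  qed
  then have "(\<integral>x. (T (coord 0) x - ?Y x)\<^sup>2 \<partial>\<mu>) \<le> 0" by (rule field_le_epsilon[of _ 0, simplified])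
  moreover have "0 \<le> (\<integral>x. (T (coord 0) x - ?Y x)\<^sup>2 \<partial>\<mu>)" by simp
  ultimately have "(\<integral>x. (T (coord 0) x - ?Y x)\<^sup>2 \<partial>\<mu>) = 0" by linarith
  then have "AE x in \<mu>. (T (coord 0) x - ?Y x)\<^sup>2 = 0"
    using integral_nonneg_eq_0_iff_AE[OF P0(1)] by simp
  then show ?thesis by eventually_elim simp
qed

lemma projection_measurable:
  assumes T: "is_orth_projection \<mu> (closed_coord_span \<mu> I) T"
  shows "(\<lambda>x. coord 0 x - T (coord 0) x) \<in> borel_measurable \<mu>"
proof -
  have "T (coord 0) \<in> closed_coord_span \<mu> I"
    using T span_square_integrable[OF coord_W] by (simp add: is_orth_projection_def)
  then have [measurable]: "T (coord 0) \<in> borel_measurable \<mu>" by (simp add: closed_coord_span_def square_integrable_def)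
  show ?thesis by measurable
qed

text \<open>The error given the whole past is a lower bound for every d_n. An approximation of the
  infinite projection uses finitely many coordinates, so some d_n comes as close to this bound as
  desired, and monotonicity does the rest.\<close>

lemma d_tendsto:
  assumes T: "is_orth_projection \<mu> (closed_coord_span \<mu> {..-1}) T"
  shows "d \<longlonglongrightarrow> (\<integral>x. (coord 0 x - T (coord 0) x)\<^sup>2 \<partial>\<mu>)"
proof (rule order_tendstoI)
  let ?S = "\<integral>x. (coord 0 x - T (coord 0) x)\<^sup>2 \<partial>\<mu>"
  fix a assume a: "a < ?S"
  have "?S \<le> d n" for n
  proof -
    let ?Y = "\<lambda>x. coord 0 x - res 0 {- int n..-1} x"
    have "?Y \<in> coord_span {- int n..-1}" by (rule coord_minus_res) simp
    moreover have "{- int n..-1} \<subseteq> {..-1}" by auto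
    ultimately have "?Y \<in> coord_span {..-1}" using coord_span_mono by blast
    from projection_pythagoras(2)[OF T this]
    have "d n = ?S + (\<integral>x. (T (coord 0) x - ?Y x)\<^sup>2 \<partial>\<mu>)" by (simp add: d_def)
    moreover have "0 \<le> (\<integral>x. (T (coord 0) x - ?Y x)\<^sup>2 \<partial>\<mu>)" by simp
    ultimately show ?thesis by linarith
  qed
  then show "\<forall>\<^sub>F n in sequentially. a < d n" using a by (intro always_eventually allI) (rule less_le_trans)
next
  let ?S = "\<integral>x. (coord 0 x - T (coord 0) x)\<^sup>2 \<partial>\<mu>"
  fix a assume a: "?S < a"
  then have "0 < a - ?S" by simp
  then obtain Y where Y: "Y \<in> coord_span {..-1}" "(\<integral>x. (T (coord 0) x - Y x)\<^sup>2 \<partial>\<mu>) < a - ?S"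
    by (rule projection_approx[OF T])
  obtain K c where K: "finite K" "K \<subseteq> {..-1}" "Y = (\<lambda>x. \<Sum>k\<in>K. c k * coord k x)"
    using Y(1) unfolding coord_span_def by blast
  obtain n where n: "K \<subseteq> {- int n..-1}"
  proof
    \<comment> \<open>\<open>Min\<close> is unspecified for empty K, but then the inclusion is
      trivial.\<close>
    show "K \<subseteq> {- int (nat (- Min K))..-1}"
    proof
      fix k assume k: "k \<in> K"
      then have "Min K \<le> k" "k \<le> -1" using K by auto
      then show "k \<in> {- int (nat (- Min K))..-1}" by auto
    qed
  qed
  have Yn: "Y \<in> coord_span {- int n..-1}" by (rule coord_spanI[OF K(1) n K(3)])
  have "d n \<le> ip (\<lambda>x. coord 0 x - Y x) (\<lambda>x. coord 0 x - Y x)"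
    unfolding d_def by (rule res_minimal[OF _ Yn]) simp
  also have "\<dots> < a" using projection_pythagoras(2)[OF T Y(1)] Y(2) by linarith
  finally have "d n < a" .
  then have "d m < a" if "n \<le> m" for m using d_antimono[OF that] by linarith
  then show "\<forall>\<^sub>F m in sequentially. d m < a" unfolding eventually_sequentially by blast
qed

section \<open>The entropy limit\<close>

lemma entropy_limit:
  assumes lim: "d \<longlonglongrightarrow> S" and S: "0 \<le> S"
  shows "(\<lambda>n. ereal (block_entropy \<mu> r n / real n)) \<longlonglongrightarrow>
    ereal (1/2 * ln (2 * pi)) + ereal (1/2) * ext_ln S + ereal (1/2)"
proof -
  let ?m = "\<lambda>n. (\<Sum>k<n. ln (d k)) / real n"
  have m: "(\<lambda>n. ereal (?m n)) \<longlonglongrightarrow> ext_ln S"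
  proof (cases "S = 0")
    case True
    have "filterlim (\<lambda>n. ln (d n)) at_bot sequentially"
      by (rule filterlim_compose[OF ln_at_0]) (use lim True d_pos in \<open>auto simp: filterlim_at\<close>)
    from mean_at_bot[OF this] have "filterlim ?m at_bot sequentially" .
    then have "(\<lambda>n. ereal (?m n)) \<longlonglongrightarrow> - \<infinity>" by (simp add: tendsto_MInfty filterlim_at_bot_dense)
    then show ?thesis using True by (simp add: ext_ln_def)
  next
    case False
    then have "(\<lambda>k. ln (d k)) \<longlonglongrightarrow> ln S" by (intro tendsto_ln lim)
    then have "conv_to \<mu> (\<lambda>k x. ln (d k)) (\<lambda>x. ln S)" by (rule conv_to_const[OF \<mu>_prob])
    from conv_to_mean[OF this] have "?m \<longlonglongrightarrow> ln S" by (auto simp: conv_to_def)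
    then show ?thesis using False by (simp add: ext_ln_def)
  qed
  have "(\<lambda>n. ereal (1/2 * ln (2 * pi)) + ereal (1/2) * ereal (?m n) + ereal (1/2)) \<longlonglongrightarrow>
    ereal (1/2 * ln (2 * pi)) + ereal (1/2) * ext_ln S + ereal (1/2)"
    by (intro tendsto_add_ereal_general1 tendsto_add_ereal_general2 tendsto_cmult_ereal tendsto_const m) auto
  moreover have "\<forall>\<^sub>F n in sequentially. ereal (1/2 * ln (2 * pi)) + ereal (1/2) * ereal (?m n) + ereal (1/2) =
    ereal (block_entropy \<mu> r n / real n)"
    unfolding eventually_sequentially
  proof (intro exI[of _ 1] allI impI)
    fix n :: nat assume "1 \<le> n"
    then show "ereal (1/2 * ln (2 * pi)) + ereal (1/2) * ereal (?m n) + ereal (1/2) = ereal (block_entropy \<mu> r n / real n)"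
      by (simp add: block_entropy_eq info_const_def add_divide_distrib)
  qed
  ultimately show ?thesis by (rule Lim_transform_eventually)
qed

section \<open>The spectral isometry\<close>

lemma ip_sum_sum:
  "ip (\<lambda>x. \<Sum>i\<in>A. a i * coord (g i) x) (\<lambda>x. \<Sum>j\<in>A. b j * coord (g j) x) =
    (\<Sum>i\<in>A. \<Sum>j\<in>A. a i * b j * r (g i - g j))" if "finite A"
proof -
  have W: "(\<lambda>x. \<Sum>j\<in>A. b j * coord (g j) x) \<in> W" for b :: "'a \<Rightarrow> real"
    using that
  proof (induction A rule: finite_induct)
    case (insert k A)
    then show ?case by (simp add: coord_span_add coord_span_scale)
  qed (simp add: coord_span_zero)
  have "ip (\<lambda>x. \<Sum>i\<in>A. a i * coord (g i) x) (\<lambda>x. \<Sum>j\<in>A. b j * coord (g j) x) =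
    (\<Sum>i\<in>A. a i * ip (\<lambda>x. \<Sum>j\<in>A. b j * coord (g j) x) (coord (g i)))"
    unfolding ip_sum_left[OF W] by (simp only: ip_commute)
  also have "\<dots> = (\<Sum>i\<in>A. a i * (\<Sum>j\<in>A. b j * r (g j - g i)))"
    by (simp only: ip_sum_left[OF coord_W] ip_coord)
  also have "\<dots> = (\<Sum>i\<in>A. \<Sum>j\<in>A. a i * b j * r (g i - g j))"
  proof -
    have "r (j - i) = r (i - j)" for i j using r_sym[of "i - j"] by simp
    then show ?thesis by (simp add: sum_distrib_left mult.assoc)
  qed
  finally show ?thesis .
qed

text \<open>On the circle \<open>cnj z\<close> is the inverse of z, so the squared modulus is a
  combination of the powers z^(i-j), which integrate to covariances. This is the isometry that takes
  z^i to X_(-i).\<close>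

lemma spectral_quadratic_form:
  assumes \<nu>: "is_spectral_measure r \<nu>"
  shows "(\<integral>z. (cmod (\<Sum>i\<le>n. c i * z ^ i))\<^sup>2 \<partial>\<nu>) =
    (\<Sum>i\<le>n. \<Sum>j\<le>n. Re (c i * cnj (c j)) * r (int i - int j))"
proof -
  have fin: "finite_measure \<nu>" and sets: "sets \<nu> = sets circle_lebesgue"
    and F: "\<And>n. fourier_coeff \<nu> n = complex_of_real (r n)"
    using \<nu> by (auto simp: is_spectral_measure_def)
  have sp: "space \<nu> = circle" using sets_eq_imp_space_eq[OF sets] by simp
  have int: "integrable \<nu> (\<lambda>z. z powi k)" for k
    by (intro integrable_circle_continuous fin sets continuous_intros) auto
  \<comment> \<open>\<open>fourier_coeff\<close> integrates z^(-n), so the coefficient at j - i is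
    used; r is even.\<close>
  have val: "(\<integral>z. z powi (int i - int j) \<partial>\<nu>) = complex_of_real (r (int i - int j))" for i j
    using F[of "int j - int i"] r_sym[of "int i - int j"] by (simp add: fourier_coeff_def)
  have pw: "complex_of_real ((cmod (\<Sum>i\<le>n. c i * z ^ i))\<^sup>2) =
    (\<Sum>i\<le>n. \<Sum>j\<le>n. c i * cnj (c j) * z powi (int i - int j))" if z: "z \<in> circle" for z
  proof -
    have "cmod z = 1" using z by simp
    then have zz: "z * cnj z = 1" using complex_norm_square[of z] by simp
    then have z0: "z \<noteq> 0" by auto
    have ci: "cnj z = inverse z" using zz z0 by (simp add: field_simps)
    have zij: "z ^ i * cnj z ^ j = z powi (int i - int j)" for i j
      using z0 by (simp add: ci power_int_diff power_inverse divide_inverse)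
    have "complex_of_real ((cmod (\<Sum>i\<le>n. c i * z ^ i))\<^sup>2) = (\<Sum>i\<le>n. c i * z ^ i) * (\<Sum>j\<le>n. cnj (c j) * cnj z ^ j)"
      by (simp only: complex_norm_square cnj_sum complex_cnj_mult complex_cnj_power)
    also have "\<dots> = (\<Sum>i\<le>n. \<Sum>j\<le>n. c i * cnj (c j) * (z ^ i * cnj z ^ j))"
      unfolding sum_product by (intro sum.cong refl) (simp only: mult_ac)
    finally show ?thesis by (simp only: zij)
  qed
  have "complex_of_real (\<integral>z. (cmod (\<Sum>i\<le>n. c i * z ^ i))\<^sup>2 \<partial>\<nu>) =
    (\<integral>z. complex_of_real ((cmod (\<Sum>i\<le>n. c i * z ^ i))\<^sup>2) \<partial>\<nu>)"
    by (rule integral_complex_of_real[symmetric])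
  also have "\<dots> = (\<integral>z. (\<Sum>i\<le>n. \<Sum>j\<le>n. c i * cnj (c j) * z powi (int i - int j)) \<partial>\<nu>)"
    by (rule Bochner_Integration.integral_cong[OF refl]) (simp only: pw sp)
  also have "\<dots> = (\<Sum>i\<le>n. \<Sum>j\<le>n. c i * cnj (c j) * complex_of_real (r (int i - int j)))"
    using int by (simp add: Bochner_Integration.integral_sum val)
  finally have "Re (complex_of_real (\<integral>z. (cmod (\<Sum>i\<le>n. c i * z ^ i))\<^sup>2 \<partial>\<nu>)) =
    Re (\<Sum>i\<le>n. \<Sum>j\<le>n. c i * cnj (c j) * complex_of_real (r (int i - int j)))" by simp
  also have "\<dots> = (\<Sum>i\<le>n. \<Sum>j\<le>n. Re (c i * cnj (c j)) * r (int i - int j))"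
    unfolding Re_sum by (intro sum.cong refl) (simp add: algebra_simps)
  finally show ?thesis by simp
qed

text \<open>Complex coefficients do not improve on real ones: r is real and even, so the form splits
  into those of the real and of the imaginary parts, and the latter is nonnegative. The real parts
  describe X_0 minus a combination of X_(-1), ..., X_(-n), with n the degree, whose squared norm is
  at least d_n.\<close>

lemma spectral_lower:
  assumes \<nu>: "is_spectral_measure r \<nu>" and p: "poly p 0 = 1" and S: "\<And>n. S \<le> d n"
  shows "S \<le> (\<integral>z. (cmod (poly p z))\<^sup>2 \<partial>\<nu>)"
proof -
  let ?n = "degree p" and ?c = "coeff p"
  let ?Y = "\<lambda>a x. \<Sum>i\<le>?n. a i * coord (- int i) x"
  have ipY: "ip (?Y a) (?Y a) = (\<Sum>i\<le>?n. \<Sum>j\<le>?n. a i * a j * r (int i - int j))" for a :: "nat \<Rightarrow> real"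
  proof -
    have "r (int j - int i) = r (int i - int j)" for i j using r_sym[of "int i - int j"] by simp
    then show ?thesis by (subst ip_sum_sum) simp_all
  qed
  have "(\<integral>z. (cmod (poly p z))\<^sup>2 \<partial>\<nu>) = (\<Sum>i\<le>?n. \<Sum>j\<le>?n. Re (?c i * cnj (?c j)) * r (int i - int j))"
    unfolding poly_altdef by (rule spectral_quadratic_form[OF \<nu>])
  also have "\<dots> = ip (?Y (\<lambda>i. Re (?c i))) (?Y (\<lambda>i. Re (?c i))) + ip (?Y (\<lambda>i. Im (?c i))) (?Y (\<lambda>i. Im (?c i)))"
    unfolding ipY sum.distrib[symmetric] by (intro sum.cong refl) (simp add: distrib_right)
  also have "\<dots> \<ge> ip (?Y (\<lambda>i. Re (?c i))) (?Y (\<lambda>i. Re (?c i)))" using ip_nonneg by simp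
  finally have 1: "ip (?Y (\<lambda>i. Re (?c i))) (?Y (\<lambda>i. Re (?c i))) \<le> (\<integral>z. (cmod (poly p z))\<^sup>2 \<partial>\<nu>)" .
  have c0: "Re (?c 0) = 1" using p by (simp add: poly_0_coeff_0)
  let ?Z = "\<lambda>x. \<Sum>k\<in>{- int ?n..-1}. - Re (?c (nat (- k))) * coord k x"
  have Z: "?Z \<in> coord_span {- int ?n..-1}"
    by (rule coord_spanI[of "{- int ?n..-1}" _ _ "\<lambda>k. - Re (?c (nat (- k)))"]) auto
  have YZ: "?Y (\<lambda>i. Re (?c i)) = (\<lambda>x. coord 0 x - ?Z x)"
  proof
    fix x
    have im: "{- int ?n..-1} = (\<lambda>i. - int i) ` {1..?n}" by (rule minus_int_image)
    have "{..?n} = insert 0 {1..?n}" by auto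
    then have "?Y (\<lambda>i. Re (?c i)) x = coord 0 x + (\<Sum>i\<in>{1..?n}. Re (?c i) * coord (- int i) x)"
      using c0 by simp
    moreover have "?Z x = (\<Sum>i\<in>{1..?n}. - Re (?c i) * coord (- int i) x)"
      unfolding im by (subst sum.reindex) (auto simp: inj_on_def)
    ultimately show "?Y (\<lambda>i. Re (?c i)) x = coord 0 x - ?Z x" by (simp add: sum_negf)
  qed
  have "d ?n \<le> ip (?Y (\<lambda>i. Re (?c i))) (?Y (\<lambda>i. Re (?c i)))"
    unfolding d_def YZ by (rule res_minimal[OF _ Z]) simp
  with 1 S[of ?n] show ?thesis by linarith
qed

text \<open>The polynomial is the residual of X_0 with z^i in place of X_(-i); its constant term is
  1 because X_0 enters its own residual with coefficient 1.\<close>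

lemma spectral_upper:
  assumes \<nu>: "is_spectral_measure r \<nu>"
  shows "\<exists>p. poly p 0 = 1 \<and> (\<integral>z. (cmod (poly p z))\<^sup>2 \<partial>\<nu>) = d n"
proof -
  let ?R = "res 0 {- int n..-1}"
  define a where "a i = ?R (unit_seq (- int i))" for i
  have "{..n} = insert 0 {1..n}" by auto
  then have ins: "insert 0 {- int n..-1} = (\<lambda>i. - int i) ` {..n}" by (simp add: minus_int_image)
  have R: "?R = (\<lambda>x. \<Sum>i\<le>n. a i * coord (- int i) x)"
  proof
    fix x
    have "?R x = (\<Sum>k\<in>insert 0 {- int n..-1}. ?R (unit_seq k) * coord k x)"
      by (rule coord_span_expand[OF res_span]) auto
    then show "?R x = (\<Sum>i\<le>n. a i * coord (- int i) x)"
      unfolding ins by (subst (asm) sum.reindex) (auto simp: inj_on_def a_def)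
  qed
  have a0: "a 0 = 1"
  proof -
    have "(\<lambda>x. coord 0 x - ?R x) \<in> coord_span {- int n..-1}" by (rule coord_minus_res) simp
    from coord_span_unit_seq_notin[OF this, of 0] show ?thesis by (simp add: coord_unit_seq a_def)
  qed
  define p where "p = (\<Sum>i\<le>n. Polynomial.monom (complex_of_real (a i)) i)"
  have pz: "poly p z = (\<Sum>i\<le>n. complex_of_real (a i) * z ^ i)" for z
    by (simp add: p_def poly_sum poly_monom)
  have "poly p 0 = (\<Sum>i\<le>n. if i = 0 then complex_of_real (a i) else 0)"
    unfolding pz by (intro sum.cong) (auto simp: power_0_left)
  then have "poly p 0 = 1" using a0 by simp
  moreover have "(\<integral>z. (cmod (poly p z))\<^sup>2 \<partial>\<nu>) = d n"
  proof -
    have sw: "r (int j - int i) = r (int i - int j)" for i j using r_sym[of "int i - int j"] by simp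
    have "(\<integral>z. (cmod (poly p z))\<^sup>2 \<partial>\<nu>) = (\<Sum>i\<le>n. \<Sum>j\<le>n. a i * a j * r (int i - int j))"
      unfolding pz spectral_quadratic_form[OF \<nu>] by simp
    also have "\<dots> = ip (\<lambda>x. \<Sum>i\<le>n. a i * coord (- int i) x) (\<lambda>x. \<Sum>i\<le>n. a i * coord (- int i) x)"
      by (subst ip_sum_sum) (simp_all add: sw)
    also have "\<dots> = d n" unfolding d_def R[symmetric] ..
    finally show ?thesis .
  qed
  ultimately show ?thesis by blast
qed

lemma szego_innovation:
  assumes \<nu>: "is_spectral_measure r \<nu>" and f: "is_ac_density circle_lebesgue \<nu> f" and lim: "d \<longlonglongrightarrow> S"
  shows "ext_integral circle_lebesgue (\<lambda>z. ext_ln (f z)) = ext_ln S"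
proof (rule szego[OF _ _ f])
  show "finite_measure \<nu>" "sets \<nu> = sets circle_lebesgue" using \<nu> by (auto simp: is_spectral_measure_def)
  have dS: "S \<le> d i" for i
    by (rule LIMSEQ_le_const2[OF lim]) (auto intro: exI[of _ i] d_antimono)
  show "S \<le> (\<integral>z. (cmod (poly p z))\<^sup>2 \<partial>\<nu>)" if "poly p 0 = 1" for p
    by (rule spectral_lower[OF \<nu> that dS])
  show "\<exists>p. poly p 0 = 1 \<and> (\<integral>z. (cmod (poly p z))\<^sup>2 \<partial>\<nu>) < S + e" if "0 < e" for e
  proof -
    have "\<forall>\<^sub>F n in sequentially. d n < S + e" by (rule order_tendstoD(2)[OF lim]) (use that in simp)
    then obtain n where n: "d n < S + e" by (auto simp: eventually_sequentially)
    obtain p where "poly p 0 = 1" "(\<integral>z. (cmod (poly p z))\<^sup>2 \<partial>\<nu>) = d n" using spectral_upper[OF \<nu>, of n] by blast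
    then show ?thesis using n by (intro exI[of _ p]) simp
  qed
qed

section \<open>Averages along powers of the shift\<close>

lemma shift_preserving: "shift \<in> \<mu> \<rightarrow>\<^sub>M \<mu>" "distr \<mu> \<mu> shift = \<mu>"
  using \<mu>_inv by (auto simp: shift_invariant_def)

lemma the_inv_shift_preserving: "the_inv shift \<in> \<mu> \<rightarrow>\<^sub>M \<mu>" "distr \<mu> \<mu> (the_inv shift) = \<mu>"
proof -
  have "(\<lambda>x i. x (i - 1)) \<in> seq_space \<rightarrow>\<^sub>M seq_space"
    unfolding seq_space_def by (rule measurable_PiM_single') (auto simp: space_PiM)
  moreover have "the_inv shift = (\<lambda>x i. x (i - 1))" by (simp add: fun_eq_iff the_inv_shift pull_def)
  ultimately show m: "the_inv shift \<in> \<mu> \<rightarrow>\<^sub>M \<mu>" by (simp add: measurable_cong_sets[OF \<mu>_sets \<mu>_sets])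
  have "the_inv shift \<circ> shift = (\<lambda>x. x)" by (simp add: fun_eq_iff the_inv_shift shift_def pull_def)
  then have "distr (distr \<mu> \<mu> shift) \<mu> (the_inv shift) = \<mu>"
    by (subst distr_distr[OF m shift_preserving(1)]) (simp add: distr_id[unfolded id_def])
  then show "distr \<mu> \<mu> (the_inv shift) = \<mu>" unfolding shift_preserving(2) .
qed

text \<open>\<open>R\<close> stands for the pointwise residual and \<open>G\<close> for the one
  given by a projection, equal to it only almost everywhere. A measure-preserving
  \<open>\<phi> N j\<close> pulls null sets back to null sets, and each N involves finitely many
  j.\<close>

lemma transfer_average:
  assumes conv: "conv_to \<mu> (\<lambda>N x. 1 / real N * (\<Sum>j\<in>{1..N-1}. (e N j x)\<^sup>2)) h"
    and G: "\<And>j. 1 \<le> j \<Longrightarrow> AE y in \<mu>. G j y = R j y" "\<And>j. 1 \<le> j \<Longrightarrow> G j \<in> borel_measurable \<mu>"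
    and \<phi>: "\<And>N j. \<phi> N j \<in> \<mu> \<rightarrow>\<^sub>M \<mu>" "\<And>N j. distr \<mu> \<mu> (\<phi> N j) = \<mu>"
    and R: "\<And>N j x. 1 \<le> j \<Longrightarrow> j \<le> N - 1 \<Longrightarrow> R j (\<phi> N j x) = e N j x"
  shows "conv_to \<mu> (\<lambda>N x. 1 / real N * (\<Sum>j\<in>{1..N-1}. (G j (\<phi> N j x))\<^sup>2)) h"
proof (rule conv_to_cong[OF conv])
  fix N
  have "AE x in \<mu>. G j (\<phi> N j x) = e N j x" if j: "j \<in> {1..N-1}" for j
  proof -
    have "AE y in distr \<mu> \<mu> (\<phi> N j). G j y = R j y" using G(1)[of j] j unfolding \<phi>(2) by simp
    from AE_distrD[OF \<phi>(1) this] show ?thesis using R[of j N] j by auto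
  qed
  then have "AE x in \<mu>. \<forall>j\<in>{1..N-1}. G j (\<phi> N j x) = e N j x" by (intro AE_finite_allI) auto
  then show "AE x in \<mu>. 1 / real N * (\<Sum>j\<in>{1..N-1}. (G j (\<phi> N j x))\<^sup>2) = 1 / real N * (\<Sum>j\<in>{1..N-1}. (e N j x)\<^sup>2)"
    by eventually_elim simp
  have "(\<lambda>x. (G j (\<phi> N j x))\<^sup>2) \<in> borel_measurable \<mu>" if "j \<in> {1..N-1}" for j
    using measurable_compose[OF \<phi>(1) G(2)] that by simp
  then show "(\<lambda>x. 1 / real N * (\<Sum>j\<in>{1..N-1}. (G j (\<phi> N j x))\<^sup>2)) \<in> borel_measurable \<mu>"
    by (intro borel_measurable_times borel_measurable_const borel_measurable_sum)
qed

lemma average_from_1: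
  assumes e: "\<And>k. 1 \<le> k \<Longrightarrow> e k \<in> W" and o: "\<And>j k. 1 \<le> j \<Longrightarrow> j < k \<Longrightarrow> ip (e j) (e k) = 0"
    and v: "\<And>k. 1 \<le> k \<Longrightarrow> ip (e k) (e k) = d (g k)" and lim: "(\<lambda>k. d (g k)) \<longlonglongrightarrow> S"
  shows "conv_to \<mu> (\<lambda>N x. 1 / real N * (\<Sum>j\<in>{1..N-1}. (e j x)\<^sup>2)) (\<lambda>x. S)"
proof -
  \<comment> \<open>The zero function at index 0 turns the sum over \<open>{1..N-1}\<close> into one
    over k < N, the form of the strong law.\<close>
  let ?e = "\<lambda>k. if k = 0 then (\<lambda>x. 0) else e k"
  have "conv_to \<mu> (\<lambda>N x. (\<Sum>k<N. (?e k x)\<^sup>2) / real N) (\<lambda>x. S)"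
  proof (rule slln_orthogonal[where B = "d 0"])
    show "?e k \<in> W" for k using e[of k] coord_span_zero by simp
    show "ip (?e j) (?e k) = 0" if "j < k" for j k using o[of j k] that by simp
    show "(\<lambda>k. ip (?e k) (?e k)) \<longlonglongrightarrow> S"
      by (rule Lim_transform_eventually[OF lim]) (auto simp: eventually_sequentially v intro!: exI[of _ 1])
    show "ip (?e k) (?e k) \<le> d 0" for k using v[of k] d_antimono[of 0 "g k"] d_pos[of 0] by (simp add: less_imp_le)
  qed
  moreover have "(\<Sum>k<N. (?e k x)\<^sup>2) / real N = 1 / real N * (\<Sum>j\<in>{1..N-1}. (e j x)\<^sup>2)" for N x
  proof -
    have "(\<Sum>j\<in>{1..N-1}. (e j x)\<^sup>2) = (\<Sum>k<N. (?e k x)\<^sup>2)"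
      by (rule sum.mono_neutral_cong_left) auto
    then show ?thesis by simp
  qed
  ultimately show ?thesis by simp
qed

text \<open>Composition with powers of the inverse shift keeps the end X_0 of the predicting block
  fixed. The residuals form one orthogonal sequence that does not change with N, which makes (iii)
  simpler than (ii).\<close>

lemma backward_average_fixed:
  assumes lim: "d \<longlonglongrightarrow> S"
  shows "conv_to \<mu> (\<lambda>N x. 1 / real N * (\<Sum>j\<in>{1..N-1}. (res (- int j) {1 - int j..0} x)\<^sup>2)) (\<lambda>x. S)"
proof (rule average_from_1[where g = "\<lambda>k. k", OF _ _ _ lim])
  fix j k :: nat assume jk: "1 \<le> j" "j < k"
  have "insert (- int j) {1 - int j..0} \<subseteq> {1 - int k..0}" using jk by auto
  then have "res (- int j) {1 - int j..0} \<in> coord_span {1 - int k..0}"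
    using res_span[of "{1 - int j..0}" "- int j"] coord_span_mono by blast
  then have "ip (res (- int k) {1 - int k..0}) (res (- int j) {1 - int j..0}) = 0" by (intro res_orthogonal) auto
  then show "ip (res (- int j) {1 - int j..0}) (res (- int k) {1 - int k..0}) = 0" by (simp add: ip_commute)
next
  fix k :: nat
  show "ip (res (- int k) {1 - int k..0}) (res (- int k) {1 - int k..0}) = d k"
    using ip_res_backward[of "- int k" k] by (simp add: algebra_simps)
qed simp

text \<open>Here the left end X_1 is fixed. \<open>Q j\<close> predicts from j - 1 coordinates, so
  the j-th error is \<open>d (j - 1)\<close>; at j = 1 this is the variance of X_0, in accordance
  with Q_1 = 0.\<close>

lemma forward_average:
  assumes lim: "d \<longlonglongrightarrow> S"
  shows "conv_to \<mu> (\<lambda>N x. 1 / real N * (\<Sum>j\<in>{1..N-1}. (res (int j) {1..int j - 1} x)\<^sup>2)) (\<lambda>x. S)"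
proof (rule average_from_1[where g = "\<lambda>k. k - 1"])
  fix j k :: nat assume jk: "1 \<le> j" "j < k"
  have "insert (int j) {1..int j - 1} \<subseteq> {1..int k - 1}" using jk by auto
  then have "res (int j) {1..int j - 1} \<in> coord_span {1..int k - 1}"
    using res_span[of "{1..int j - 1}" "int j"] coord_span_mono by blast
  then have "ip (res (int k) {1..int k - 1}) (res (int j) {1..int j - 1}) = 0" by (intro res_orthogonal) auto
  then show "ip (res (int j) {1..int j - 1}) (res (int k) {1..int k - 1}) = 0" by (simp add: ip_commute)
next
  fix k :: nat assume "1 \<le> k"
  then show "ip (res (int k) {1..int k - 1}) (res (int k) {1..int k - 1}) = d (k - 1)"
    using ip_res_forward[of "int k" "k - 1"] by (simp add: of_nat_diff)
next
  have "(\<lambda>k. d (Suc k - 1)) \<longlonglongrightarrow> S" using lim by simp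
  then show "(\<lambda>k. d (k - 1)) \<longlonglongrightarrow> S" by (rule LIMSEQ_imp_Suc)
qed simp

lemma res_translate_Icc: "res (j + m) {a + m..b + m} x = res j {a..b} (pull (\<lambda>i. i + m) x)"
  using res_translate[of "{a..b}" j m] by (simp add: translate_image)

text \<open>Composition with \<open>shift ^^ (N - j)\<close> carries X_0 to X_(N-j) and the
  predictors X_1, ..., X_j to X_(N-j+1), ..., X_N, which gives \<open>bwd N j\<close>.\<close>

lemma average_ii:
  assumes lim: "d \<longlonglongrightarrow> S" and S: "0 < S"
    and P: "\<And>n. n \<ge> 1 \<Longrightarrow> is_orth_projection \<mu> (closed_coord_span \<mu> {1..int n}) (P n)"
  shows "conv_to \<mu> (\<lambda>N x. 1 / real N * (\<Sum>j\<in>{1..N-1}.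
    (coord 0 ((shift ^^ (N - j)) x) - P j (coord 0) ((shift ^^ (N - j)) x))\<^sup>2)) (\<lambda>x. S)"
proof (rule transfer_average[OF backward_average[OF lim S], where R = "\<lambda>j. res 0 {1..int j}"
    and G = "\<lambda>j y. coord 0 y - P j (coord 0) y" and \<phi> = "\<lambda>N j. shift ^^ (N - j)"])
  show "AE y in \<mu>. coord 0 y - P j (coord 0) y = res 0 {1..int j} y" if "1 \<le> j" for j
    by (rule projection_finite[OF P[OF that]]) simp
  show "(\<lambda>y. coord 0 y - P j (coord 0) y) \<in> borel_measurable \<mu>" if "1 \<le> j" for j
    by (rule projection_measurable[OF P[OF that]])
  show "shift ^^ (N - j) \<in> \<mu> \<rightarrow>\<^sub>M \<mu>" "distr \<mu> \<mu> (shift ^^ (N - j)) = \<mu>" for N j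
    using distr_funpow[OF shift_preserving] by blast+
  show "res 0 {1..int j} ((shift ^^ (N - j)) x) = bwd N j x" if j: "1 \<le> j" "j \<le> N - 1" for N j x
  proof -
    have "1 + int (N - j) = int (N - j) + 1" "int j + int (N - j) = int N" "0 + int (N - j) = int (N - j)" using j by auto
    then show ?thesis using res_translate_Icc[of 0 "int (N - j)" 1 "int j" x] by (simp only: shift_funpow bwd_def)
  qed
qed

lemma average_iii:
  assumes lim: "d \<longlonglongrightarrow> S"
    and P: "\<And>n. n \<ge> 1 \<Longrightarrow> is_orth_projection \<mu> (closed_coord_span \<mu> {1..int n}) (P n)"
  shows "conv_to \<mu> (\<lambda>N x. 1 / real N * (\<Sum>j\<in>{1..N-1}.
    (coord 0 ((the_inv shift ^^ j) x) - P j (coord 0) ((the_inv shift ^^ j) x))\<^sup>2)) (\<lambda>x. S)"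
proof (rule transfer_average[OF backward_average_fixed[OF lim], where R = "\<lambda>j. res 0 {1..int j}"
    and G = "\<lambda>j y. coord 0 y - P j (coord 0) y" and \<phi> = "\<lambda>N j. the_inv shift ^^ j"])
  show "AE y in \<mu>. coord 0 y - P j (coord 0) y = res 0 {1..int j} y" if "1 \<le> j" for j
    by (rule projection_finite[OF P[OF that]]) simp
  show "(\<lambda>y. coord 0 y - P j (coord 0) y) \<in> borel_measurable \<mu>" if "1 \<le> j" for j
    by (rule projection_measurable[OF P[OF that]])
  show "the_inv shift ^^ j \<in> \<mu> \<rightarrow>\<^sub>M \<mu>" "distr \<mu> \<mu> (the_inv shift ^^ j) = \<mu>" for j
    using distr_funpow[OF the_inv_shift_preserving] by blast+
  show "res 0 {1..int j} ((the_inv shift ^^ j) x) = res (- int j) {1 - int j..0} x" for j x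
    using res_translate_Icc[of 0 "- int j" 1 "int j" x] by (simp add: the_inv_shift_funpow)
qed

lemma average_iv:
  assumes lim: "d \<longlonglongrightarrow> S"
    and Q: "\<And>n. n \<ge> 1 \<Longrightarrow> is_orth_projection \<mu> (closed_coord_span \<mu> {- int n + 1..- 1}) (Q n)"
  shows "conv_to \<mu> (\<lambda>N x. 1 / real N * (\<Sum>j\<in>{1..N-1}.
    (coord 0 ((shift ^^ j) x) - Q j (coord 0) ((shift ^^ j) x))\<^sup>2)) (\<lambda>x. S)"
proof (rule transfer_average[OF forward_average[OF lim], where R = "\<lambda>j. res 0 {- int j + 1..-1}"
    and G = "\<lambda>j y. coord 0 y - Q j (coord 0) y" and \<phi> = "\<lambda>N j. shift ^^ j"])
  show "AE y in \<mu>. coord 0 y - Q j (coord 0) y = res 0 {- int j + 1..-1} y" if "1 \<le> j" for j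
    by (rule projection_finite[OF Q[OF that]]) simp
  show "(\<lambda>y. coord 0 y - Q j (coord 0) y) \<in> borel_measurable \<mu>" if "1 \<le> j" for j
    by (rule projection_measurable[OF Q[OF that]])
  show "shift ^^ j \<in> \<mu> \<rightarrow>\<^sub>M \<mu>" "distr \<mu> \<mu> (shift ^^ j) = \<mu>" for j
    using distr_funpow[OF shift_preserving] by blast+
  show "res 0 {- int j + 1..-1} ((shift ^^ j) x) = res (int j) {1..int j - 1} x" for j x
    using res_translate_Icc[of 0 "int j" "- int j + 1" "-1" x] by (simp add: shift_funpow)
qed

end

theorem lemma6p3:
  fixes \<mu> :: "(int \<Rightarrow> real) measure"
    and r :: "int \<Rightarrow> real"
    and \<nu> :: "complex measure"
    and f :: "complex \<Rightarrow> real"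
    and P Q :: "nat \<Rightarrow> ((int \<Rightarrow> real) \<Rightarrow> real) \<Rightarrow> ((int \<Rightarrow> real) \<Rightarrow> real)"
    and Qinf :: "((int \<Rightarrow> real) \<Rightarrow> real) \<Rightarrow> ((int \<Rightarrow> real) \<Rightarrow> real)"
    and F :: "(int \<Rightarrow> real) \<Rightarrow> real"
  assumes r_sym: "\<And>n. r (- n) = r n"
    and r_posdef: "strictly_posdef r"
    and \<mu>_prob: "prob_space \<mu>"
    and \<mu>_sets: "sets \<mu> = sets seq_space"
    and \<mu>_gauss: "centered_gaussian \<mu>"
    and \<mu>_inv: "shift_invariant \<mu>"
    and \<mu>_cov: "has_covariance \<mu> r"
    and \<nu>_spec: "is_spectral_measure r \<nu>"
    and f_dens: "is_ac_density circle_lebesgue \<nu> f"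
    and F_def: "F = coord 0"
    and P_proj: "\<And>n. n \<ge> 1 \<Longrightarrow>
      is_orth_projection \<mu> (closed_coord_span \<mu> {1..int n}) (P n)"
    and Q_proj: "\<And>n. n \<ge> 1 \<Longrightarrow>
      is_orth_projection \<mu> (closed_coord_span \<mu> {- int n + 1..- 1}) (Q n)"
    and Qinf_proj: "is_orth_projection \<mu> (closed_coord_span \<mu> {..- 1}) Qinf"
  shows
    "(convergent (\<lambda>n. ereal (block_entropy \<mu> r n / real n)) \<and>
      shannon_entropy \<mu> r =
        ereal (1/2 * ln (2 * pi)) + ext_ln (norm2 \<mu> (\<lambda>x. F x - Qinf F x)) + ereal (1/2) \<and>
      shannon_entropy \<mu> r =
        ereal (1/2 * ln (2 * pi))
        + ereal (1/2) * ext_integral circle_lebesgue (\<lambda>z. ext_ln (f z)) + ereal (1/2) \<and>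
      (norm2 \<mu> (\<lambda>x. F x - Qinf F x) = 0 \<longrightarrow> shannon_entropy \<mu> r = -\<infinity>))
   \<and> (norm2 \<mu> (\<lambda>x. F x - Qinf F x) > 0 \<longrightarrow>
      (\<forall>converges \<in> {converges_AE \<mu>, converges_L1 \<mu>}.
        let
          c_i = converges (\<lambda>n x. 1 / real n * information r n x);
          c_ii = converges (\<lambda>N x. 1 / real N *
            (\<Sum>j\<in>{1..N-1}. (\<lambda>y. (F y - P j F y)\<^sup>2) ((shift ^^ (N - j)) x)));
          c_iii = converges (\<lambda>N x. 1 / real N *
            (\<Sum>j\<in>{1..N-1}. (\<lambda>y. (F y - P j F y)\<^sup>2) ((the_inv shift ^^ j) x)));
          c_iv = converges (\<lambda>N x. 1 / real N *
            (\<Sum>j\<in>{1..N-1}. (\<lambda>y. (F y - Q j F y)\<^sup>2) ((shift ^^ j) x)));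
          c_v = converges (\<lambda>N x. 1 / real N *
            (\<Sum>n\<in>{2..N}. ln (gauss_density r n x / gauss_density r n (shift x))))
        in (c_i \<longleftrightarrow> c_ii) \<and> (c_ii \<longleftrightarrow> c_iii) \<and> (c_iii \<longleftrightarrow> c_iv) \<and> (c_iv \<longleftrightarrow> c_v)))"
  proof -
  interpret gaussian_seq \<mu> r
    by (rule gaussian_seq.intro[OF r_sym r_posdef \<mu>_prob \<mu>_sets \<mu>_gauss \<mu>_inv \<mu>_cov])
  let ?S = "\<integral>x. (F x - Qinf F x)\<^sup>2 \<partial>\<mu>"
  have lim: "d \<longlonglongrightarrow> ?S" unfolding F_def by (rule d_tendsto[OF Qinf_proj])
  have S: "0 \<le> ?S" by simp
  have norm: "norm2 \<mu> (\<lambda>x. F x - Qinf F x) = sqrt ?S" by (simp add: norm2_def)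
  note E = entropy_limit[OF lim S]
  have se: "shannon_entropy \<mu> r = ereal (1/2 * ln (2 * pi)) + ereal (1/2) * ext_ln ?S + ereal (1/2)"
    unfolding shannon_entropy_def by (rule limI[OF E])
  let "?A \<and> (?N \<longrightarrow> (\<forall>converges \<in> ?C. ?B converges))" = ?thesis
  have A: ?A
  proof (intro conjI impI)
    show "convergent (\<lambda>n. ereal (block_entropy \<mu> r n / real n))"
      by (rule convergentI[OF E])
    show "shannon_entropy \<mu> r =
        ereal (1/2 * ln (2 * pi)) + ext_ln (norm2 \<mu> (\<lambda>x. F x - Qinf F x)) + ereal (1/2)"
      unfolding se norm ext_ln_sqrt[OF S] ..
    show "shannon_entropy \<mu> r =
        ereal (1/2 * ln (2 * pi))
        + ereal (1/2) * ext_integral circle_lebesgue (\<lambda>z. ext_ln (f z)) + ereal (1/2)"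
      unfolding se szego_innovation[OF \<nu>_spec f_dens lim] ..
    assume "norm2 \<mu> (\<lambda>x. F x - Qinf F x) = 0"
    then have "?S = 0" unfolding norm by simp
    then show "shannon_entropy \<mu> r = -\<infinity>" unfolding se by (simp add: ext_ln_def)
  qed
  have B: "?B converges" if "?N" "converges \<in> ?C" for converges
  proof -
    have S: "0 < ?S" using \<open>?N\<close> unfolding norm by simp
    \<comment> \<open>\<open>conv_to\<close> contains both modes of convergence, so the choice of
      \<open>converges\<close> is made only here.\<close>
    have conv: "converges g" if "conv_to \<mu> g h" for g h
      using \<open>converges \<in> ?C\<close> conv_to_AE[OF that] conv_to_L1[OF that] by auto
    obtain h where v: "conv_to \<mu> (\<lambda>N x. 1 / real N *
        (\<Sum>n\<in>{2..N}. ln (gauss_density r n x / gauss_density r n (shift x)))) h"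
      by (rule density_ratio_average[OF lim S])
    note all = conv[OF information_conv[OF lim S]] conv[OF average_ii[OF lim S P_proj]]
      conv[OF average_iii[OF lim P_proj]] conv[OF average_iv[OF lim Q_proj]] conv[OF v]
    show ?thesis unfolding Let_def F_def by (simp only: all simp_thms)
  qed
  show ?thesis
    by (intro conjI[OF A] impI ballI) (rule B)
qed

end
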